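(* Let $\varepsilon>0$ be constant. Let $A$ be an $n\times n$ positive-definite symmetric real matrix and let $T$ be a real matrix such that $T^{\mathrm T}AT=I_n$. Suppose the following assumptions hold for some $m=m(n)\in[n]$, measurable set $\bar\Omega\subseteq\mathbb R^n$, measurable function $f:\mathbb R^n\to\mathbb R$, and quantities $\rho_1,\rho_2,\rho_3,\alpha,b,\hat b,C,\widehat C\ge0$ that are functions of $n$. (i) $U_n(\rho_1)\subseteq T^{-1}(\bar\Omega)\subseteq U_n(\rho_2)\subseteq U_n(\rho_3)$, where $\rho_3\ge\rho_2\ge\rho_1\ge(\log n)^{1/2+\varepsilon}$. (ii) For every $\ell\in[m]$, $$\max_{j\in[n]}\ \sum_{V\in\binom{[n]}{\ell}:\ j\in V}\Delta_V\bigl(f(T\boldsymbol x),U_n(\rho_2)\bigr)\le\alpha<\tfrac1{400}.$$ (iii) $\max\{bm+b^2m^2,\ \hat bm+\hat b^2m^2\}\le n$. (iv) $|f(\boldsymbol x)|\le C e^{b\,\boldsymbol x^{\mathrm T}A\boldsymbol x/n}$ for all $\boldsymbol x\in\mathbb R^n$, and $|f(\boldsymbol x)|\le\widehat C e^{\hat b\,\boldsymbol x^{\mathrm T}A\boldsymbol x/n}$ for all $\boldsymbol x\in T(U_n(\rho_3))$. Then for sufficiently large $n$ we have $$\int_{\bar\Omega}e^{-\boldsymbol x^{\mathrm T}A\boldsymbol x+f(\boldsymbol x)}\,d\boldsymbol x=\pi^{n/2}|A|^{-1/2}\exp\left(\sum_{r=1}^m\frac{\kappa_r(f(\boldsymbol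 X))}{r!}+\delta\right),$$ where $\boldsymbol X$ is a random vector with the Gaussian density $\pi^{-n/2}|A|^{1/2}e^{-\boldsymbol x^{\mathrm T}A\boldsymbol x}$, and $$|\delta|\le 2n(100\alpha)^{m+1}+e^{-\rho_1^2/2}+6^m\left((C^m+C)\,e^{-(\rho_3^2-bm)/2}+(\widehat C^m+\widehat C)\,e^{-(\rho_1^2-\hat bm)/2}\right).$$
   Context: $[n]=\{1,\dots,n\}$, $\binom{[n]}{\ell}$ is the set of $\ell$-element subsets of $[n]$, $|A|$ is the determinant of $A$, and $U_n(\rho):=\{\boldsymbol x\in\mathbb R^n:\|\boldsymbol x\|_\infty\le\rho\}$. $\kappa_r(Z)=r!\,[t^r]\log\mathbf E[e^{tZ}]$ (formally, in terms of moments) is the $r$-th cumulant of $Z$. For a product set $\boldsymbol S=S_1\times\cdots\times S_n$ and $g:\boldsymbol S\to\mathbb R$: for $\boldsymbol y\in\boldsymbol S$, $R^j_{\boldsymbol y}[g](\boldsymbol x)=g(x_1,\dots,x_{j-1},y_j,x_{j+1},\dots,x_n)$, $\partial^j_{\boldsymbol y}:=I-R^j_{\boldsymbol y}$, $\partial^V_{\boldsymbol y}:=\prod_{j\in V}\partial^j_{\boldsymbol y}$ for $V\subseteq[n]$, and $\Delta_V(g,\boldsymbol S):=\sup_{\boldsymbol x,\boldsymbol y\in\boldsymbol S}|\partial^V_{\boldsymbol y}[g](\boldsymbol x)|$. In (ii) this is applied to the function $\boldsymbol x\mapsto f(T\boldsymbol x)$ on $\boldsymbol S=U_n(\rho_2)$.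 *)

theory Defs
  imports
    "HOL-Analysis.Embed_Measure"
    "HOL-Analysis.Complete_Measure"
    "HOL-Analysis.Lebesgue_Measure"
    "HOL-Analysis.Set_Integral"
    "HOL-Computational_Algebra.Formal_Power_Series"
    "Jordan_Normal_Form.Determinant"
begin

text \<open>
  The dimension \<open>n\<close> is a variable of the theorem, so the space of real \<open>n\<close>-vectors is
  \<open>carrier_vec n\<close> and an \<open>n \<times> n\<close> matrix is an element of \<open>carrier_mat n n\<close>.
  The index set \<open>{1, \<dots>, n}\<close> becomes \<open>{..<n}\<close>.
\<close>

text \<open>
  Lebesgue measure on \<open>carrier_vec n\<close>: the \<open>n\<close>-fold product of Borel--Lebesgue measure, carried
  over to vectors by the bijection \<open>Matrix.vec n\<close> and completed, so that ``measurable'' means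
  Lebesgue measurable.
\<close>
definition lebesgue_vec :: "nat \<Rightarrow> real Matrix.vec measure" where
  "lebesgue_vec n = completion (embed_measure (\<Pi>\<^sub>M i\<in>{..<n}. lborel) (Matrix.vec n))"

lemma inj_on_vec: "inj_on (Matrix.vec n) (space (\<Pi>\<^sub>M i\<in>{..<n}. (lborel :: real measure)))"
proof (rule inj_onI)
  fix x y assume x: "x \<in> space (\<Pi>\<^sub>M i\<in>{..<n}. (lborel :: real measure))"
    and y: "y \<in> space (\<Pi>\<^sub>M i\<in>{..<n}. (lborel :: real measure))"
    and eq: "Matrix.vec n x = Matrix.vec n y"
  have "x i = y i" if "i < n" for i
    using arg_cong[OF eq, of "\<lambda>v. Matrix.vec_index v i"] that by simp
  then show "x = y"
    using x y by (intro PiE_ext[of x "{..<n}" "\<lambda>_. UNIV" y]) (auto simp: space_PiM)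
qed

lemma space_lebesgue_vec: "space (lebesgue_vec n) = carrier_vec n"
proof -
  have "v \<in> Matrix.vec n ` ({..<n} \<rightarrow>\<^sub>E UNIV)" if "v \<in> carrier_vec n" for v :: "real Matrix.vec"
  proof (rule image_eqI)
    show "v = Matrix.vec n (\<lambda>i\<in>{..<n}. Matrix.vec_index v i)"
      using that by (intro eq_vecI) auto
  qed auto
  then show ?thesis
    by (auto simp: lebesgue_vec_def space_embed_measure space_PiM)
qed

definition positive_definite :: "nat \<Rightarrow> real mat \<Rightarrow> bool" where
  "positive_definite n A \<longleftrightarrow> A \<in> carrier_mat n n \<and>
     (\<forall>x\<in>carrier_vec n. x \<noteq> 0\<^sub>v n \<longrightarrow> scalar_prod x (A *\<^sub>v x) > 0)"

definition sup_box :: "nat \<Rightarrow> real \<Rightarrow> real Matrix.vec set" where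
  "sup_box n \<rho> = {x \<in> carrier_vec n. \<forall>i<n. \<bar>Matrix.vec_index x i\<bar> \<le> \<rho>}"

definition replace_coord ::
  "nat \<Rightarrow> real Matrix.vec \<Rightarrow> (real Matrix.vec \<Rightarrow> real) \<Rightarrow> real Matrix.vec \<Rightarrow> real" where
  "replace_coord j y g x =
     g (Matrix.vec (dim_vec x) (\<lambda>i. if i = j then Matrix.vec_index y i else Matrix.vec_index x i))"

definition coord_diff ::
  "nat \<Rightarrow> real Matrix.vec \<Rightarrow> (real Matrix.vec \<Rightarrow> real) \<Rightarrow> real Matrix.vec \<Rightarrow> real" where
  "coord_diff j y g = (\<lambda>x. g x - replace_coord j y g x)"

text \<open>
  The product (composition) of the operators \<open>coord_diff j y\<close> over \<open>j \<in> V\<close>; the order is irrelevant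
  because they commute.
\<close>
definition coord_diffs ::
  "nat set \<Rightarrow> real Matrix.vec \<Rightarrow> (real Matrix.vec \<Rightarrow> real) \<Rightarrow> real Matrix.vec \<Rightarrow> real" where
  "coord_diffs V y g = Finite_Set.fold (\<lambda>j. coord_diff j y) g V"

lemma comp_fun_commute_coord_diff: "comp_fun_commute (\<lambda>j. coord_diff j y)"
proof
  fix i j
  have "replace_coord i y (replace_coord j y g) x = replace_coord j y (replace_coord i y g) x" for g x
    unfolding replace_coord_def by (intro arg_cong[where f = g] eq_vecI) auto
  moreover have "replace_coord k y (coord_diff l y g) x =
      replace_coord k y g x - replace_coord k y (replace_coord l y g) x" for k l g x
    by (simp add: replace_coord_def coord_diff_def)
  ultimately show "coord_diff j y \<circ> coord_diff i y = coord_diff i y \<circ> coord_diff j y"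
    by (simp add: fun_eq_iff coord_diff_def)
qed

lemma coord_diffs_empty: "coord_diffs {} y g = g"
  by (simp add: coord_diffs_def)

lemma coord_diffs_insert:
  "finite V \<Longrightarrow> j \<notin> V \<Longrightarrow> coord_diffs (insert j V) y g = coord_diff j y (coord_diffs V y g)"
  unfolding coord_diffs_def
  by (rule comp_fun_commute_on.fold_insert[OF comp_fun_commute_coord_diff[unfolded comp_fun_commute_def']]) auto

text \<open>The supremum is taken in \<open>ereal\<close>, so that it is infinite for unbounded differences.\<close>
definition Delta :: "nat set \<Rightarrow> (real Matrix.vec \<Rightarrow> real) \<Rightarrow> real Matrix.vec set \<Rightarrow> ereal" where
  "Delta V g S = (SUP (x, y)\<in>S \<times> S. ereal \<bar>coord_diffs V y g x\<bar>)"

text \<open>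
  The series \<open>E[exp(tZ)]\<close> in terms of the moments of \<open>Z\<close> under \<open>M\<close>, and the cumulants as the
  coefficients of its formal logarithm; \<open>fps_ln 1\<close> is the series of \<open>ln (1 + t)\<close>.
\<close>
definition moment_series :: "'a measure \<Rightarrow> ('a \<Rightarrow> real) \<Rightarrow> real fps" where
  "moment_series M Z = Abs_fps (\<lambda>k. (LINT \<omega>|M. Z \<omega> ^ k) / fact k)"

definition cumulant :: "nat \<Rightarrow> 'a measure \<Rightarrow> ('a \<Rightarrow> real) \<Rightarrow> real" where
  "cumulant r M Z = fact r * fps_nth (fps_compose (fps_ln 1) (moment_series M Z - 1)) r"

text \<open>The law of a random vector with density \<open>pi^(-n/2) |A|^(1/2) exp(- x^T A x)\<close>.\<close>
definition gaussian_vec :: "nat \<Rightarrow> real mat \<Rightarrow> real Matrix.vec measure" where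
  "gaussian_vec n A = density (lebesgue_vec n)
     (\<lambda>x. ennreal (pi powr (- (real n / 2)) * Determinant.det A powr (1 / 2)
                   * exp (- scalar_prod x (A *\<^sub>v x))))"

end

theory Submission
  imports Defs "HOL-Probability.Probability"
begin

text \<open>
  Put \<open>x = T z\<close> and \<open>g z = f (T z)\<close>. Since \<open>T\<^sup>T A T = 1\<close>, the quadratic form becomes \<open>\<Sum>i. (z i)\<^sup>2\<close>, and
  apart from the factor \<open>pi^(n/2) |A|^(-1/2)\<close> the integral is \<open>E[1_Om e^g]\<close>, where the coordinates of
  \<open>z\<close> are independent with law \<open>N(0, 1/2)\<close> and \<open>Om\<close> lies between two cubes. The heart of the matter
  is a statement about independent coordinates: if the mixed differences of \<open>g\<close> satisfy
  \<open>\<Sum>V\<ni>j, |V|=l. \<Delta>\<^sub>V(g) \<le> \<alpha>\<close> for all \<open>j\<close> and all \<open>1 \<le> l \<le> m\<close>, then \<open>ln E[e^g]\<close> is the sum of the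
  \<open>\<kappa>\<^sub>r(g)/r!\<close> over \<open>r \<le> m\<close> up to \<open>(5/2) n (50\<alpha>)^(m+1)\<close>.

  To see this, integrate out one coordinate after the other. Let \<open>H\<^sub>k\<close> be the formal logarithm of the
  conditional expectation of \<open>e^(t g)\<close> after the first \<open>k\<close> coordinates have been averaged out: a power
  series in \<open>t\<close> whose coefficients are functions of the other coordinates. Then \<open>H\<^sub>0 = t g\<close>, and the
  coefficients of \<open>H\<^sub>n\<close> are the \<open>\<kappa>\<^sub>r(g)/r!\<close>. Write \<open>p\<^sub>k\<close> for the sum of the coefficients of \<open>H\<^sub>k\<close> up to
  \<open>t^m\<close>. If \<open>ln E\<^sub>k[exp p\<^sub>k]\<close> differs from \<open>p\<^bsub>k+1\<^esub>\<close> by at most \<open>\<eta>\<close> in every step, then, because averages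
  are monotone, \<open>ln E[e^g]\<close> differs from \<open>p\<^sub>n\<close> by at most \<open>n \<eta>\<close>.

  Both the size of \<open>\<eta>\<close> and the feasibility of the induction rest on one norm. Give the coefficient of
  \<open>t^r\<close> in \<open>H\<close>, differenced along \<open>V\<close>, the weight \<open>R^r (1/2)^(|V|-1)\<close>, and for each \<open>j\<close> sum these
  weighted maxima over all \<open>V\<close> that contain \<open>j\<close>. Initially this is at most \<open>2 R \<alpha> \<le> 1/25\<close>. In one step
  \<open>H' = E\<^sub>i H + L\<close>, where \<open>L = ln E\<^sub>i[exp (H - E\<^sub>i H)]\<close> starts with a quadratic term. The differences
  of \<open>H - E\<^sub>i H\<close> along \<open>V\<close> are bounded by those of \<open>H\<close> along \<open>insert i V\<close>; the sets containing \<open>i\<close>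
  leave the norm at this step, and what they contributed pays for \<open>L\<close> with room to spare. So the norm
  never increases (\<open>log_mean_exp_step\<close>), and a series of norm at most \<open>1/25\<close> can be truncated at order
  \<open>m\<close> inside an exponential with an error \<open>O(R^(-(m+1)))\<close> (\<open>fexp_truncation_error\<close>). Choosing
  \<open>R = 1/(50\<alpha>)\<close> gives the bound.

  This induction (\<open>cumulant_expansion\<close>) is carried out for finite products, where all maxima exist. The
  general case follows by discretizing the product space (\<open>discretize_product\<close>,
  \<open>cumulant_expansion_PiM\<close>). This detour is natural because \<open>f\<close> is only Lebesgue measurable while the
  bounds on its differences are pointwise: grids can be chosen to avoid a given null set.

  For the Gaussian integral (\<open>gaussian_cumulant_expansion\<close>) the expansion is applied to the law
  conditioned on the cube of radius \<open>\<rho>\<^sub>2\<close>, which is again a product law. Replacing this cube by \<open>Om\<close>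
  costs little since changing one coordinate changes \<open>g\<close> by at most \<open>\<alpha>\<close>, so that one-dimensional
  Gaussian tails survive the tilt by \<open>e^g\<close> (\<open>tilted_tail_le\<close>). Finally the conditional cumulants on the
  cube of radius \<open>\<rho>\<^sub>2\<close> are compared with those on the cube of radius \<open>\<rho>\<^sub>3\<close>, and these with the
  unconditional ones, by means of the growth bounds on \<open>f\<close> (\<open>cumulants_box_compare\<close>).
\<close>

section \<open>Formal exponential and logarithm\<close>

text \<open>
  A linear differential equation determines all coefficients of a power series from the constant one.
  This replaces manipulations of composed series in the proof of \<open>fexp_add\<close>.
\<close>
lemma fps_linear_ode_unique:
  fixes f g d :: "real fps"
  assumes f: "fps_deriv f = d * f" and g: "fps_deriv g = d * g" and 0: "fps_nth f 0 = fps_nth g 0"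
  shows "f = g"
proof -
  define h where "h = f - g"
  have h: "fps_deriv h = d * h" by (simp add: h_def f g algebra_simps)
  have "fps_nth h n = 0" for n
  proof (induction n rule: less_induct)
    case (less n)
    show ?case
    proof (cases n)
      case 0 then show ?thesis using assms(3) by (simp add: h_def)
    next
      case (Suc k)
      have "of_nat (Suc k) * fps_nth h (Suc k) = fps_nth (d * h) k"
        by (metis h fps_deriv_nth Suc_eq_plus1)
      also have "\<dots> = 0"
        unfolding fps_mult_nth using less Suc by (intro sum.neutral) auto
      finally show ?thesis using Suc by simp
    qed
  qed
  then show ?thesis by (simp add: h_def fps_eq_iff)
qed

abbreviation fexp :: "real fps \<Rightarrow> real fps" where "fexp a \<equiv> fps_compose (fps_exp 1) a"
abbreviation fln :: "real fps \<Rightarrow> real fps" where "fln a \<equiv> fps_compose (fps_ln 1) a"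

lemma fexp_add:
  assumes "fps_nth a 0 = 0" "fps_nth b 0 = 0"
  shows "fexp (a + b) = fexp a * fexp b"
proof (rule fps_linear_ode_unique[where d = "fps_deriv (a + b)"])
  have d: "fps_deriv (fexp c) = fps_deriv c * fexp c" if "fps_nth c 0 = 0" for c
    using fps_compose_deriv[OF that, of "fps_exp 1"] by simp
  show "fps_deriv (fexp (a + b)) = fps_deriv (a + b) * fexp (a + b)"
    by (rule d) (simp add: assms)
  show "fps_deriv (fexp a * fexp b) = fps_deriv (a + b) * (fexp a * fexp b)"
    by (simp add: d assms algebra_simps)
qed simp

text \<open>
  \<open>ln (1 + t)\<close> and \<open>e^t - 1\<close> are inverse to each other under composition, and composition is associative.
\<close>
lemma fexp_fln:
  assumes "fps_nth w 0 = 0"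
  shows "fexp (fln w) = 1 + w"
proof -
  have "fps_ln 1 = fps_inv (fps_exp 1 - 1 :: real fps)" by (rule fps_ln_fps_exp_inv) simp
  then have "fps_compose (fps_exp 1 - 1) (fps_ln 1 :: real fps) = fps_X"
    using fps_inv_right[of "fps_exp 1 - 1 :: real fps"] by simp
  then have "fps_compose (fps_exp 1 - 1 :: real fps) (fln w) = w"
    using fps_compose_assoc[of w "fps_ln 1" "fps_exp 1 - 1"] assms
    by (simp add: fps_X_fps_compose_startby0)
  then show ?thesis by (simp add: fps_compose_sub_distrib algebra_simps)
qed

lemma fln_fexp:
  assumes "fps_nth h 0 = 0"
  shows "fln (fexp h - 1) = h"
proof -
  have "fps_ln 1 = fps_inv (fps_exp 1 - 1 :: real fps)" by (rule fps_ln_fps_exp_inv) simp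
  then have "fps_compose (fps_ln 1 :: real fps) (fps_exp 1 - 1) = fps_X"
    using fps_inv[of "fps_exp 1 - 1 :: real fps"] by simp
  then show ?thesis
    using fps_compose_assoc[of h "fps_exp 1 - 1 :: real fps" "fps_ln 1"] assms
    by (simp add: fps_X_fps_compose_startby0 fps_compose_sub_distrib)
qed

section \<open>Truncation inside an exponential\<close>

text \<open>
  Every discarded term has degree at least \<open>m + 1\<close>, so the weight \<open>R^r\<close> in the norm exceeds \<open>R^(m+1)\<close>.
\<close>
lemma poly_truncate_bound:
  fixes p :: "real poly"
  assumes "R \<ge> 1"
  shows "\<bar>poly p 1 - (\<Sum>r\<le>m. coeff p r)\<bar> * R ^ (m + 1) \<le> (\<Sum>r\<le>degree p. \<bar>coeff p r\<bar> * R ^ r)"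
proof -
  define N where "N = max m (degree p)"
  have "poly p 1 = (\<Sum>r\<le>degree p. coeff p r)" by (simp add: poly_altdef)
  also have "\<dots> = (\<Sum>r\<le>N. coeff p r)"
    by (rule sum.mono_neutral_left) (auto simp: N_def coeff_eq_0)
  also have "\<dots> = (\<Sum>r\<le>m. coeff p r) + (\<Sum>r\<in>{m<..N}. coeff p r)"
    by (subst sum.union_disjoint[symmetric]) (auto intro!: sum.cong simp: N_def)
  finally have "\<bar>poly p 1 - (\<Sum>r\<le>m. coeff p r)\<bar> = \<bar>\<Sum>r\<in>{m<..N}. coeff p r\<bar>" by simp
  also have "\<dots> \<le> (\<Sum>r\<in>{m<..N}. \<bar>coeff p r\<bar>)" by (rule sum_abs)
  finally have "\<bar>poly p 1 - (\<Sum>r\<le>m. coeff p r)\<bar> * R ^ (m + 1) \<le> (\<Sum>r\<in>{m<..N}. \<bar>coeff p r\<bar>) * R ^ (m+1)"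
    using assms by (intro mult_right_mono) auto
  also have "\<dots> \<le> (\<Sum>r\<in>{m<..N}. \<bar>coeff p r\<bar> * R ^ r)"
    unfolding sum_distrib_right using assms
    by (intro sum_mono mult_left_mono power_increasing) auto
  also have "\<dots> \<le> (\<Sum>r\<le>N. \<bar>coeff p r\<bar> * R ^ r)"
    using assms by (intro sum_mono2) auto
  also have "\<dots> = (\<Sum>r\<le>degree p. \<bar>coeff p r\<bar> * R ^ r)"
    by (rule sum.mono_neutral_right) (auto simp: N_def coeff_eq_0)
  finally show ?thesis .
qed

lemma poly_l1_norm_mult_le:
  fixes p q :: "real poly"
  assumes "R \<ge> 0"
  shows "(\<Sum>r\<le>degree (p * q). \<bar>coeff (p * q) r\<bar> * R ^ r)
    \<le> (\<Sum>r\<le>degree p. \<bar>coeff p r\<bar> * R ^ r) * (\<Sum>r\<le>degree q. \<bar>coeff q r\<bar> * R ^ r)"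
proof -
  define p' where "p' = map_poly abs p"
  define q' where "q' = map_poly abs q"
  have ev: "poly (map_poly abs u) R = (\<Sum>r\<le>degree u. \<bar>coeff u r\<bar> * R ^ r)" for u :: "real poly"
  proof -
    have "degree (map_poly abs u) = degree u" by (rule degree_map_poly) auto
    then show ?thesis by (simp add: poly_altdef coeff_map_poly)
  qed
  have ext: "(\<Sum>r\<le>degree (p * q). \<bar>coeff (p * q) r\<bar> * R ^ r) \<le> (\<Sum>r\<le>degree (p'*q'). coeff (p' * q') r * R ^ r)"
  proof -
    have 1: "\<bar>coeff (p * q) r\<bar> \<le> coeff (p' * q') r" for r
      unfolding coeff_mult p'_def q'_def
      by (rule order_trans[OF sum_abs]) (simp add: coeff_map_poly abs_mult)
    define N where "N = max (degree (p*q)) (degree (p'*q'))"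
    have "(\<Sum>r\<le>degree (p * q). \<bar>coeff (p * q) r\<bar> * R ^ r) = (\<Sum>r\<le>N. \<bar>coeff (p * q) r\<bar> * R ^ r)"
      by (rule sum.mono_neutral_left) (auto simp: N_def coeff_eq_0)
    also have "\<dots> \<le> (\<Sum>r\<le>N. coeff (p' * q') r * R ^ r)"
      using 1 assms by (intro sum_mono mult_right_mono) auto
    also have "\<dots> = (\<Sum>r\<le>degree (p'*q'). coeff (p' * q') r * R ^ r)"
      by (rule sum.mono_neutral_right) (auto simp: N_def coeff_eq_0)
    finally show ?thesis .
  qed
  also have "\<dots> = poly (p' * q') R" by (simp add: poly_altdef)
  finally show ?thesis by (simp add: ev p'_def q'_def)
qed

text \<open>
  Truncating the exponent at order \<open>m\<close> and truncating the formal exponential at order \<open>m\<close> nearly commute.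
  Expand the exponential of the truncated exponent \<open>p\<close> into powers \<open>p^q / q!\<close>. Up to order \<open>m\<close> the
  coefficients of \<open>p^q\<close> and of \<open>a^q\<close> coincide, and the part of \<open>p^q\<close> of higher order is controlled by
  the weighted \<open>l\<^sup>1\<close> norm, which is submultiplicative: it is at most \<open>K^q\<close>. Summing over \<open>q\<close> gives
  \<open>e^K\<close>.
\<close>
lemma fexp_truncation_error:
  fixes a :: "real fps"
  assumes a0: "fps_nth a 0 = 0" and R: "R \<ge> 1" and K: "(\<Sum>r=1..m. \<bar>fps_nth a r\<bar> * R ^ r) \<le> K"
  shows "\<bar>exp (\<Sum>r=1..m. fps_nth a r) - (\<Sum>r\<le>m. fps_nth (fexp a) r)\<bar> * R ^ (m + 1) \<le> exp K"
proof -
  define p :: "real poly" where "p = (\<Sum>r=1..m. monom (fps_nth a r) r)"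
  have cp: "coeff p r = (if 1 \<le> r \<and> r \<le> m then fps_nth a r else 0)" for r
    unfolding p_def coeff_sum by simp
  have dp: "degree p \<le> m" by (rule degree_le) (auto simp: cp)
  have p1: "poly p 1 = (\<Sum>r=1..m. fps_nth a r)" by (simp add: p_def poly_sum poly_monom)
  have norm1: "(\<Sum>r\<le>degree p. \<bar>coeff p r\<bar> * R ^ r) \<le> K"
  proof -
    have "(\<Sum>r\<le>degree p. \<bar>coeff p r\<bar> * R ^ r) = (\<Sum>r\<le>m. \<bar>coeff p r\<bar> * R ^ r)"
      using dp by (intro sum.mono_neutral_left) (auto simp: coeff_eq_0)
    also have "\<dots> = (\<Sum>r=1..m. \<bar>fps_nth a r\<bar> * R ^ r)"
      by (intro sum.mono_neutral_cong_right) (auto simp: cp)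
    finally show ?thesis using K by simp
  qed
  have K0: "K \<ge> 0" by (rule order_trans[OF _ norm1]) (use R in \<open>auto intro!: sum_nonneg\<close>)
  have normq: "(\<Sum>r\<le>degree (p ^ q). \<bar>coeff (p ^ q) r\<bar> * R ^ r) \<le> K ^ q" for q
  proof (induction q)
    case (Suc q)
    have "(\<Sum>r\<le>degree (p ^ Suc q). \<bar>coeff (p ^ Suc q) r\<bar> * R ^ r)
      \<le> (\<Sum>r\<le>degree p. \<bar>coeff p r\<bar> * R ^ r) * (\<Sum>r\<le>degree (p^q). \<bar>coeff (p ^ q) r\<bar> * R ^ r)"
      unfolding power_Suc by (rule poly_l1_norm_mult_le) (use R in auto)
    also have "\<dots> \<le> K * K ^ q"
      using R by (intro mult_mono norm1 Suc K0 sum_nonneg) auto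
    finally show ?case by simp
  qed simp
  have coeffpow: "coeff (p ^ q) r = fps_nth (a ^ q) r" if "r \<le> m" for q r
    using that
  proof (induction q arbitrary: r)
    case 0 then show ?case by (auto simp: coeff_1)
  next
    case (Suc q)
    show ?case unfolding power_Suc coeff_mult fps_mult_nth atLeast0AtMost[symmetric]
      by (intro sum.cong) (use Suc a0 in \<open>auto simp: cp Suc_le_eq\<close>)
  qed
  have Exp_nth: "fps_nth (fexp a) r = (\<Sum>q\<le>m. fps_nth (a ^ q) r / fact q)" if "r \<le> m" for r
  proof -
    have "fps_nth (fexp a) r = (\<Sum>q=0..r. fps_nth (a ^ q) r / fact q)"
      by (simp add: fps_compose_nth)
    also have "\<dots> = (\<Sum>q\<le>m. fps_nth (a ^ q) r / fact q)"
      using that a0 by (intro sum.mono_neutral_left) (auto simp: startsby_zero_power_prefix)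
    finally show ?thesis .
  qed
  define T where "T q = poly p 1 ^ q - (\<Sum>r\<le>m. fps_nth (a ^ q) r)" for q
  have T: "\<bar>T q\<bar> * R ^ (m + 1) \<le> K ^ q" for q
  proof -
    have "T q = poly (p ^ q) 1 - (\<Sum>r\<le>m. coeff (p ^ q) r)"
      by (simp add: T_def coeffpow)
    then show ?thesis using poly_truncate_bound[OF R, of "p ^ q" m] normq[of q] by simp
  qed
  \<comment> \<open>For \<open>q > m\<close> the power \<open>a^q\<close> has no terms of order at most \<open>m\<close>, so \<open>T q\<close> is all of \<open>p^q\<close>.\<close>
  have Tm: "T q = poly p 1 ^ q" if "q > m" for q
    unfolding T_def using that a0 by (simp add: startsby_zero_power_prefix)
  have s1: "(\<lambda>q. poly p 1 ^ q / fact q) sums exp (poly p 1)"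
    using exp_converges[of "poly p 1"] by (simp add: scaleR_conv_of_real field_simps)
  have s2: "(\<lambda>q. if q \<in> {..m} then (\<Sum>r\<le>m. fps_nth (a ^ q) r) / fact q else 0)
      sums (\<Sum>q\<le>m. (\<Sum>r\<le>m. fps_nth (a ^ q) r) / fact q)"
    by (rule sums_If_finite_set) simp
  have e2: "(\<Sum>q\<le>m. (\<Sum>r\<le>m. fps_nth (a ^ q) r) / fact q) = (\<Sum>r\<le>m. fps_nth (fexp a) r)"
    by (simp add: Exp_nth sum_divide_distrib) (rule sum.swap)
  have "(\<lambda>q. poly p 1 ^ q / fact q - (if q \<in> {..m} then (\<Sum>r\<le>m. fps_nth (a ^ q) r) / fact q else 0))
      sums (exp (poly p 1) - (\<Sum>r\<le>m. fps_nth (fexp a) r))"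
    using sums_diff[OF s1 s2] by (simp add: e2)
  moreover have "poly p 1 ^ q / fact q - (if q \<in> {..m} then (\<Sum>r\<le>m. fps_nth (a ^ q) r) / fact q else 0) = T q / fact q" for q
    using Tm[of q] by (auto simp: T_def diff_divide_distrib)
  ultimately have s3: "(\<lambda>q. T q / fact q) sums (exp (poly p 1) - (\<Sum>r\<le>m. fps_nth (fexp a) r))" by simp
  have s4: "(\<lambda>q. K ^ q / fact q) sums exp K"
    using exp_converges[of K] by (simp add: scaleR_conv_of_real field_simps)
  have s5: "(\<lambda>q. T q / fact q * R ^ (m+1)) sums ((exp (poly p 1) - (\<Sum>r\<le>m. fps_nth (fexp a) r)) * R ^ (m+1))"
    by (rule sums_mult2[OF s3])
  have "norm ((exp (poly p 1) - (\<Sum>r\<le>m. fps_nth (fexp a) r)) * R ^ (m+1)) \<le> exp K"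
  proof -
    have "norm (suminf (\<lambda>q. T q / fact q * R ^ (m+1))) \<le> suminf (\<lambda>q. K ^ q / fact q)"
    proof (rule norm_suminf_le)
      show "norm (T q / fact q * R ^ (m+1)) \<le> K ^ q / fact q" for q
        using T[of q] R by (simp add: abs_mult divide_right_mono)
      show "summable (\<lambda>q. K ^ q / fact q)" using s4 by (rule sums_summable)
    qed
    then show ?thesis using s5 s4 by (simp add: sums_iff)
  qed
  then show ?thesis using R by (simp add: p1 abs_mult)
qed

section \<open>Mixed differences\<close>

text \<open>
  The operator \<open>\<partial>\<^sup>V\<close> expanded by inclusion and exclusion over the set \<open>W\<close> of coordinates taken from \<open>y\<close>.
  In this form it needs neither an order of the coordinates nor commutation of the factors.
\<close>
definition mixed_diff :: "nat set \<Rightarrow> (nat \<Rightarrow> 'a) \<Rightarrow> ((nat \<Rightarrow> 'a) \<Rightarrow> real) \<Rightarrow> (nat \<Rightarrow> 'a) \<Rightarrow> real" where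
  "mixed_diff V y f x = (\<Sum>W\<in>Pow V. (-1) ^ card W * f (override_on x y W))"

lemma mixed_diff_empty [simp]: "mixed_diff {} y f x = f x"
  by (simp add: mixed_diff_def)

lemma override_on_insert_upd: "override_on x y (insert j W) = override_on (x(j := y j)) y W"
  by (auto simp: override_on_def)

lemma mixed_diff_insert:
  assumes "finite V" "j \<notin> V"
  shows "mixed_diff (insert j V) y f x = mixed_diff V y f x - mixed_diff V y f (x(j := y j))"
proof -
  have inj: "inj_on (insert j) (Pow V)" using assms by (auto simp: inj_on_def)
  have "mixed_diff (insert j V) y f x = (\<Sum>W\<in>Pow V. (-1) ^ card W * f (override_on x y W))
     + (\<Sum>W\<in>insert j ` Pow V. (-1) ^ card W * f (override_on x y W))"
    unfolding mixed_diff_def Pow_insert using assms by (intro sum.union_disjoint) auto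
  also have "(\<Sum>W\<in>insert j ` Pow V. (-1) ^ card W * f (override_on x y W))
     = (\<Sum>W\<in>Pow V. - ((-1) ^ card W * f (override_on (x(j := y j)) y W)))"
  proof (subst sum.reindex[OF inj], intro sum.cong refl)
    fix W assume "W \<in> Pow V"
    then have "finite W" "j \<notin> W" using assms by (auto intro: finite_subset)
    then show "((\<lambda>W. (-1) ^ card W * f (override_on x y W)) \<circ> insert j) W =
        - ((-1) ^ card W * f (override_on (x(j := y j)) y W))"
      by (simp add: override_on_insert_upd)
  qed
  finally show ?thesis by (simp add: mixed_diff_def sum_negf)
qed

lemma mixed_diff_sum: "mixed_diff V y (\<lambda>x. \<Sum>i\<in>I. f i x) x = (\<Sum>i\<in>I. mixed_diff V y (f i) x)"
  unfolding mixed_diff_def by (simp add: sum_distrib_left) (rule sum.swap)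

lemma mixed_diff_cmult: "mixed_diff V y (\<lambda>x. c * f x) x = c * mixed_diff V y f x"
  unfolding mixed_diff_def by (simp add: sum_distrib_left mult.left_commute)

lemma mixed_diff_add: "mixed_diff V y (\<lambda>x. f x + g x) x = mixed_diff V y f x + mixed_diff V y g x"
  unfolding mixed_diff_def by (simp add: algebra_simps sum.distrib)

lemma mixed_diff_diff: "mixed_diff V y (\<lambda>x. f x - g x) x = mixed_diff V y f x - mixed_diff V y g x"
  unfolding mixed_diff_def by (simp add: algebra_simps sum_subtractf)

lemma mixed_diff_upd_irrelevant:
  assumes "i \<notin> V" shows "mixed_diff V (y(i := a)) f x = mixed_diff V y f x"
  unfolding mixed_diff_def
proof (intro sum.cong refl)
  fix W assume "W \<in> Pow V"
  then have "override_on x (y(i := a)) W = override_on x y W"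
    using assms by (auto simp: override_on_def fun_eq_iff)
  then show "(-1) ^ card W * f (override_on x (y(i := a)) W) = (-1) ^ card W * f (override_on x y W)" by simp
qed

text \<open>
  Leibniz rule: a difference of a product splits into differences of the factors, the coordinates in \<open>V\<close>
  being distributed among them. The shift of the second factor to \<open>override_on x y U\<close> is harmless below,
  where only maxima over all points matter.
\<close>
lemma mixed_diff_mult:
  assumes "finite V"
  shows "mixed_diff V y (\<lambda>x. f x * g x) x = (\<Sum>U\<in>Pow V. mixed_diff U y f x * mixed_diff (V - U) y g (override_on x y U))"
  using assms
proof (induction V arbitrary: x rule: finite_induct)
  case empty then show ?case by simp
next
  case (insert j V)
  define x' where "x' = x(j := y j)"
  have inj: "inj_on (insert j) (Pow V)"
    using insert(2) by (intro inj_onI) (metis PowD insert_ident subsetD)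
  have "(\<Sum>U\<in>Pow (insert j V). mixed_diff U y f x * mixed_diff (insert j V - U) y g (override_on x y U))
    = (\<Sum>U\<in>Pow V. mixed_diff U y f x * mixed_diff (insert j V - U) y g (override_on x y U))
    + (\<Sum>U\<in>insert j ` Pow V. mixed_diff U y f x * mixed_diff (insert j V - U) y g (override_on x y U))"
    unfolding Pow_insert using insert by (intro sum.union_disjoint) auto
  also have "(\<Sum>U\<in>insert j ` Pow V. mixed_diff U y f x * mixed_diff (insert j V - U) y g (override_on x y U))
    = (\<Sum>U\<in>Pow V. mixed_diff (insert j U) y f x * mixed_diff (insert j V - insert j U) y g (override_on x y (insert j U)))"
    by (subst sum.reindex[OF inj]) simp
  also have "\<dots> = (\<Sum>U\<in>Pow V. (mixed_diff U y f x - mixed_diff U y f x') * mixed_diff (V - U) y g (override_on x' y U))"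
  proof (intro sum.cong refl)
    fix U assume U: "U \<in> Pow V"
    then have "finite U" "j \<notin> U" using insert by (auto intro: finite_subset)
    moreover have "insert j V - insert j U = V - U" using insert by auto
    ultimately show "mixed_diff (insert j U) y f x * mixed_diff (insert j V - insert j U) y g (override_on x y (insert j U))
      = (mixed_diff U y f x - mixed_diff U y f x') * mixed_diff (V - U) y g (override_on x' y U)"
      by (simp add: mixed_diff_insert override_on_insert_upd x'_def)
  qed
  also have "(\<Sum>U\<in>Pow V. mixed_diff U y f x * mixed_diff (insert j V - U) y g (override_on x y U)) =
    (\<Sum>U\<in>Pow V. mixed_diff U y f x * (mixed_diff (V - U) y g (override_on x y U) - mixed_diff (V - U) y g (override_on x' y U)))"
  proof (intro sum.cong refl)
    fix U assume U: "U \<in> Pow V"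
    then have 1: "finite (V - U)" "j \<notin> V - U" using insert by auto
    have 2: "insert j V - U = insert j (V - U)" using U insert by auto
    have 3: "(override_on x y U)(j := y j) = override_on x' y U"
      by (auto simp: override_on_def x'_def)
    show "mixed_diff U y f x * mixed_diff (insert j V - U) y g (override_on x y U) =
      mixed_diff U y f x * (mixed_diff (V - U) y g (override_on x y U) - mixed_diff (V - U) y g (override_on x' y U))"
      by (simp add: 2 mixed_diff_insert[OF 1] 3)
  qed
  finally have "(\<Sum>U\<in>Pow (insert j V). mixed_diff U y f x * mixed_diff (insert j V - U) y g (override_on x y U))
    = (\<Sum>U\<in>Pow V. mixed_diff U y f x * mixed_diff (V - U) y g (override_on x y U)) - (\<Sum>U\<in>Pow V. mixed_diff U y f x' * mixed_diff (V - U) y g (override_on x' y U))"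
    by (simp add: sum.distrib[symmetric] sum_subtractf[symmetric] algebra_simps)
  then show ?case unfolding mixed_diff_insert[OF insert(1,2)] insert.IH x'_def by (rule sym)
qed

section \<open>Means over finite products\<close>

definition coord_mean :: "(nat \<Rightarrow> 'a set) \<Rightarrow> (nat \<Rightarrow> 'a \<Rightarrow> real) \<Rightarrow> nat \<Rightarrow> ((nat \<Rightarrow> 'a) \<Rightarrow> real) \<Rightarrow> (nat \<Rightarrow> 'a) \<Rightarrow> real" where
  "coord_mean A wt i u x = (\<Sum>a\<in>A i. wt i a * u (x(i := a)))"

text \<open>
  Coordinates are averaged out in the order \<open>0, 1, 2, \<dots>\<close>, so that \<open>iter_mean A wt k u x\<close> is the
  conditional expectation of \<open>u\<close> given the coordinates \<open>x k, x (k + 1), \<dots>\<close>. In particular, after all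
  coordinates have been averaged out, the point \<open>x\<close> is irrelevant.
\<close>
primrec iter_mean :: "(nat \<Rightarrow> 'a set) \<Rightarrow> (nat \<Rightarrow> 'a \<Rightarrow> real) \<Rightarrow> nat \<Rightarrow> ((nat \<Rightarrow> 'a) \<Rightarrow> real) \<Rightarrow> (nat \<Rightarrow> 'a) \<Rightarrow> real" where
  "iter_mean A wt 0 u = u"
| "iter_mean A wt (Suc k) u = coord_mean A wt k (iter_mean A wt k u)"

locale finite_product =
  fixes n :: nat and A :: "nat \<Rightarrow> 'a set" and wt :: "nat \<Rightarrow> 'a \<Rightarrow> real"
  assumes finite_A: "i < n \<Longrightarrow> finite (A i)"
    and wt_nonneg: "i < n \<Longrightarrow> a \<in> A i \<Longrightarrow> wt i a \<ge> 0"
    and wt_sum: "i < n \<Longrightarrow> (\<Sum>a\<in>A i. wt i a) = 1"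
begin

definition S :: "(nat \<Rightarrow> 'a) set" where "S = PiE {..<n} A"

abbreviation E :: "nat \<Rightarrow> ((nat \<Rightarrow> 'a) \<Rightarrow> real) \<Rightarrow> (nat \<Rightarrow> 'a) \<Rightarrow> real" where
  "E \<equiv> coord_mean A wt"

definition max_diff :: "nat set \<Rightarrow> ((nat \<Rightarrow> 'a) \<Rightarrow> real) \<Rightarrow> real" where
  "max_diff V f = Max ((\<lambda>(x, y). \<bar>mixed_diff V y f x\<bar>) ` (S \<times> S))"

lemma finite_S: "finite S"
  unfolding S_def by (intro finite_PiE) (auto simp: finite_A)

lemma A_nonempty: "i < n \<Longrightarrow> A i \<noteq> {}"
  using wt_sum[of i] by auto

lemma S_nonempty: "S \<noteq> {}"
  unfolding S_def using A_nonempty by (simp add: PiE_eq_empty_iff)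

lemma upd_S: "x \<in> S \<Longrightarrow> i < n \<Longrightarrow> a \<in> A i \<Longrightarrow> x(i := a) \<in> S"
  by (auto simp: S_def PiE_iff extensional_def)

lemma override_S: "x \<in> S \<Longrightarrow> y \<in> S \<Longrightarrow> override_on x y W \<in> S"
  by (auto simp: S_def PiE_iff extensional_def override_on_def)

lemma max_diff_ge: "x \<in> S \<Longrightarrow> y \<in> S \<Longrightarrow> \<bar>mixed_diff V y f x\<bar> \<le> max_diff V f"
  unfolding max_diff_def by (intro Max_ge finite_imageI finite_cartesian_product finite_S) auto

lemma max_diff_le: "(\<And>x y. x \<in> S \<Longrightarrow> y \<in> S \<Longrightarrow> \<bar>mixed_diff V y f x\<bar> \<le> B) \<Longrightarrow> max_diff V f \<le> B"
  unfolding max_diff_def using S_nonempty finite_S by (intro Max.boundedI) auto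

lemma max_diff_nonneg: "max_diff V f \<ge> 0"
proof -
  obtain x where "x \<in> S" using S_nonempty by auto
  from max_diff_ge[OF this this, of V f] show ?thesis by linarith
qed

lemma E_mono:
  assumes "i < n" "x \<in> S" "\<And>x. x \<in> S \<Longrightarrow> u x \<le> v x"
  shows "E i u x \<le> E i v x"
  unfolding coord_mean_def using assms by (intro sum_mono mult_left_mono wt_nonneg) (auto intro: upd_S)

lemma E_const: "i < n \<Longrightarrow> E i (\<lambda>_. c) x = c"
  by (simp add: coord_mean_def sum_distrib_right[symmetric] wt_sum)

lemma E_add: "E i (\<lambda>x. u x + v x) x = E i u x + E i v x"
  by (simp add: coord_mean_def algebra_simps sum.distrib)

lemma E_diff: "E i (\<lambda>x. u x - v x) x = E i u x - E i v x"
  by (simp add: coord_mean_def algebra_simps sum_subtractf)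

lemma E_sum: "E i (\<lambda>x. \<Sum>k\<in>I. u k x) x = (\<Sum>k\<in>I. E i (u k) x)"
  unfolding coord_mean_def by (simp add: sum_distrib_left) (rule sum.swap)

lemma E_cmult: "E i (\<lambda>x. c * u x) x = c * E i u x"
  by (simp add: coord_mean_def sum_distrib_left mult.left_commute)

lemma E_indep: "(\<And>a. u (x(i := a)) = u x) \<Longrightarrow> E i (\<lambda>x. u x * v x) x = u x * E i v x"
  by (simp add: coord_mean_def sum_distrib_left mult.left_commute)

lemma E_upd: "E i u (x(i := a)) = E i u x"
  by (simp add: coord_mean_def)

lemma E_abs_le:
  assumes "i < n" "x \<in> S" "\<And>x. x \<in> S \<Longrightarrow> \<bar>u x\<bar> \<le> B"
  shows "\<bar>E i u x\<bar> \<le> B"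
proof -
  have "E i u x \<le> E i (\<lambda>_. B) x" by (rule E_mono) (use assms in \<open>auto intro: order_trans[OF abs_ge_self]\<close>)
  moreover have "E i (\<lambda>_. -B) x \<le> E i u x"
  proof (rule E_mono[OF assms(1,2)])
    fix x assume "x \<in> S" then show "- B \<le> u x" using assms(3)[of x] by linarith
  qed
  ultimately show ?thesis using assms(1) by (simp add: E_const abs_le_iff)
qed

lemma mixed_diff_E:
  assumes "i \<notin> V"
  shows "mixed_diff V y (E i u) x = (\<Sum>a\<in>A i. wt i a * mixed_diff V y u (x(i := a)))"
proof -
  have "mixed_diff V y (E i u) x = (\<Sum>W\<in>Pow V. \<Sum>a\<in>A i. wt i a * ((-1) ^ card W * u (override_on (x(i := a)) y W)))"
    unfolding mixed_diff_def coord_mean_def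
  proof (intro sum.cong refl)
    fix W assume W: "W \<in> Pow V"
    have "(override_on x y W)(i := a) = override_on (x(i := a)) y W" for a
      using W assms by (auto simp: override_on_def fun_eq_iff)
    then show "(-1) ^ card W * (\<Sum>a\<in>A i. wt i a * u ((override_on x y W)(i := a))) =
         (\<Sum>a\<in>A i. wt i a * ((-1) ^ card W * u (override_on (x(i := a)) y W)))"
      by (simp add: sum_distrib_left mult.left_commute)
  qed
  then show ?thesis
    unfolding mixed_diff_def by (simp add: sum_distrib_left sum.swap[of _ "A i"])
qed

text \<open>
  Averaging over a coordinate outside \<open>V\<close> commutes with differencing along \<open>V\<close> and is a contraction.
\<close>
lemma max_diff_E:
  assumes "i < n" "i \<notin> V"
  shows "max_diff V (E i u) \<le> max_diff V u"
proof (rule max_diff_le)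
  fix x y assume xy: "x \<in> S" "y \<in> S"
  show "\<bar>mixed_diff V y (E i u) x\<bar> \<le> max_diff V u"
    using E_abs_le[OF assms(1) xy(1), of "mixed_diff V y u" "max_diff V u"] max_diff_ge xy assms(2) by (simp add: mixed_diff_E coord_mean_def)
qed

text \<open>
  \<open>u - E\<^sub>i u\<close> is an average of one-coordinate differences of \<open>u\<close> along \<open>i\<close>. A bound on differences along
  \<open>insert i V\<close> therefore bounds the centered function along \<open>V\<close>: this is where the hypothesis on mixed
  differences of higher order enters.
\<close>
lemma max_diff_centered:
  assumes i: "i < n" "i \<notin> V" and V: "finite V"
  shows "max_diff V (\<lambda>x. u x - E i u x) \<le> max_diff (insert i V) u"
proof (rule max_diff_le)
  fix x y assume xy: "x \<in> S" "y \<in> S"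
  have "mixed_diff V y (\<lambda>x. u x - E i u x) x = (\<Sum>a\<in>A i. wt i a * mixed_diff V y u x) - (\<Sum>a\<in>A i. wt i a * mixed_diff V y u (x(i := a)))"
    using i by (simp add: mixed_diff_diff mixed_diff_E sum_distrib_right[symmetric] wt_sum)
  also have "\<dots> = (\<Sum>a\<in>A i. wt i a * mixed_diff (insert i V) (y(i := a)) u x)"
    by (simp add: mixed_diff_insert[OF V i(2)] mixed_diff_upd_irrelevant[OF i(2)] sum_subtractf algebra_simps)
  also have "\<bar>\<dots>\<bar> \<le> (\<Sum>a\<in>A i. \<bar>wt i a * mixed_diff (insert i V) (y(i := a)) u x\<bar>)" by (rule sum_abs)
  also have "\<dots> \<le> (\<Sum>a\<in>A i. wt i a * max_diff (insert i V) u)"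
    unfolding abs_mult using i xy by (intro sum_mono mult_mono max_diff_ge upd_S) (auto simp: wt_nonneg)
  also have "\<dots> = max_diff (insert i V) u" using i by (simp add: sum_distrib_right[symmetric] wt_sum)
  finally show "\<bar>mixed_diff V y (\<lambda>x. u x - E i u x) x\<bar> \<le> max_diff (insert i V) u" .
qed

lemma max_diff_sum_cmult:
  "max_diff V (\<lambda>x. \<Sum>k\<in>I. c k * f k x) \<le> (\<Sum>k\<in>I. \<bar>c k\<bar> * max_diff V (f k))"
proof (rule max_diff_le)
  fix x y assume xy: "x \<in> S" "y \<in> S"
  have "\<bar>mixed_diff V y (\<lambda>x. \<Sum>k\<in>I. c k * f k x) x\<bar> \<le> (\<Sum>k\<in>I. \<bar>c k * mixed_diff V y (f k) x\<bar>)"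
    by (simp add: mixed_diff_sum mixed_diff_cmult sum_abs)
  also have "\<dots> \<le> (\<Sum>k\<in>I. \<bar>c k\<bar> * max_diff V (f k))"
    unfolding abs_mult using xy by (intro sum_mono mult_left_mono max_diff_ge) auto
  finally show "\<bar>mixed_diff V y (\<lambda>x. \<Sum>k\<in>I. c k * f k x) x\<bar> \<le> (\<Sum>k\<in>I. \<bar>c k\<bar> * max_diff V (f k))" .
qed

lemma max_diff_add: "max_diff V (\<lambda>x. f x + g x) \<le> max_diff V f + max_diff V g"
proof (rule max_diff_le)
  fix x y assume xy: "x \<in> S" "y \<in> S"
  show "\<bar>mixed_diff V y (\<lambda>x. f x + g x) x\<bar> \<le> max_diff V f + max_diff V g"
    unfolding mixed_diff_add using max_diff_ge[OF xy, of V f] max_diff_ge[OF xy, of V g] by linarith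
qed

text \<open>
  The product rule on the level of maxima. Only \<open>1 \<le> s < r\<close> occurs because neither factor has a constant
  term; this restriction is the source of the gain of one degree in \<open>convolution_le\<close>.
\<close>
lemma max_diff_mult_nth:
  assumes V: "finite V" and 0: "\<And>x. fps_nth (f x) 0 = 0" "\<And>x. fps_nth (g x) 0 = 0"
  shows "max_diff V (\<lambda>x. fps_nth (f x * g x) r)
    \<le> (\<Sum>s\<in>{1..<r}. \<Sum>U\<in>Pow V. max_diff U (\<lambda>x. fps_nth (f x) s) * max_diff (V - U) (\<lambda>x. fps_nth (g x) (r - s)))"
proof (rule max_diff_le)
  fix x y assume xy: "x \<in> S" "y \<in> S"
  have eq: "(\<lambda>x. fps_nth (f x * g x) r) = (\<lambda>x. \<Sum>s\<in>{1..<r}. fps_nth (f x) s * fps_nth (g x) (r - s))"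
    unfolding fps_mult_nth
  proof (intro ext sum.mono_neutral_right ballI)
    fix x s assume "s \<in> {0..r} - {1..<r}"
    then have "s = 0 \<or> s = r" by auto
    then show "fps_nth (f x) s * fps_nth (g x) (r - s) = 0" using 0 by auto
  qed auto
  have "\<bar>mixed_diff V y (\<lambda>x. fps_nth (f x * g x) r) x\<bar> =
     \<bar>\<Sum>s\<in>{1..<r}. \<Sum>U\<in>Pow V. mixed_diff U y (\<lambda>x. fps_nth (f x) s) x * mixed_diff (V - U) y (\<lambda>x. fps_nth (g x) (r - s)) (override_on x y U)\<bar>"
    by (simp add: eq mixed_diff_sum mixed_diff_mult[OF V])
  also have "\<dots> \<le> (\<Sum>s\<in>{1..<r}. \<Sum>U\<in>Pow V. \<bar>mixed_diff U y (\<lambda>x. fps_nth (f x) s) x * mixed_diff (V - U) y (\<lambda>x. fps_nth (g x) (r - s)) (override_on x y U)\<bar>)"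
    by (rule order_trans[OF sum_abs]) (intro sum_mono sum_abs)
  also have "\<dots> \<le> (\<Sum>s\<in>{1..<r}. \<Sum>U\<in>Pow V. max_diff U (\<lambda>x. fps_nth (f x) s) * max_diff (V - U) (\<lambda>x. fps_nth (g x) (r - s)))"
    unfolding abs_mult using xy by (intro sum_mono mult_mono max_diff_ge override_S max_diff_nonneg) auto
  finally show "\<bar>mixed_diff V y (\<lambda>x. fps_nth (f x * g x) r) x\<bar> \<le> \<dots>" .
qed

end

section \<open>Weighted norms\<close>

text \<open>
  The pairs of an order \<open>r\<close> in \<open>t\<close> and a set \<open>V\<close> of differenced coordinates that the argument can
  control. Centering uses up one differenced coordinate and so lowers the available total \<open>d\<close> by one,
  whereas multiplication of two series without constant term raises it by one. The total \<open>d = m + 1\<close> is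
  thus stable under one step of the induction, and for the linear series \<open>t g\<close> it involves precisely the
  sets with at most \<open>m\<close> elements.
\<close>
definition Deg :: "nat \<Rightarrow> nat set \<Rightarrow> (nat \<times> nat set) set" where
  "Deg d J = {(r, V). V \<subseteq> J \<and> 1 \<le> r \<and> r + card V \<le> d}"

lemma finite_Deg: "finite J \<Longrightarrow> finite (Deg d J)"
  by (rule finite_subset[of _ "{..d} \<times> Pow J"]) (auto simp: Deg_def)

lemma Deg_mono: "d \<le> d' \<Longrightarrow> Deg d J \<subseteq> Deg d' J"
  by (auto simp: Deg_def)

text \<open>
  Both factors have order at least one in \<open>t\<close>, so each of them uses up at most \<open>d\<close> of a total degree
  \<open>d + 1\<close>. The map sending a summand on the left to its two factors is injective, hence the left-hand
  side is a part of the expanded product on the right.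
\<close>
lemma convolution_le:
  fixes F G :: "nat \<Rightarrow> nat set \<Rightarrow> real"
  assumes J: "finite J" and F: "\<And>r V. F r V \<ge> 0" and G: "\<And>r V. G r V \<ge> 0"
  shows "(\<Sum>(r, V)\<in>Deg (Suc d) J. \<Sum>s\<in>{1..<r}. \<Sum>U\<in>Pow V. F s U * G (r - s) (V - U))
    \<le> (\<Sum>(r, V)\<in>Deg d J. F r V) * (\<Sum>(r, V)\<in>Deg d J. G r V)"
proof -
  define T where "T = Sigma (Deg (Suc d) J) (\<lambda>(r, V). Sigma {1..<r} (\<lambda>s. Pow V))"
  define \<pi> :: "(nat \<times> nat set) \<times> nat \<times> nat set \<Rightarrow> (nat \<times> nat set) \<times> nat \<times> nat set"
    where "\<pi> = (\<lambda>((r, V), (s, U)). ((s, U), (r - s, V - U)))"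
  define \<phi> where "\<phi> = (\<lambda>((s, U), (t, W)). F s U * G t W)"
  have finV: "finite V" if "(r, V) \<in> Deg d' J" for r V d'
    using that J by (auto simp: Deg_def intro: finite_subset)
  have "(\<Sum>(r, V)\<in>Deg (Suc d) J. \<Sum>s\<in>{1..<r}. \<Sum>U\<in>Pow V. F s U * G (r - s) (V - U))
    = (\<Sum>p\<in>Deg (Suc d) J. \<Sum>q\<in>(case p of (r, V) \<Rightarrow> Sigma {1..<r} (\<lambda>s. Pow V)). \<phi> (\<pi> (p, q)))"
  proof (intro sum.cong refl, clarify)
    fix r V assume "(r, V) \<in> Deg (Suc d) J"
    then have "finite V" by (rule finV)
    then show "(\<Sum>s\<in>{1..<r}. \<Sum>U\<in>Pow V. F s U * G (r - s) (V - U))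
       = (\<Sum>q\<in>Sigma {1..<r} (\<lambda>s. Pow V). \<phi> (\<pi> ((r, V), q)))"
      by (subst sum.Sigma) (auto simp: \<phi>_def \<pi>_def split_def)
  qed
  also have "\<dots> = (\<Sum>t\<in>T. \<phi> (\<pi> t))"
    unfolding T_def by (subst sum.Sigma) (auto simp: finite_Deg J finV split: prod.splits)
  also have "\<dots> = (\<Sum>t\<in>\<pi> ` T. \<phi> t)"
  proof (subst sum.reindex)
    show "inj_on \<pi> T"
      by (rule inj_onI) (auto simp: T_def \<pi>_def)
  qed simp
  also have "\<dots> \<le> (\<Sum>t\<in>Deg d J \<times> Deg d J. \<phi> t)"
  proof (rule sum_mono2)
    show "finite (Deg d J \<times> Deg d J)" using J by (simp add: finite_Deg)
    show "\<pi> ` T \<subseteq> Deg d J \<times> Deg d J"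
    proof -
      have "(s, U) \<in> Deg d J \<and> (r - s, V - U) \<in> Deg d J"
        if "(r, V) \<in> Deg (Suc d) J" "s \<in> {1..<r}" "U \<subseteq> V" for r V s U
      proof -
        have "card U \<le> card V" "card (V - U) \<le> card V"
          using finV[OF that(1)] that(3) by (auto intro: card_mono)
        then show ?thesis using that by (auto simp: Deg_def)
      qed
      then show ?thesis by (auto simp: T_def \<pi>_def)
    qed
    show "0 \<le> \<phi> b" for b by (auto simp: \<phi>_def F G split: prod.splits)
  qed
  also have "\<dots> = (\<Sum>(r, V)\<in>Deg d J. F r V) * (\<Sum>(r, V)\<in>Deg d J. G r V)"
    by (simp add: sum_product sum.cartesian_product \<phi>_def split_def)
  finally show ?thesis .
qed

locale weighted_product = finite_product n A wt
  for n :: nat and A :: "nat \<Rightarrow> 'a set" and wt :: "nat \<Rightarrow> 'a \<Rightarrow> real" +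
  fixes R :: real
  assumes R_ge1: "R \<ge> 1"
begin

lemma R_pos [simp]: "R > 0" and R_nonneg [simp]: "R \<ge> 0" using R_ge1 by auto

text \<open>
  Norms on power series whose coefficients are functions on the product. The weight \<open>R^r\<close> measures the
  order in \<open>t\<close>; the weight \<open>(1/2)^|V|\<close> makes sets that gain an element cheaper, which is used in
  \<open>log_mean_exp_step\<close>. In \<open>jet_norm_at\<close>, where only sets containing \<open>j\<close> count, the element \<open>j\<close> itself is
  not charged. Thus \<open>jet_norm\<close> is submultiplicative and \<open>jet_norm_at\<close> obeys a product rule like that of
  a derivation.
\<close>
definition jet_norm :: "nat \<Rightarrow> nat set \<Rightarrow> ((nat \<Rightarrow> 'a) \<Rightarrow> real fps) \<Rightarrow> real" where
  "jet_norm d J f = (\<Sum>(r, V)\<in>Deg d J. max_diff V (\<lambda>x. fps_nth (f x) r) * R ^ r * (1/2) ^ card V)"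

definition jet_norm_at :: "nat \<Rightarrow> nat set \<Rightarrow> nat \<Rightarrow> ((nat \<Rightarrow> 'a) \<Rightarrow> real fps) \<Rightarrow> real" where
  "jet_norm_at d J j f = (\<Sum>(r, V)\<in>Deg d J. if j \<in> V then max_diff V (\<lambda>x. fps_nth (f x) r) * R ^ r * (1/2) ^ (card V - 1) else 0)"

lemma jet_norm_nonneg: "jet_norm d J f \<ge> 0"
  unfolding jet_norm_def by (intro sum_nonneg) (auto simp: max_diff_nonneg)

lemma jet_norm_at_nonneg: "jet_norm_at d J j f \<ge> 0"
  unfolding jet_norm_at_def by (intro sum_nonneg) (auto simp: max_diff_nonneg)

lemma jet_norm_mono: "finite J \<Longrightarrow> d \<le> d' \<Longrightarrow> jet_norm d J f \<le> jet_norm d' J f"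
  unfolding jet_norm_def by (intro sum_mono2 finite_Deg Deg_mono) (auto simp: max_diff_nonneg)

lemma jet_norm_at_mono: "finite J \<Longrightarrow> d \<le> d' \<Longrightarrow> jet_norm_at d J j f \<le> jet_norm_at d' J j f"
  unfolding jet_norm_at_def by (intro sum_mono2 finite_Deg Deg_mono) (auto simp: max_diff_nonneg)

lemma jet_norm_mult:
  assumes J: "finite J" and 0: "\<And>x. fps_nth (f x) 0 = 0" "\<And>x. fps_nth (g x) 0 = 0"
  shows "jet_norm (Suc d) J (\<lambda>x. f x * g x) \<le> jet_norm d J f * jet_norm d J g"
proof -
  let ?F = "\<lambda>s U. max_diff U (\<lambda>x. fps_nth (f x) s) * R ^ s * (1/2) ^ card U"
  let ?G = "\<lambda>s U. max_diff U (\<lambda>x. fps_nth (g x) s) * R ^ s * (1/2) ^ card U"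
  have "jet_norm (Suc d) J (\<lambda>x. f x * g x) \<le>
     (\<Sum>(r, V)\<in>Deg (Suc d) J. \<Sum>s\<in>{1..<r}. \<Sum>U\<in>Pow V. ?F s U * ?G (r - s) (V - U))"
    unfolding jet_norm_def
  proof (intro sum_mono, clarify)
    fix r V assume "(r, V) \<in> Deg (Suc d) J"
    then have V: "finite V" using J by (auto simp: Deg_def intro: finite_subset)
    have "max_diff V (\<lambda>x. fps_nth (f x * g x) r) * (R ^ r * (1/2) ^ card V) \<le>
      (\<Sum>s\<in>{1..<r}. \<Sum>U\<in>Pow V. max_diff U (\<lambda>x. fps_nth (f x) s) * max_diff (V - U) (\<lambda>x. fps_nth (g x) (r - s))) * (R ^ r * (1/2) ^ card V)"
      by (intro mult_right_mono max_diff_mult_nth V 0) auto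
    also have "\<dots> = (\<Sum>s\<in>{1..<r}. \<Sum>U\<in>Pow V. ?F s U * ?G (r - s) (V - U))"
      unfolding sum_distrib_right
    proof (intro sum.cong refl)
      fix s U assume s: "s \<in> {1..<r}" and U: "U \<in> Pow V"
      have "card V = card U + card (V - U)"
        using U V by (metis PowD card_Diff_subset card_mono finite_subset le_add_diff_inverse)
      moreover have "r = s + (r - s)" using s by simp
      ultimately have "R ^ r * (1/2) ^ card V = R ^ s * R ^ (r - s) * ((1/2) ^ card U * (1/2) ^ card (V - U))"
        by (metis power_add)
      then show "max_diff U (\<lambda>x. fps_nth (f x) s) * max_diff (V - U) (\<lambda>x. fps_nth (g x) (r - s)) * (R ^ r * (1/2) ^ card V)
         = ?F s U * ?G (r - s) (V - U)" by (simp add: algebra_simps)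
    qed
    finally show "max_diff V (\<lambda>x. fps_nth (f x * g x) r) * R ^ r * (1/2) ^ card V \<le>
      (\<Sum>s\<in>{1..<r}. \<Sum>U\<in>Pow V. ?F s U * ?G (r - s) (V - U))" by (simp add: mult.assoc)
  qed
  also have "\<dots> \<le> jet_norm d J f * jet_norm d J g"
    unfolding jet_norm_def by (rule convolution_le[OF J]) (auto simp: max_diff_nonneg)
  finally show ?thesis .
qed

text \<open>
  A set that contains \<open>j\<close> and is split between two factors has \<open>j\<close> in exactly one of the parts; this gives
  the two terms.
\<close>
lemma jet_norm_at_mult:
  assumes J: "finite J" and 0: "\<And>x. fps_nth (f x) 0 = 0" "\<And>x. fps_nth (g x) 0 = 0"
  shows "jet_norm_at (Suc d) J j (\<lambda>x. f x * g x) \<le> jet_norm_at d J j f * jet_norm d J g + jet_norm d J f * jet_norm_at d J j g"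
proof -
  let ?F = "\<lambda>s U. max_diff U (\<lambda>x. fps_nth (f x) s) * R ^ s * (1/2) ^ card U"
  let ?G = "\<lambda>s U. max_diff U (\<lambda>x. fps_nth (g x) s) * R ^ s * (1/2) ^ card U"
  let ?Fj = "\<lambda>s U. if j \<in> U then max_diff U (\<lambda>x. fps_nth (f x) s) * R ^ s * (1/2) ^ (card U - 1) else 0"
  let ?Gj = "\<lambda>s U. if j \<in> U then max_diff U (\<lambda>x. fps_nth (g x) s) * R ^ s * (1/2) ^ (card U - 1) else 0"
  have "jet_norm_at (Suc d) J j (\<lambda>x. f x * g x) \<le>
     (\<Sum>(r, V)\<in>Deg (Suc d) J. (\<Sum>s\<in>{1..<r}. \<Sum>U\<in>Pow V. ?Fj s U * ?G (r - s) (V - U))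
       + (\<Sum>s\<in>{1..<r}. \<Sum>U\<in>Pow V. ?F s U * ?Gj (r - s) (V - U)))"
    unfolding jet_norm_at_def
  proof (intro sum_mono, clarify)
    fix r V assume "(r, V) \<in> Deg (Suc d) J"
    then have V: "finite V" using J by (auto simp: Deg_def intro: finite_subset)
    show "(if j \<in> V then max_diff V (\<lambda>x. fps_nth (f x * g x) r) * R ^ r * (1/2) ^ (card V - 1) else 0) \<le>
      (\<Sum>s\<in>{1..<r}. \<Sum>U\<in>Pow V. ?Fj s U * ?G (r - s) (V - U))
       + (\<Sum>s\<in>{1..<r}. \<Sum>U\<in>Pow V. ?F s U * ?Gj (r - s) (V - U))" (is "_ \<le> ?rhs")
    proof (cases "j \<in> V")
      case False
      then show ?thesis by (auto intro!: add_nonneg_nonneg sum_nonneg simp: max_diff_nonneg)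
    next
      case True
      have "max_diff V (\<lambda>x. fps_nth (f x * g x) r) * (R ^ r * (1/2) ^ (card V - 1)) \<le>
        (\<Sum>s\<in>{1..<r}. \<Sum>U\<in>Pow V. max_diff U (\<lambda>x. fps_nth (f x) s) * max_diff (V - U) (\<lambda>x. fps_nth (g x) (r - s))) * (R ^ r * (1/2) ^ (card V - 1))"
        by (intro mult_right_mono max_diff_mult_nth V 0) auto
      also have "\<dots> = (\<Sum>s\<in>{1..<r}. \<Sum>U\<in>Pow V. ?Fj s U * ?G (r - s) (V - U) + ?F s U * ?Gj (r - s) (V - U))"
        unfolding sum_distrib_right
      proof (intro sum.cong refl)
        fix s U assume s: "s \<in> {1..<r}" and U: "U \<in> Pow V"
        have cV: "card V = card U + card (V - U)"
          using U V by (metis PowD card_Diff_subset card_mono finite_subset le_add_diff_inverse)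
        have fin: "finite U" "finite (V - U)" using U V by (auto intro: finite_subset)
        have r: "R ^ r = R ^ s * R ^ (r - s)" using s by (simp add: power_add[symmetric])
        show "max_diff U (\<lambda>x. fps_nth (f x) s) * max_diff (V - U) (\<lambda>x. fps_nth (g x) (r - s)) * (R ^ r * (1/2) ^ (card V - 1))
          = ?Fj s U * ?G (r - s) (V - U) + ?F s U * ?Gj (r - s) (V - U)"
        proof (cases "j \<in> U")
          case True
          then have "card U > 0" using fin by (auto simp: card_gt_0_iff)
          then have "(1/2::real) ^ (card V - 1) = (1/2) ^ (card U - 1) * (1/2) ^ card (V - U)"
            unfolding cV by (simp add: power_add[symmetric])
          then show ?thesis using True by (simp add: r)
        next
          case False
          then have jm: "j \<in> V - U" using \<open>j \<in> V\<close> by auto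
          then have "card (V - U) > 0" using fin card_gt_0_iff by blast
          then have "(1/2::real) ^ (card V - 1) = (1/2) ^ card U * (1/2) ^ (card (V - U) - 1)"
            unfolding cV by (simp add: power_add[symmetric])
          then show ?thesis using False jm by (simp add: r)
        qed
      qed
      finally show ?thesis using True by (simp add: mult.assoc sum.distrib)
    qed
  qed
  also have "\<dots> = (\<Sum>(r, V)\<in>Deg (Suc d) J. \<Sum>s\<in>{1..<r}. \<Sum>U\<in>Pow V. ?Fj s U * ?G (r - s) (V - U))
       + (\<Sum>(r, V)\<in>Deg (Suc d) J. \<Sum>s\<in>{1..<r}. \<Sum>U\<in>Pow V. ?F s U * ?Gj (r - s) (V - U))"
    unfolding split_def by (rule sum.distrib)
  also have "\<dots> \<le> jet_norm_at d J j f * jet_norm d J g + jet_norm d J f * jet_norm_at d J j g"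
    unfolding jet_norm_def jet_norm_at_def by (intro add_mono convolution_le[OF J]) (auto simp: max_diff_nonneg)
  finally show ?thesis .
qed

text \<open>
  The second bound is the first one with the degree gained by a product of at least two factors.
\<close>
lemma jet_norm_power:
  assumes J: "finite J" and 0: "\<And>x. fps_nth (f x) 0 = 0" and a: "jet_norm d J f \<le> a" and p: "p \<ge> 1"
  shows "jet_norm d J (\<lambda>x. f x ^ p) \<le> a ^ p"
    and "jet_norm (Suc d) J (\<lambda>x. f x ^ Suc p) \<le> a ^ Suc p"
proof -
  have a0: "a \<ge> 0" using a jet_norm_nonneg order_trans by blast
  have stp: "jet_norm (Suc d) J (\<lambda>x. f x ^ Suc p) \<le> a ^ Suc p"
    if "p \<ge> 1" "jet_norm d J (\<lambda>x. f x ^ p) \<le> a ^ p" for p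
  proof -
    have "jet_norm (Suc d) J (\<lambda>x. f x * f x ^ p) \<le> jet_norm d J f * jet_norm d J (\<lambda>x. f x ^ p)"
      using that 0 by (intro jet_norm_mult J) (auto simp: zero_power)
    also have "\<dots> \<le> a * a ^ p" using that a a0 by (intro mult_mono jet_norm_nonneg) auto
    finally show ?thesis by simp
  qed
  show 1: "jet_norm d J (\<lambda>x. f x ^ p) \<le> a ^ p"
    using p
  proof (induction p rule: dec_induct)
    case base then show ?case using a by simp
  next
    case (step p)
    have "jet_norm d J (\<lambda>x. f x ^ Suc p) \<le> jet_norm (Suc d) J (\<lambda>x. f x ^ Suc p)" by (rule jet_norm_mono[OF J]) simp
    also have "\<dots> \<le> a ^ Suc p" using step stp by blast
    finally show ?case .
  qed
  show "jet_norm (Suc d) J (\<lambda>x. f x ^ Suc p) \<le> a ^ Suc p" by (rule stp[OF p 1])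
qed

lemma jet_norm_at_power:
  assumes J: "finite J" and 0: "\<And>x. fps_nth (f x) 0 = 0" and a: "jet_norm d J f \<le> a"
    and b: "jet_norm_at d J j f \<le> b" and p: "p \<ge> 1"
  shows "jet_norm_at d J j (\<lambda>x. f x ^ p) \<le> real p * a ^ (p - 1) * b"
    and "jet_norm_at (Suc d) J j (\<lambda>x. f x ^ Suc p) \<le> real (Suc p) * a ^ p * b"
proof -
  have a0: "a \<ge> 0" using a jet_norm_nonneg order_trans by blast
  have b0: "b \<ge> 0" using b jet_norm_at_nonneg order_trans by blast
  have stp: "jet_norm_at (Suc d) J j (\<lambda>x. f x ^ Suc p) \<le> real (Suc p) * a ^ p * b"
    if p: "p \<ge> 1" and h: "jet_norm_at d J j (\<lambda>x. f x ^ p) \<le> real p * a ^ (p - 1) * b" for p :: nat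
  proof -
    have "jet_norm_at (Suc d) J j (\<lambda>x. f x * f x ^ p) \<le> jet_norm_at d J j f * jet_norm d J (\<lambda>x. f x ^ p) + jet_norm d J f * jet_norm_at d J j (\<lambda>x. f x ^ p)"
      using that 0 by (intro jet_norm_at_mult J) (auto simp: zero_power)
    also have "\<dots> \<le> b * a ^ p + a * (real p * a ^ (p - 1) * b)"
      using that a b a0 b0 jet_norm_power(1)[OF J 0 a p] by (intro add_mono mult_mono jet_norm_nonneg jet_norm_at_nonneg) auto
    also have "a * (real p * a ^ (p - 1) * b) = real p * a ^ p * b"
      using p by (cases p) auto
    finally show ?thesis by (simp add: algebra_simps)
  qed
  show 1: "jet_norm_at d J j (\<lambda>x. f x ^ p) \<le> real p * a ^ (p - 1) * b"
    using p
  proof (induction p rule: dec_induct)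
    case base then show ?case using b by simp
  next
    case (step p)
    have "jet_norm_at d J j (\<lambda>x. f x ^ Suc p) \<le> jet_norm_at (Suc d) J j (\<lambda>x. f x ^ Suc p)" by (rule jet_norm_at_mono[OF J]) simp
    also have "\<dots> \<le> real (Suc p) * a ^ p * b" using step stp by blast
    finally show ?case by simp
  qed
  show "jet_norm_at (Suc d) J j (\<lambda>x. f x ^ Suc p) \<le> real (Suc p) * a ^ p * b" by (rule stp[OF p 1])
qed

end

section \<open>Averaging out one coordinate\<close>

lemma geometric_sum_le:
  fixes K :: real
  assumes "0 \<le> K" "K < 1"
  shows "(\<Sum>p=a..N. K ^ p) \<le> K ^ a / (1 - K)"
  using assms by (auto simp: sum_gp divide_right_mono)

lemma abs_ln_diff_le:
  fixes a b :: real
  assumes "e > 0" "a \<ge> e" "b \<ge> e"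
  shows "\<bar>ln a - ln b\<bar> \<le> \<bar>a - b\<bar> / e"
proof -
  have *: "ln x - ln y \<le> \<bar>x - y\<bar> / e" if "x \<ge> e" "y \<ge> e" for x y :: real
  proof -
    have "ln x - ln y \<le> (x - y) / y" using that assms by (intro ln_diff_le) auto
    also have "\<dots> \<le> \<bar>x - y\<bar> / y" using that assms by (intro divide_right_mono) auto
    also have "\<dots> \<le> \<bar>x - y\<bar> / e" using that assms by (intro divide_left_mono) auto
    finally show ?thesis .
  qed
  show ?thesis using *[of a b] *[of b a] assms by (simp add: abs_le_iff abs_minus_commute)
qed

text \<open>
  Sets that contain the coordinate about to be averaged out are parametrized by the remaining elements,
  of which there is one fewer: hence the smaller degree \<open>d\<close>.
\<close>
lemma sum_Deg_insert:
  fixes h :: "nat \<times> nat set \<Rightarrow> real"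
  assumes J: "finite J" "i \<notin> J"
  shows "(\<Sum>p\<in>Deg (Suc d) (insert i J). h p) = (\<Sum>p\<in>Deg (Suc d) J. h p) + (\<Sum>(r, V)\<in>Deg d J. h (r, insert i V))"
proof -
  define \<pi> where "\<pi> = (\<lambda>(r :: nat, V). (r, insert i V))"
  have finV: "finite V" if "V \<subseteq> J" for V using that J by (auto intro: finite_subset)
  have card: "card (insert i V) = Suc (card V)" if "V \<subseteq> J" for V
    using finV[OF that] that J(2) by (subst card_insert_disjoint) auto
  have "Deg (Suc d) (insert i J) = Deg (Suc d) J \<union> \<pi> ` Deg d J"
  proof (intro equalityI subsetI)
    fix p assume p: "p \<in> Deg (Suc d) (insert i J)"
    obtain r U where rU: "p = (r, U)" by (cases p)
    show "p \<in> Deg (Suc d) J \<union> \<pi> ` Deg d J"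
    proof (cases "i \<in> U")
      case False
      then show ?thesis using p rU by (auto simp: Deg_def)
    next
      case True
      have sub: "U - {i} \<subseteq> J" using p rU by (auto simp: Deg_def)
      have ins: "insert i (U - {i}) = U" using True by auto
      have "(r, U - {i}) \<in> Deg d J"
        using p rU card[OF sub] sub unfolding ins by (auto simp: Deg_def)
      moreover have "p = \<pi> (r, U - {i})" using rU ins by (simp add: \<pi>_def)
      ultimately show ?thesis by blast
    qed
  next
    fix p assume "p \<in> Deg (Suc d) J \<union> \<pi> ` Deg d J"
    then show "p \<in> Deg (Suc d) (insert i J)"
      by (auto simp: Deg_def \<pi>_def card)
  qed
  moreover have "Deg (Suc d) J \<inter> \<pi> ` Deg d J = {}" using J by (auto simp: Deg_def \<pi>_def)
  moreover have "inj_on \<pi> (Deg d J)"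
  proof (rule inj_onI, clarsimp simp: \<pi>_def Deg_def)
    fix V W assume "V \<subseteq> J" "W \<subseteq> J" "insert i V = insert i W"
    then show "V = W" using J(2) by (metis insert_ident subsetD)
  qed
  ultimately have "(\<Sum>p\<in>Deg (Suc d) (insert i J). h p) = (\<Sum>p\<in>Deg (Suc d) J. h p) + (\<Sum>p\<in>Deg d J. h (\<pi> p))"
    using J by (simp add: sum.union_disjoint finite_Deg sum.reindex)
  then show ?thesis by (simp add: \<pi>_def split_def)
qed

context finite_product
begin

lemma iter_mean_const: "k \<le> n \<Longrightarrow> iter_mean A wt k (\<lambda>_. c) x = c"
proof (induction k arbitrary: x)
  case (Suc k)
  then have "iter_mean A wt k (\<lambda>_. c) = (\<lambda>_. c)" by (intro ext) auto
  then show ?case using Suc by (simp add: E_const)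
qed simp

lemma iter_mean_pos: "k \<le> n \<Longrightarrow> x \<in> S \<Longrightarrow> (\<And>x. u x > 0) \<Longrightarrow> iter_mean A wt k u x > 0"
proof (induction k arbitrary: x)
  case (Suc k)
  obtain B where B: "B > 0" "\<And>z. z \<in> S \<Longrightarrow> B \<le> iter_mean A wt k u z"
  proof
    show "Min (iter_mean A wt k u ` S) > 0" using Suc finite_S S_nonempty by (subst Min_gr_iff) auto
    show "Min (iter_mean A wt k u ` S) \<le> iter_mean A wt k u z" if "z \<in> S" for z using that finite_S by auto
  qed
  have "E k (\<lambda>_. B) x \<le> E k (iter_mean A wt k u) x" using Suc B by (intro E_mono) auto
  then show ?case using B Suc by (simp add: E_const)
qed simp

end

context weighted_product
begin

definition E_fps :: "nat \<Rightarrow> ((nat \<Rightarrow> 'a) \<Rightarrow> real fps) \<Rightarrow> (nat \<Rightarrow> 'a) \<Rightarrow> real fps" where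
  "E_fps i F x = Abs_fps (\<lambda>r. E i (\<lambda>x. fps_nth (F x) r) x)"

text \<open>
  The norms are monotone and positively homogeneous in the maxima of differences, so a coefficientwise
  estimate carries over. It is used for truncated exponential and logarithm series.
\<close>
lemma jet_norm_le_lincomb:
  assumes "\<And>r V. (r, V) \<in> Deg d J \<Longrightarrow> max_diff V (\<lambda>x. fps_nth (f x) r) \<le> (\<Sum>k\<in>I. c k * max_diff V (\<lambda>x. fps_nth (g k x) r))"
  shows "jet_norm d J f \<le> (\<Sum>k\<in>I. c k * jet_norm d J (g k))"
proof -
  have "jet_norm d J f \<le> (\<Sum>(r, V)\<in>Deg d J. (\<Sum>k\<in>I. c k * max_diff V (\<lambda>x. fps_nth (g k x) r)) * (R ^ r * (1/2) ^ card V))"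
    unfolding jet_norm_def
  proof (intro sum_mono, clarify)
    fix r V assume "(r, V) \<in> Deg d J"
    from assms[OF this] show "max_diff V (\<lambda>x. fps_nth (f x) r) * R ^ r * (1/2) ^ card V \<le>
      (\<Sum>k\<in>I. c k * max_diff V (\<lambda>x. fps_nth (g k x) r)) * (R ^ r * (1/2) ^ card V)"
      unfolding mult.assoc by (intro mult_right_mono) auto
  qed
  also have "\<dots> = (\<Sum>k\<in>I. c k * jet_norm d J (g k))"
    unfolding jet_norm_def sum_distrib_left sum_distrib_right split_def
    by (subst sum.swap) (simp add: mult_ac)
  finally show ?thesis .
qed

lemma jet_norm_at_le_lincomb:
  assumes "\<And>r V. (r, V) \<in> Deg d J \<Longrightarrow> max_diff V (\<lambda>x. fps_nth (f x) r) \<le> (\<Sum>k\<in>I. c k * max_diff V (\<lambda>x. fps_nth (g k x) r))"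
  shows "jet_norm_at d J j f \<le> (\<Sum>k\<in>I. c k * jet_norm_at d J j (g k))"
proof -
  have "jet_norm_at d J j f \<le> (\<Sum>(r, V)\<in>Deg d J. (\<Sum>k\<in>I. c k * max_diff V (\<lambda>x. fps_nth (g k x) r)) * (if j \<in> V then R ^ r * (1/2) ^ (card V - 1) else 0))"
    unfolding jet_norm_at_def
  proof (intro sum_mono, clarify)
    fix r V assume "(r, V) \<in> Deg d J"
    from assms[OF this] have "max_diff V (\<lambda>x. fps_nth (f x) r) * (R ^ r * (1/2) ^ (card V - 1)) \<le>
      (\<Sum>k\<in>I. c k * max_diff V (\<lambda>x. fps_nth (g k x) r)) * (R ^ r * (1/2) ^ (card V - 1))"
      by (intro mult_right_mono) auto
    then show "(if j \<in> V then max_diff V (\<lambda>x. fps_nth (f x) r) * R ^ r * (1/2) ^ (card V - 1) else 0) \<le>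
      (\<Sum>k\<in>I. c k * max_diff V (\<lambda>x. fps_nth (g k x) r)) * (if j \<in> V then R ^ r * (1/2) ^ (card V - 1) else 0)"
      by (simp add: mult.assoc)
  qed
  also have "\<dots> = (\<Sum>k\<in>I. c k * jet_norm_at d J j (g k))"
    unfolding jet_norm_at_def sum_distrib_left sum_distrib_right split_def
    by (subst sum.swap) (intro sum.cong refl, auto)
  finally show ?thesis .
qed

lemma sum_nth_le_jet_norm:
  assumes "x \<in> S" "finite J"
  shows "(\<Sum>r=1..d. \<bar>fps_nth (f x) r\<bar> * R ^ r) \<le> jet_norm d J f"
proof -
  have "(\<Sum>r=1..d. \<bar>fps_nth (f x) r\<bar> * R ^ r) \<le> (\<Sum>r=1..d. max_diff {} (\<lambda>x. fps_nth (f x) r) * R ^ r)"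
    using max_diff_ge[OF assms(1,1), of "{}"] by (intro sum_mono mult_right_mono) auto
  also have "\<dots> = (\<Sum>(r, V)\<in>(\<lambda>r. (r, {})) ` {1..d}. max_diff V (\<lambda>x. fps_nth (f x) r) * R ^ r * (1/2) ^ card V)"
    by (subst sum.reindex) (auto simp: inj_on_def)
  also have "\<dots> \<le> jet_norm d J f"
    unfolding jet_norm_def by (intro sum_mono2 finite_Deg assms) (auto simp: Deg_def max_diff_nonneg)
  finally show ?thesis .
qed

lemma max_diff_cong: "(\<And>x. f x = g x) \<Longrightarrow> max_diff V f = max_diff V g"
  by (rule arg_cong[where f = "max_diff V"]) auto

lemma nth_power_vanish: "fps_nth a 0 = 0 \<Longrightarrow> r < p \<Longrightarrow> fps_nth (a ^ p) r = 0" for a :: "real fps"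
  by (simp add: startsby_zero_power_prefix)

text \<open>
  One step of the induction: coordinate \<open>i\<close> is averaged out of \<open>exp H\<close>, and the formal logarithm is
  taken. Write \<open>H = c + v\<close> with \<open>c = E\<^sub>i H\<close>. As \<open>c\<close> does not depend on \<open>i\<close>, the new series is
  \<open>H' = c + L\<close> with \<open>L = ln E\<^sub>i[exp v]\<close>, and \<open>E\<^sub>i[exp v] - 1\<close> has no term linear in \<open>v\<close>.

  For the first claim, split the norm at \<open>j\<close> of \<open>H\<close> into the sets without \<open>i\<close>, which bound \<open>c\<close>, and the
  sets with \<open>i\<close>. The latter contribute \<open>A\<^sub>j / 2\<close>, where \<open>A\<^sub>j\<close> bounds the norm of \<open>v\<close> at \<open>j\<close>; the factor
  \<open>1/2\<close> is the weight of the element \<open>i\<close>. Since \<open>L\<close> begins with quadratic terms and the full norm of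
  \<open>v\<close> is at most the norm of \<open>H\<close> at \<open>i\<close>, that is \<open>1/25\<close>, the norm of \<open>L\<close> at \<open>j\<close> is a small multiple of
  \<open>A\<^sub>j\<close>, in particular at most \<open>A\<^sub>j / 2\<close>.

  For the second claim, the numbers \<open>E\<^sub>i[exp (\<Sum>r=1..m. v\<^sub>r)]\<close> and \<open>exp (\<Sum>r=1..m. L\<^sub>r)\<close> are both close to
  the truncation \<open>t\<close> of the formal series \<open>exp L = E\<^sub>i[exp v]\<close>.
\<close>
lemma log_mean_exp_step:
  fixes H :: "(nat \<Rightarrow> 'a) \<Rightarrow> real fps"
  assumes i: "i < n" "i \<notin> J" and J: "finite J" and H0: "\<And>x. fps_nth (H x) 0 = 0"
    and K: "\<And>j. j \<in> insert i J \<Longrightarrow> jet_norm_at (Suc m) (insert i J) j H \<le> 1 / 25"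
  defines "H' \<equiv> (\<lambda>x. fln (E_fps i (\<lambda>x. fexp (H x)) x - 1))"
  shows "\<And>j. j \<in> J \<Longrightarrow> jet_norm_at (Suc m) J j H' \<le> jet_norm_at (Suc m) (insert i J) j H"
    and "\<And>x. x \<in> S \<Longrightarrow>
      \<bar>ln (E i (\<lambda>x. exp (\<Sum>r=1..m. fps_nth (H x) r)) x) - (\<Sum>r=1..m. fps_nth (H' x) r)\<bar> * R ^ (m + 1) \<le> 5 / 2"
proof -
  define c where "c = E_fps i H"
  define v where "v x = H x - c x" for x
  define w where "w x = E_fps i (\<lambda>x. fexp (v x)) x - 1" for x
  define L where "L x = fln (w x)" for x
  have c0: "fps_nth (c x) 0 = 0" for x by (simp add: c_def E_fps_def H0 coord_mean_def)
  have v0: "fps_nth (v x) 0 = 0" for x by (simp add: v_def H0 c0)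
  have w0: "fps_nth (w x) 0 = 0" for x using i by (simp add: w_def E_fps_def E_const)
  have L0: "fps_nth (L x) 0 = 0" for x by (simp add: L_def)
  have cupd: "c (x(i := a)) = c x" for x a by (simp add: c_def E_fps_def E_upd)
  have H'eq: "H' x = c x + L x" for x
  proof -
    have "fexp (H y) = fexp (c y) * fexp (v y)" for y
      using fexp_add[of "c y" "v y"] c0 v0 by (simp add: v_def)
    then have "E_fps i (\<lambda>x. fexp (H x)) x = fexp (c x) * E_fps i (\<lambda>x. fexp (v x)) x"
      by (simp add: fps_eq_iff E_fps_def fps_mult_nth E_sum E_indep cupd)
    also have "\<dots> = fexp (c x) * fexp (L x)"
      by (simp add: L_def fexp_fln w0) (simp add: w_def)
    also have "\<dots> = fexp (c x + L x)" by (simp add: fexp_add c0 L0)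
    finally show ?thesis by (simp add: H'_def fln_fexp c0 L0)
  qed
  \<comment> \<open>Centering has used up one degree, hence \<open>m\<close>; the powers \<open>v^p\<close> with \<open>p \<ge> 2\<close> regain it.\<close>
  define X where "X = jet_norm m J v"
  define Aj where "Aj j = (\<Sum>(r, V)\<in>Deg m J. if j \<in> V then max_diff (insert i V) (\<lambda>x. fps_nth (H x) r) * R ^ r * (1/2) ^ (card V - 1) else 0)" for j
  have finV: "finite V" if "(r, V) \<in> Deg d J" for r d V
    using that J by (auto simp: Deg_def intro: finite_subset)
  have iV: "i \<notin> V" if "(r, V) \<in> Deg d J" for r d V
    using that i by (auto simp: Deg_def)
  have vdlt: "max_diff V (\<lambda>x. fps_nth (v x) r) \<le> max_diff (insert i V) (\<lambda>x. fps_nth (H x) r)" if "(r, V) \<in> Deg d J" for r V d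
    using max_diff_centered[OF i(1) iV[OF that] finV[OF that], of "\<lambda>x. fps_nth (H x) r"]
    by (simp add: v_def c_def E_fps_def)
  have X: "X \<le> 1 / 25"
  proof -
    have "X \<le> (\<Sum>(r, V)\<in>Deg m J. max_diff (insert i V) (\<lambda>x. fps_nth (H x) r) * R ^ r * (1/2) ^ card V)"
      unfolding X_def jet_norm_def by (intro sum_mono) (auto intro!: mult_right_mono vdlt)
    also have "\<dots> = (\<Sum>(r, V)\<in>Deg m J. max_diff (insert i V) (\<lambda>x. fps_nth (H x) r) * R ^ r * (1/2) ^ (card (insert i V) - 1))"
      by (intro sum.cong refl) (auto simp: finV iV)
    also have "\<dots> = jet_norm_at (Suc m) (insert i J) i H"
    proof -
      have "(\<Sum>(r, V)\<in>Deg (Suc m) J. if i \<in> V then max_diff V (\<lambda>x. fps_nth (H x) r) * R ^ r * (1/2) ^ (card V - 1) else 0) = 0"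
        by (intro sum.neutral) (auto simp: iV)
      then show ?thesis
        unfolding jet_norm_at_def by (simp add: sum_Deg_insert[OF J i(2)] del: card_insert_disjoint)
    qed
    also have "\<dots> \<le> 1 / 25" by (rule K) simp
    finally show ?thesis .
  qed
  have Aj0: "Aj j \<ge> 0" for j unfolding Aj_def by (intro sum_nonneg) (auto simp: max_diff_nonneg)
  have vj: "jet_norm_at m J j v \<le> Aj j" for j
    unfolding jet_norm_at_def Aj_def by (intro sum_mono) (auto intro!: mult_right_mono vdlt)
  have split: "jet_norm_at (Suc m) (insert i J) j H = jet_norm_at (Suc m) J j H + Aj j / 2" if "j \<in> J" for j
  proof -
    have "(\<Sum>(r, V)\<in>Deg m J. if j \<in> insert i V then max_diff (insert i V) (\<lambda>x. fps_nth (H x) r) * R ^ r * (1/2) ^ (card (insert i V) - 1) else 0)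
      = Aj j / 2"
      unfolding Aj_def sum_divide_distrib
    proof (intro sum.cong refl, clarify)
      fix r V assume V: "(r, V) \<in> Deg m J"
      have ji: "j \<noteq> i" using that i by auto
      show "(if j \<in> insert i V then max_diff (insert i V) (\<lambda>x. fps_nth (H x) r) * R ^ r * (1/2) ^ (card (insert i V) - 1) else 0) =
        (if j \<in> V then max_diff (insert i V) (\<lambda>x. fps_nth (H x) r) * R ^ r * (1/2) ^ (card V - 1) else 0) / 2"
      proof (cases "j \<in> V")
        case True
        then have "card V > 0" using finV[OF V] by (auto simp: card_gt_0_iff)
        then obtain k where "card V = Suc k" by (cases "card V") auto
        then show ?thesis using True V by (simp add: finV iV)
      qed (use ji in auto)
    qed
    then show ?thesis
      unfolding jet_norm_at_def by (simp add: sum_Deg_insert[OF J i(2)] del: card_insert_disjoint)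
  qed
  have wnth: "fps_nth (w x) r = E i (\<lambda>x. \<Sum>p=2..Suc m. (1 / fact p) * fps_nth (v x ^ p) r) x"
    if r: "1 \<le> r" "r \<le> Suc m" for r x
  proof -
    have Ev: "E i (\<lambda>x. fps_nth (v x) r) x = 0"
      using i by (simp add: v_def c_def E_fps_def E_diff) (simp add: coord_mean_def sum_distrib_right[symmetric] wt_sum)
    have "fps_nth (fexp (v y)) r = fps_nth (v y) r + (\<Sum>p=2..Suc m. (1 / fact p) * fps_nth (v y ^ p) r)" for y
    proof -
      have "fps_nth (fexp (v y)) r = (\<Sum>p=0..r. fps_nth (v y ^ p) r / fact p)"
        by (simp add: fps_compose_nth)
      also have "\<dots> = (\<Sum>p=0..Suc m. fps_nth (v y ^ p) r / fact p)"
        using r by (intro sum.mono_neutral_left) (auto simp: nth_power_vanish v0)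
      also have "{0..Suc m} = insert 0 (insert 1 {2..Suc m})" by auto
      finally show ?thesis using r by simp
    qed
    then have "fps_nth (w x) r = E i (\<lambda>y. fps_nth (v y) r + (\<Sum>p=2..Suc m. (1 / fact p) * fps_nth (v y ^ p) r)) x"
      using r by (simp add: w_def E_fps_def)
    then show ?thesis by (simp only: E_add Ev)
  qed
  have wdlt: "max_diff V (\<lambda>x. fps_nth (w x) r) \<le> (\<Sum>p=2..Suc m. (1 / fact p) * max_diff V (\<lambda>x. fps_nth (v x ^ p) r))"
    if rV: "(r, V) \<in> Deg (Suc m) J" for r V
  proof -
    have r: "1 \<le> r" "r \<le> Suc m" using rV by (auto simp: Deg_def)
    have "max_diff V (\<lambda>x. fps_nth (w x) r) = max_diff V (E i (\<lambda>x. \<Sum>p=2..Suc m. (1 / fact p) * fps_nth (v x ^ p) r))"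
      by (rule max_diff_cong) (rule wnth[OF r])
    also have "\<dots> \<le> max_diff V (\<lambda>x. \<Sum>p=2..Suc m. (1 / fact p) * fps_nth (v x ^ p) r)"
      by (rule max_diff_E[OF i(1) iV[OF rV]])
    also have "\<dots> \<le> (\<Sum>p=2..Suc m. \<bar>1 / fact p\<bar> * max_diff V (\<lambda>x. fps_nth (v x ^ p) r))"
      by (rule max_diff_sum_cmult)
    finally show ?thesis by simp
  qed
  \<comment> \<open>\<open>1/600\<close> is the full geometric series from \<open>p = 2\<close>; it is then the ratio of the series for the logarithm.\<close>
  have geo: "(\<Sum>p=2..Suc m. (1/25::real) ^ p) \<le> 1 / 600"
    using geometric_sum_le[of "1/25" 2 "Suc m"] by (simp add: power2_eq_square)
  have vpow: "jet_norm (Suc m) J (\<lambda>x. v x ^ p) \<le> (1/25) ^ p"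
     "jet_norm_at (Suc m) J j (\<lambda>x. v x ^ p) \<le> real p * (1/25) ^ (p - 1) * Aj j" if "2 \<le> p" for p j
  proof -
    have q: "p = Suc (p - 1)" "p - 1 \<ge> 1" using that by auto
    show "jet_norm (Suc m) J (\<lambda>x. v x ^ p) \<le> (1/25) ^ p"
      using jet_norm_power(2)[OF J v0 X[unfolded X_def] q(2)] q(1) by simp
    show "jet_norm_at (Suc m) J j (\<lambda>x. v x ^ p) \<le> real p * (1/25) ^ (p - 1) * Aj j"
      using jet_norm_at_power(2)[OF J v0 X[unfolded X_def] vj q(2), of j] q(1) by simp
  qed
  have wn: "jet_norm (Suc m) J w \<le> 1 / 600"
  proof -
    have "jet_norm (Suc m) J w \<le> (\<Sum>p=2..Suc m. (1 / fact p) * jet_norm (Suc m) J (\<lambda>x. v x ^ p))"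
      by (rule jet_norm_le_lincomb) (rule wdlt)
    also have "\<dots> \<le> (\<Sum>p=2..Suc m. 1 * (1/25) ^ p)"
      by (intro sum_mono mult_mono vpow jet_norm_nonneg) (auto simp: divide_simps)
    finally show ?thesis using geo by simp
  qed
  have wj: "jet_norm_at (Suc m) J j w \<le> Aj j / 24" for j
  proof -
    have "jet_norm_at (Suc m) J j w \<le> (\<Sum>p=2..Suc m. (1 / fact p) * jet_norm_at (Suc m) J j (\<lambda>x. v x ^ p))"
      by (rule jet_norm_at_le_lincomb) (rule wdlt)
    also have "\<dots> \<le> (\<Sum>p=2..Suc m. (1/25) ^ p * (25 * Aj j))"
    proof (intro sum_mono)
      fix p assume p: "p \<in> {2..Suc m}"
      have "(1 / fact p) * jet_norm_at (Suc m) J j (\<lambda>x. v x ^ p) \<le> (1 / fact p) * (real p * (1/25) ^ (p - 1) * Aj j)"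
        using p by (intro mult_left_mono vpow) auto
      also have "\<dots> = (real p / fact p) * ((1/25) ^ (p - 1) * Aj j)" by simp
      also have "\<dots> \<le> 1 * ((1/25) ^ (p - 1) * Aj j)"
      proof (rule mult_right_mono)
        have "real p \<le> real (fact p)" by (intro of_nat_mono fact_ge_self)
        then show "real p / fact p \<le> 1" by simp
      qed (simp add: Aj0)
      also have "\<dots> = (1/25) ^ p * (25 * Aj j)" using p by (cases p) auto
      finally show "(1 / fact p) * jet_norm_at (Suc m) J j (\<lambda>x. v x ^ p) \<le> (1/25) ^ p * (25 * Aj j)" .
    qed
    also have "\<dots> \<le> (1/600) * (25 * Aj j)"
      unfolding sum_distrib_right[symmetric] using Aj0 by (intro mult_right_mono geo) auto
    finally show ?thesis by simp
  qed
  have Ldlt: "max_diff V (\<lambda>x. fps_nth (L x) r) \<le> (\<Sum>q=1..Suc m. (1 / real q) * max_diff V (\<lambda>x. fps_nth (w x ^ q) r))"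
    if rV: "(r, V) \<in> Deg (Suc m) J" for r V
  proof -
    have r: "1 \<le> r" "r \<le> Suc m" using rV by (auto simp: Deg_def)
    have "fps_nth (L x) r = (\<Sum>q=1..Suc m. fps_nth (fps_ln 1) q * fps_nth (w x ^ q) r)" for x
    proof -
      have "fps_nth (L x) r = (\<Sum>q=0..r. fps_nth (fps_ln 1) q * fps_nth (w x ^ q) r)"
        by (simp add: L_def fps_compose_nth)
      also have "\<dots> = (\<Sum>q=0..Suc m. fps_nth (fps_ln 1) q * fps_nth (w x ^ q) r)"
        using r by (intro sum.mono_neutral_left) (auto simp: nth_power_vanish w0)
      also have "\<dots> = (\<Sum>q=1..Suc m. fps_nth (fps_ln 1) q * fps_nth (w x ^ q) r)"
        by (intro sum.mono_neutral_right) (auto simp: not_le)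
      finally show ?thesis .
    qed
    then have "max_diff V (\<lambda>x. fps_nth (L x) r) = max_diff V (\<lambda>x. \<Sum>q=1..Suc m. fps_nth (fps_ln 1) q * fps_nth (w x ^ q) r)"
      by (intro max_diff_cong)
    also have "\<dots> \<le> (\<Sum>q=1..Suc m. \<bar>fps_nth (fps_ln 1) q\<bar> * max_diff V (\<lambda>x. fps_nth (w x ^ q) r))"
      by (rule max_diff_sum_cmult)
    also have "\<dots> = (\<Sum>q=1..Suc m. (1 / real q) * max_diff V (\<lambda>x. fps_nth (w x ^ q) r))"
      by (intro sum.cong refl) (auto simp: fps_ln_nth abs_mult power_abs)
    finally show ?thesis .
  qed
  have geo2: "(\<Sum>q=1..Suc m. (1/600::real) ^ q) \<le> 1 / 599"
    using geometric_sum_le[of "1/600" 1 "Suc m"] by simp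
  have L_norm: "jet_norm (Suc m) J L \<le> 1 / 25"
  proof -
    have "jet_norm (Suc m) J L \<le> (\<Sum>q=1..Suc m. (1 / real q) * jet_norm (Suc m) J (\<lambda>x. w x ^ q))"
      by (rule jet_norm_le_lincomb) (rule Ldlt)
    also have "\<dots> \<le> (\<Sum>q=1..Suc m. 1 * (1/600) ^ q)"
      by (intro sum_mono mult_mono jet_norm_power(1)[OF J w0 wn] jet_norm_nonneg) auto
    finally show ?thesis using geo2 by simp
  qed
  have Lj: "jet_norm_at (Suc m) J j L \<le> Aj j / 2" for j
  proof -
    have "jet_norm_at (Suc m) J j L \<le> (\<Sum>q=1..Suc m. (1 / real q) * jet_norm_at (Suc m) J j (\<lambda>x. w x ^ q))"
      by (rule jet_norm_at_le_lincomb) (rule Ldlt)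
    also have "\<dots> \<le> (\<Sum>q=1..Suc m. (1/600) ^ q * (25 * Aj j))"
    proof (intro sum_mono)
      fix q assume q: "q \<in> {1..Suc m}"
      have "(1 / real q) * jet_norm_at (Suc m) J j (\<lambda>x. w x ^ q) \<le> (1 / real q) * (real q * (1/600) ^ (q - 1) * (Aj j / 24))"
        using q by (intro mult_left_mono jet_norm_at_power(1)[OF J w0 wn wj]) auto
      also have "\<dots> = (1/600) ^ q * (25 * Aj j)" using q by (cases q) auto
      finally show "(1 / real q) * jet_norm_at (Suc m) J j (\<lambda>x. w x ^ q) \<le> (1/600) ^ q * (25 * Aj j)" .
    qed
    also have "\<dots> \<le> (1/599) * (25 * Aj j)"
      unfolding sum_distrib_right[symmetric] using Aj0 by (intro mult_right_mono geo2) auto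
    finally show ?thesis using Aj0[of j] by simp
  qed
  show "jet_norm_at (Suc m) J j H' \<le> jet_norm_at (Suc m) (insert i J) j H" if "j \<in> J" for j
  proof -
    have "jet_norm_at (Suc m) J j H' \<le> (\<Sum>k\<in>{True, False}. 1 * jet_norm_at (Suc m) J j (if k then H else L))"
    proof (rule jet_norm_at_le_lincomb)
      fix r V assume rV: "(r, V) \<in> Deg (Suc m) J"
      have "max_diff V (\<lambda>x. fps_nth (H' x) r) \<le> max_diff V (\<lambda>x. fps_nth (c x) r) + max_diff V (\<lambda>x. fps_nth (L x) r)"
        using max_diff_add[of V "\<lambda>x. fps_nth (c x) r" "\<lambda>x. fps_nth (L x) r"] by (simp add: H'eq)
      moreover have "max_diff V (\<lambda>x. fps_nth (c x) r) \<le> max_diff V (\<lambda>x. fps_nth (H x) r)"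
        using max_diff_E[OF i(1) iV[OF rV], of "\<lambda>x. fps_nth (H x) r"] by (simp add: c_def E_fps_def)
      ultimately show "max_diff V (\<lambda>x. fps_nth (H' x) r) \<le> (\<Sum>k\<in>{True, False}. 1 * max_diff V (\<lambda>x. fps_nth ((if k then H else L) x) r))"
        by simp
    qed
    then show ?thesis using Lj[of j] split[OF that] by simp
  qed
  show "\<bar>ln (E i (\<lambda>x. exp (\<Sum>r=1..m. fps_nth (H x) r)) x) - (\<Sum>r=1..m. fps_nth (H' x) r)\<bar> * R ^ (m + 1) \<le> 5 / 2"
    if x: "x \<in> S" for x
  proof -
    define a where "a = E i (\<lambda>x. exp (\<Sum>r=1..m. fps_nth (v x) r)) x"
    define b where "b = exp (\<Sum>r=1..m. fps_nth (L x) r)"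
    have abs_sum: "\<bar>\<Sum>r=1..m. u r\<bar> \<le> (\<Sum>r=1..m. \<bar>u r\<bar> * R ^ r)" for u :: "nat \<Rightarrow> real"
    proof -
      have "\<bar>u r\<bar> * 1 \<le> \<bar>u r\<bar> * R ^ r" for r using R_ge1 by (intro mult_left_mono) auto
      then show ?thesis by (intro order_trans[OF sum_abs] sum_mono) simp
    qed
    have vK: "(\<Sum>r=1..m. \<bar>fps_nth (v z) r\<bar> * R ^ r) \<le> 1 / 25" if "z \<in> S" for z
      using sum_nth_le_jet_norm[OF that J, of v m] X by (simp add: X_def)
    have LK: "(\<Sum>r=1..m. \<bar>fps_nth (L x) r\<bar> * R ^ r) \<le> 1 / 25"
      using sum_nth_le_jet_norm[OF x J, of L m] jet_norm_mono[OF J, of m "Suc m" L] L_norm by simp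
    have "E i (\<lambda>x. exp (\<Sum>r=1..m. fps_nth (H x) r)) x = E i (\<lambda>x. exp (\<Sum>r=1..m. fps_nth (c x) r) * exp (\<Sum>r=1..m. fps_nth (v x) r)) x"
      by (simp add: exp_add[symmetric] sum.distrib[symmetric] v_def)
    also have "\<dots> = exp (\<Sum>r=1..m. fps_nth (c x) r) * a"
      unfolding a_def by (rule E_indep) (simp add: cupd)
    finally have eH: "E i (\<lambda>x. exp (\<Sum>r=1..m. fps_nth (H x) r)) x = exp (\<Sum>r=1..m. fps_nth (c x) r) * a" .
    have a_ge: "a \<ge> exp (- (1/25))"
    proof -
      have "E i (\<lambda>_. exp (- (1/25))) x \<le> a"
        unfolding a_def
      proof (rule E_mono[OF i(1) x])
        fix z assume "z \<in> S"
        from vK[OF this] abs_sum[of "fps_nth (v z)"] show "exp (- (1/25)) \<le> exp (\<Sum>r=1..m. fps_nth (v z) r)"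
          by (subst exp_le_cancel_iff) linarith
      qed
      then show ?thesis using i by (simp add: E_const)
    qed
    have b_ge: "b \<ge> exp (- (1/25))"
      unfolding b_def using LK abs_sum[of "fps_nth (L x)"] by (subst exp_le_cancel_iff) linarith
    define t where "t = (\<Sum>r\<le>m. fps_nth (fexp (L x)) r)"
    have t_eq: "t = E i (\<lambda>x. \<Sum>r\<le>m. fps_nth (fexp (v x)) r) x"
    proof -
      have "fexp (L x) = E_fps i (\<lambda>x. fexp (v x)) x" by (simp add: L_def fexp_fln w0) (simp add: w_def)
      then show ?thesis by (simp add: t_def E_fps_def E_sum)
    qed
    have Rp: "R ^ (m + 1) > 0" by simp
    have "\<bar>a - t\<bar> \<le> exp (1/25) / R ^ (m+1)"
      unfolding a_def t_eq E_diff[symmetric]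
      by (rule E_abs_le[OF i(1) x])
         (use fexp_truncation_error[OF v0 R_ge1 vK] Rp in \<open>simp only: pos_le_divide_eq\<close>)
    moreover have "\<bar>b - t\<bar> \<le> exp (1/25) / R ^ (m+1)"
      unfolding b_def t_def using fexp_truncation_error[OF L0 R_ge1 LK] Rp by (simp only: pos_le_divide_eq)
    ultimately have "\<bar>a - b\<bar> \<le> 2 * exp (1/25) / R ^ (m + 1)" by linarith
    then have "\<bar>ln a - ln b\<bar> \<le> 2 * exp (1/25) / R ^ (m + 1) / exp (- (1/25))"
      by (intro order_trans[OF abs_ln_diff_le[OF _ a_ge b_ge]] divide_right_mono) auto
    also have "\<dots> = 2 * exp (2/25) / R ^ (m + 1)"
      by (simp add: exp_minus field_simps exp_add[symmetric] mult_exp_exp)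
    also have "\<dots> \<le> (5 / 2) / R ^ (m + 1)"
      using exp_bound[of "2/25"] by (intro divide_right_mono) (auto simp: power2_eq_square)
    finally have "\<bar>ln a - ln b\<bar> * R ^ (m + 1) \<le> 5 / 2" using Rp by (simp only: pos_le_divide_eq)
    moreover have "ln (E i (\<lambda>x. exp (\<Sum>r=1..m. fps_nth (H x) r)) x) - (\<Sum>r=1..m. fps_nth (H' x) r) = ln a - ln b"
    proof -
      have "a > 0" using a_ge by (rule less_le_trans[OF exp_gt_zero])
      then show ?thesis unfolding eH b_def by (simp add: ln_mult H'eq sum.distrib)
    qed
    ultimately show ?thesis by simp
  qed
qed

text \<open>
  The expansion for finite products. The series \<open>H k\<close> is the formal logarithm of the conditional moment
  series after \<open>k\<close> averages. By \<open>log_mean_exp_step\<close> its norms at all remaining coordinates stay at most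
  \<open>1/25\<close> (\<open>inv\<close>), so each step moves \<open>ln E\<^sub>k[exp p\<^sub>k]\<close> away from \<open>p\<^bsub>k+1\<^esub>\<close> by at most the same \<open>\<epsilon>\<close>
  (\<open>step\<close>), and monotonicity of the averages accumulates these errors to \<open>n \<epsilon>\<close> (\<open>main\<close>).
\<close>
theorem cumulant_expansion:
  assumes m: "m \<ge> 1"
    and alpha: "\<And>l j. l \<in> {1..m} \<Longrightarrow> j < n \<Longrightarrow> (\<Sum>V | V \<subseteq> {..<n} \<and> card V = l \<and> j \<in> V. max_diff V g) \<le> \<alpha>"
    and R: "R * \<alpha> \<le> 1 / 50" and x: "x \<in> S"
  shows "\<bar>ln (iter_mean A wt n (\<lambda>x. exp (g x)) x)
      - (\<Sum>r=1..m. fps_nth (fln (Abs_fps (\<lambda>r. iter_mean A wt n (\<lambda>x. g x ^ r) x / fact r) - 1)) r)\<bar> \<le> n * (5 / 2) / R ^ (m + 1)"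
proof -
  define Mom where "Mom k x = Abs_fps (\<lambda>r. iter_mean A wt k (\<lambda>x. g x ^ r) x / fact r)" for k x
  define H where "H k x = fln (Mom k x - 1)" for k x
  have Mom0: "fps_nth (Mom k x) 0 = 1" if "k \<le> n" for k x
    using iter_mean_const[OF that, of 1] by (simp add: Mom_def)
  have H0: "fps_nth (H k x) 0 = 0" for k x by (simp add: H_def)
  have ExpH: "fexp (H k x) = Mom k x" if "k \<le> n" for k x
    using fexp_fln[of "Mom k x - 1"] Mom0[OF that] by (simp add: H_def)
  have MomSuc: "Mom (Suc k) x = E_fps k (Mom k) x" for k x
    by (simp add: Mom_def E_fps_def fps_eq_iff coord_mean_def sum_divide_distrib)
  have HSuc: "H (Suc k) = (\<lambda>x. fln (E_fps k (\<lambda>x. fexp (H k x)) x - 1))" if "k \<le> n" for k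
    by (rule ext) (simp add: H_def[of "Suc k"] MomSuc ExpH[OF that])
  have Hzero: "H 0 x = fps_const (g x) * fps_X" for x
  proof -
    have "fexp (fps_const (g x) * fps_X) = Mom 0 x"
      by (simp add: fps_compose_linear Mom_def fps_eq_iff)
    then show ?thesis unfolding H_def by (metis fln_fexp fps_mult_fps_X_nonzero(2) fps_mult_fps_X_commute fps_mult_nth_0 fps_X_nth mult_zero_right zero_neq_one)
  qed
  have inv: "jet_norm_at (Suc m) {k..<n} j (H k) \<le> 1 / 25" if "k \<le> n" "j \<in> {k..<n}" for k j
    using that
  proof (induction k arbitrary: j)
    case 0
    have dlt0: "max_diff V (\<lambda>x. fps_nth (H 0 x) r) = (if r = 1 then max_diff V g else 0)" for r V
    proof (cases "r = 1")
      case False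
      have "max_diff V (\<lambda>x. fps_nth (H 0 x) r) \<le> 0"
        using False by (intro max_diff_le) (auto simp: Hzero mixed_diff_def intro!: sum.neutral)
      then show ?thesis using False max_diff_nonneg[of V] by (simp add: order_antisym)
    qed (simp add: Hzero)
    define W where "W l = {V. V \<subseteq> {..<n} \<and> card V = l \<and> j \<in> V}" for l
    have finW: "finite (W l)" for l by (rule finite_subset[of _ "Pow {..<n}"]) (auto simp: W_def)
    \<comment> \<open>Only \<open>r = 1\<close> occurs in \<open>t g\<close>; grouping the sets by size gives \<open>R \<alpha> (1 + 1/2 + 1/4 + \<dots>) \<le> 2 R \<alpha>\<close>.\<close>
    have "jet_norm_at (Suc m) {0..<n} j (H 0) = (\<Sum>p\<in>(\<Union>l\<in>{1..m}. (\<lambda>V. (1::nat, V)) ` W l). (case p of (r, V) \<Rightarrow> max_diff V g * R * (1/2) ^ (card V - 1)))"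
      unfolding jet_norm_at_def
    proof (rule sum.mono_neutral_cong_right)
      show "finite (Deg (Suc m) {0..<n})" by (simp add: finite_Deg)
      show "(\<Union>l\<in>{1..m}. (\<lambda>V. (1::nat, V)) ` W l) \<subseteq> Deg (Suc m) {0..<n}"
        by (auto simp: W_def Deg_def)
      show "\<forall>p\<in>Deg (Suc m) {0..<n} - (\<Union>l\<in>{1..m}. (\<lambda>V. (1::nat, V)) ` W l).
        (case p of (r, V) \<Rightarrow> if j \<in> V then max_diff V (\<lambda>x. fps_nth (H 0 x) r) * R ^ r * (1/2) ^ (card V - 1) else 0) = 0"
      proof (intro ballI, clarsimp simp: dlt0)
        fix V assume V: "(Suc 0, V) \<in> Deg (Suc m) {0..<n}" and nin: "\<forall>l\<in>{Suc 0..m}. (Suc 0, V) \<notin> Pair (Suc 0) ` W l"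
          and j: "j \<in> V"
        have "finite V" using V by (auto simp: Deg_def intro: finite_subset)
        then have "card V \<ge> 1" using j by (metis card_gt_0_iff empty_iff less_eq_Suc_le One_nat_def)
        then have "card V \<in> {Suc 0..m}" using V by (auto simp: Deg_def)
        moreover have "V \<in> W (card V)" using V j by (auto simp: W_def Deg_def lessThan_atLeast0)
        ultimately have False using nin by auto
        then show "max_diff V g = 0" by simp
      qed
      show "(case p of (r, V) \<Rightarrow> if j \<in> V then max_diff V (\<lambda>x. fps_nth (H 0 x) r) * R ^ r * (1/2) ^ (card V - 1) else 0)
         = (case p of (r, V) \<Rightarrow> max_diff V g * R * (1/2) ^ (card V - 1))"
        if "p \<in> (\<Union>l\<in>{1..m}. (\<lambda>V. (1::nat, V)) ` W l)" for p
        using that by (auto simp: dlt0 W_def)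
    qed
    also have "\<dots> = (\<Sum>l=1..m. \<Sum>p\<in>(\<lambda>V. (1::nat, V)) ` W l. (case p of (r, V) \<Rightarrow> max_diff V g * R * (1/2) ^ (card V - 1)))"
      by (rule sum.UNION_disjoint) (auto simp: finW W_def)
    also have "\<dots> = (\<Sum>l=1..m. (\<Sum>V\<in>W l. max_diff V g) * (R * (1/2) ^ (l - 1)))"
    proof (intro sum.cong refl)
      fix l
      show "(\<Sum>p\<in>(\<lambda>V. (1::nat, V)) ` W l. (case p of (r, V) \<Rightarrow> max_diff V g * R * (1/2) ^ (card V - 1))) =
        (\<Sum>V\<in>W l. max_diff V g) * (R * (1/2) ^ (l - 1))"
        by (subst sum.reindex) (auto simp: inj_on_def W_def sum_distrib_right mult.assoc)
    qed
    also have "\<dots> \<le> (\<Sum>l=1..m. \<alpha> * (R * (1/2) ^ (l - 1)))"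
      using alpha 0 by (intro sum_mono mult_right_mono) (auto simp: W_def)
    also have "\<dots> = (R * \<alpha>) * (\<Sum>l=1..m. (1/2) ^ (l - 1))"
      by (simp add: sum_distrib_left mult_ac)
    also have "\<dots> \<le> (R * \<alpha>) * 2"
    proof (rule mult_left_mono)
      have "(\<Sum>l=1..m. (1/2::real) ^ (l - 1)) = (\<Sum>l=1..m. 2 * (1/2) ^ l)"
        by (intro sum.cong refl) (auto simp: power_eq_if)
      also have "\<dots> \<le> 2" unfolding sum_distrib_left[symmetric] using geometric_sum_le[of "1/2" 1 m] by simp
      finally show "(\<Sum>l=1..m. (1/2::real) ^ (l - 1)) \<le> 2" .
      have "0 \<le> (\<Sum>V | V \<subseteq> {..<n} \<and> card V = 1 \<and> j \<in> V. max_diff V g)" by (intro sum_nonneg max_diff_nonneg)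
      also have "\<dots> \<le> \<alpha>" using alpha[of 1 j] m 0 by simp
      finally show "0 \<le> R * \<alpha>" by simp
    qed
    also have "\<dots> \<le> 1 / 25" using R by simp
    finally show ?case .
  next
    case (Suc k)
    have ins: "{k..<n} = insert k {Suc k..<n}" using Suc by auto
    have "jet_norm_at (Suc m) {Suc k..<n} j (H (Suc k)) \<le> jet_norm_at (Suc m) (insert k {Suc k..<n}) j (H k)"
      unfolding HSuc[OF Suc_leD[OF Suc.prems(1)]]
      by (rule log_mean_exp_step(1)) (use Suc H0 ins in \<open>auto simp: Suc_le_eq\<close>)
    also have "\<dots> \<le> 1 / 25" using Suc ins by auto
    finally show ?case .
  qed
  have inv2: "jet_norm_at (Suc m) {k..<n} j (H k) \<le> 1 / 25" if "k < n" "j \<in> {k..<n}" for k j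
    using inv that by auto
  define p where "p k x = (\<Sum>r=1..m. fps_nth (H k x) r)" for k x
  define \<epsilon> where "\<epsilon> = (5 / 2) / R ^ (m + 1)"
  have step: "\<bar>ln (E k (\<lambda>x. exp (p k x)) x) - p (Suc k) x\<bar> \<le> \<epsilon>" if k: "k < n" and x: "x \<in> S" for k x
  proof -
    have ins: "{k..<n} = insert k {Suc k..<n}" using k by auto
    have "\<bar>ln (E k (\<lambda>x. exp (p k x)) x) - p (Suc k) x\<bar> * R ^ (m + 1) \<le> 5 / 2"
      unfolding p_def HSuc[OF less_imp_le[OF k]]
      by (rule log_mean_exp_step(2)[where J = "{Suc k..<n}"]) (use k x H0 inv2[OF k] ins in auto)
    then show ?thesis unfolding \<epsilon>_def by (subst pos_le_divide_eq) auto
  qed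
  have Epos: "E k (\<lambda>x. exp (p k x)) x > 0" if k: "k < n" for k x
  proof -
    have "\<exists>a\<in>A k. wt k a > 0"
    proof (rule ccontr)
      assume "\<not> ?thesis"
      then have "(\<Sum>a\<in>A k. wt k a) \<le> 0" by (intro sum_nonpos) (auto simp: not_less)
      then show False using wt_sum[OF k] by simp
    qed
    then obtain a where a: "a \<in> A k" "wt k a > 0" by auto
    show ?thesis unfolding coord_mean_def
      by (rule sum_pos2[OF finite_A[OF k] a(1)]) (use a wt_nonneg[OF k] in auto)
  qed
  have main: "exp (p k x) \<le> exp (k * \<epsilon>) * iter_mean A wt k (\<lambda>x. exp (g x)) x \<and> exp (- (k * \<epsilon>)) * iter_mean A wt k (\<lambda>x. exp (g x)) x \<le> exp (p k x)"
    if "k \<le> n" "x \<in> S" for k x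
    using that
  proof (induction k arbitrary: x)
    case 0
    have "p 0 x = g x"
    proof -
      have "p 0 x = (\<Sum>r\<in>{1}. fps_nth (H 0 x) r)"
        unfolding p_def using m by (intro sum.mono_neutral_right) (auto simp: Hzero)
      then show ?thesis by (simp add: Hzero)
    qed
    then show ?case by simp
  next
    case (Suc k)
    then have k: "k < n" and x: "x \<in> S" by auto
    have st: "\<bar>ln (E k (\<lambda>x. exp (p k x)) x) - p (Suc k) x\<bar> \<le> \<epsilon>" by (rule step[OF k x])
    have up: "E k (\<lambda>x. exp (p k x)) x \<le> exp (k * \<epsilon>) * iter_mean A wt (Suc k) (\<lambda>x. exp (g x)) x"
      unfolding iter_mean.simps E_cmult[symmetric] using Suc k x by (intro E_mono) auto
    have lo: "exp (- (k * \<epsilon>)) * iter_mean A wt (Suc k) (\<lambda>x. exp (g x)) x \<le> E k (\<lambda>x. exp (p k x)) x"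
      unfolding iter_mean.simps E_cmult[symmetric] using Suc k x by (intro E_mono) auto
    have "exp (p (Suc k) x) \<le> exp (\<epsilon> + ln (E k (\<lambda>x. exp (p k x)) x))"
      using st by (subst exp_le_cancel_iff) linarith
    also have "\<dots> = exp \<epsilon> * E k (\<lambda>x. exp (p k x)) x" using Epos[OF k] by (simp add: exp_add)
    also have "\<dots> \<le> exp \<epsilon> * (exp (k * \<epsilon>) * iter_mean A wt (Suc k) (\<lambda>x. exp (g x)) x)" using up by simp
    finally have 1: "exp (p (Suc k) x) \<le> exp (Suc k * \<epsilon>) * iter_mean A wt (Suc k) (\<lambda>x. exp (g x)) x"
      by (simp add: algebra_simps exp_add)
    have "exp (- \<epsilon>) * (exp (- (k * \<epsilon>)) * iter_mean A wt (Suc k) (\<lambda>x. exp (g x)) x) \<le> exp (- \<epsilon>) * E k (\<lambda>x. exp (p k x)) x"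
      using lo by simp
    also have "\<dots> = exp (- \<epsilon> + ln (E k (\<lambda>x. exp (p k x)) x))" using Epos[OF k, of x] by (simp only: exp_add exp_ln)
    also have "\<dots> \<le> exp (p (Suc k) x)"
      using st by (subst exp_le_cancel_iff) linarith
    finally have 2: "exp (- (Suc k * \<epsilon>)) * iter_mean A wt (Suc k) (\<lambda>x. exp (g x)) x \<le> exp (p (Suc k) x)"
      by (simp add: algebra_simps exp_add exp_minus exp_diff divide_simps)
    show ?case using 1 2 by blast
  qed
  have Ipos: "iter_mean A wt n (\<lambda>x. exp (g x)) x > 0" by (rule iter_mean_pos) (use x in auto)
  define Z where "Z = iter_mean A wt n (\<lambda>x. exp (g x)) x"
  have Zp: "Z > 0" using Ipos by (simp add: Z_def)
  have "exp (p n x) \<le> exp (n * \<epsilon> + ln Z)" "exp (- (n * \<epsilon>) + ln Z) \<le> exp (p n x)"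
    using main[OF order_refl x] Zp unfolding exp_add by (simp_all add: Z_def)
  then have "\<bar>ln Z - p n x\<bar> \<le> n * \<epsilon>"
    unfolding exp_le_cancel_iff by linarith
  then show ?thesis by (simp add: p_def H_def Mom_def \<epsilon>_def Z_def)
qed

end

section \<open>Discretization of product measures\<close>

text \<open>
  Cut the space into the finitely many cells on which all \<open>\<lfloor>G / \<epsilon>\<rfloor>\<close> are constant. Each \<open>G\<close> varies by at
  most \<open>\<epsilon>\<close> on a cell, so any point of a cell may carry its probability. A cell of positive probability
  contains a point with property \<open>Q\<close>; the other cells are dropped.
\<close>
lemma (in prob_space) discretize_functions:
  fixes GG :: "('a \<Rightarrow> real) set"
  assumes fin: "finite GG" and meas: "\<And>G. G \<in> GG \<Longrightarrow> G \<in> borel_measurable M"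
    and bdd: "\<And>G a. G \<in> GG \<Longrightarrow> a \<in> space M \<Longrightarrow> \<bar>G a\<bar> \<le> B"
    and Q: "AE a in M. Q a" and eps: "\<epsilon> > 0"
  shows "\<exists>A w. finite A \<and> A \<subseteq> space M \<and> (\<forall>a\<in>A. Q a \<and> w a \<ge> 0) \<and> (\<Sum>a\<in>A. w a) = 1 \<and>
     (\<forall>G\<in>GG. \<bar>(\<Sum>a\<in>A. w a * G a) - (\<integral>a. G a \<partial>M)\<bar> \<le> \<epsilon>)"
proof -
  define \<phi> where "\<phi> a = (\<lambda>G\<in>GG. \<lfloor>G a / \<epsilon>\<rfloor>)" for a
  define N where "N = \<lceil>B / \<epsilon>\<rceil>"
  define Vs where "Vs = PiE GG (\<lambda>_. {-N - 1..N})"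
  have finVs: "finite Vs" unfolding Vs_def using fin by (intro finite_PiE) auto
  have \<phi>_Vs: "\<phi> a \<in> Vs" if "a \<in> space M" for a
  proof -
    have "\<lfloor>G a / \<epsilon>\<rfloor> \<in> {-N - 1..N}" if G: "G \<in> GG" for G
    proof -
      have "\<bar>G a\<bar> \<le> B" using bdd[OF G \<open>a \<in> space M\<close>] .
      then have "- B \<le> G a" "G a \<le> B" by auto
      then have "- B / \<epsilon> \<le> G a / \<epsilon>" "G a / \<epsilon> \<le> B / \<epsilon>" using eps by (intro divide_right_mono; simp)+
      then have "- N - 1 \<le> \<lfloor>G a / \<epsilon>\<rfloor> \<and> \<lfloor>G a / \<epsilon>\<rfloor> \<le> N" unfolding N_def by (intro conjI; simp; linarith)
      then show ?thesis by simp
    qed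
    then show ?thesis by (auto simp: Vs_def \<phi>_def)
  qed
  define c where "c v = {a \<in> space M. \<phi> a = v}" for v
  have c_alt: "c v = {a \<in> space M. \<forall>G\<in>GG. \<lfloor>G a / \<epsilon>\<rfloor> = v G}" if "v \<in> Vs" for v
    using that by (auto simp: c_def \<phi>_def Vs_def fun_eq_iff restrict_def PiE_def extensional_def)
  have c_sets: "c v \<in> sets M" if "v \<in> Vs" for v
  proof -
    have "Measurable.pred M (\<lambda>a. \<lfloor>G a / \<epsilon>\<rfloor> = v G)" if "G \<in> GG" for G
      using meas[OF that] by measurable
    then have "Measurable.pred M (\<lambda>a. \<forall>G\<in>GG. \<lfloor>G a / \<epsilon>\<rfloor> = v G)"
      using fin by measurable
    then show ?thesis unfolding c_alt[OF that] by measurable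
  qed
  define Vp where "Vp = {v \<in> Vs. prob (c v) > 0}"
  have finVp: "finite Vp" using finVs by (simp add: Vp_def)
  have "\<exists>a. a \<in> c v \<and> Q a" if "v \<in> Vp" for v
  proof (rule ccontr)
    assume "\<nexists>a. a \<in> c v \<and> Q a"
    then have "AE a in M. a \<notin> c v" using Q by (auto elim!: eventually_mono)
    then have "c v \<in> null_sets M" using that c_sets by (subst AE_iff_null_sets) (auto simp: Vp_def)
    then have "prob (c v) = 0" by (simp add: measure_eq_0_null_sets)
    then show False using that by (simp add: Vp_def)
  qed
  then obtain a where a: "\<And>v. v \<in> Vp \<Longrightarrow> a v \<in> c v \<and> Q (a v)" by metis
  have "\<phi> (a v) = v" if "v \<in> Vp" for v using a[OF that] by (simp add: c_def)
  then have inj: "inj_on a Vp" by (metis inj_on_inverseI)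
  define w where "w z = prob (c (\<phi> z))" for z
  have wa: "w (a v) = prob (c v)" if "v \<in> Vp" for v using a[OF that] by (auto simp: w_def c_def)
  have AEc: "AE z in M. \<phi> z \<in> Vp"
  proof -
    have "AE z in M. z \<notin> c v" if "v \<in> Vs - Vp" for v
    proof -
      have "prob (c v) = 0" using that measure_nonneg[of M "c v"] by (auto simp: Vp_def)
      then have "c v \<in> null_sets M" using c_sets that by (auto simp: null_sets_def emeasure_eq_measure)
      then show ?thesis by (rule AE_not_in)
    qed
    then have "AE z in M. \<forall>v\<in>Vs - Vp. z \<notin> c v"
      using finVs by (intro AE_finite_allI) auto
    then show ?thesis using AE_space by eventually_elim (use \<phi>_Vs in \<open>auto simp: c_def\<close>)
  qed
  have step_int: "(\<integral>z. (\<Sum>v\<in>Vp. indicator (c v) z * h v) \<partial>M) = (\<Sum>v\<in>Vp. prob (c v) * h v)" for h :: "_ \<Rightarrow> real"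
    using c_sets by (subst Bochner_Integration.integral_sum) (auto simp: Vp_def emeasure_eq_measure intro!: sum.cong)
  have step_val: "(\<Sum>v\<in>Vp. indicator (c v) z * h v) = h (\<phi> z)" if "\<phi> z \<in> Vp" "z \<in> space M" for z and h :: "_ \<Rightarrow> real"
  proof -
    have "(\<Sum>v\<in>Vp. indicator (c v) z * h v) = (\<Sum>v\<in>Vp. if v = \<phi> z then h v else 0)"
      using that by (intro sum.cong) (auto simp: c_def indicator_def)
    then show ?thesis using that finVp by simp
  qed
  show ?thesis
  proof (intro exI[of _ "a ` Vp"] exI[of _ w] conjI ballI)
    show "finite (a ` Vp)" using finVp by simp
    show "a ` Vp \<subseteq> space M" using a by (auto simp: c_def)
    show "Q z" "w z \<ge> 0" if "z \<in> a ` Vp" for z using that a by (auto simp: w_def)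
    have "(\<Sum>v\<in>Vp. prob (c v) * 1) = (\<integral>z. 1 \<partial>M)"
      unfolding step_int[symmetric]
    proof (rule integral_cong_AE)
      show "AE z in M. (\<Sum>v\<in>Vp. indicator (c v) z * 1) = (1::real)"
        using AEc AE_space by eventually_elim (rule step_val[of _ "\<lambda>_. 1"])
      show "(\<lambda>z. \<Sum>v\<in>Vp. indicator (c v) z * (1::real)) \<in> borel_measurable M"
        using c_sets by (auto simp: Vp_def intro!: borel_measurable_sum)
    qed simp
    then show "(\<Sum>z\<in>a ` Vp. w z) = 1"
      by (subst sum.reindex[OF inj]) (simp add: wa prob_space)
    fix G assume G: "G \<in> GG"
    have "(\<Sum>z\<in>a ` Vp. w z * G z) = (\<Sum>v\<in>Vp. prob (c v) * G (a v))"
      by (subst sum.reindex[OF inj]) (simp add: wa)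
    also have "\<dots> = (\<integral>z. (\<Sum>v\<in>Vp. indicator (c v) z * G (a v)) \<partial>M)" by (rule step_int[symmetric])
    finally have eq: "(\<Sum>z\<in>a ` Vp. w z * G z) = (\<integral>z. (\<Sum>v\<in>Vp. indicator (c v) z * G (a v)) \<partial>M)" .
    have intG: "integrable M G"
      using bdd[OF G] by (intro integrable_const_bound[of _ B] meas G) auto
    have intS: "integrable M (\<lambda>z. \<Sum>v\<in>Vp. indicator (c v) z * G (a v))"
      using c_sets by (intro Bochner_Integration.integrable_sum integrable_mult_left) (auto simp: Vp_def emeasure_eq_measure)
    have AEd: "AE z in M. norm ((\<Sum>v\<in>Vp. indicator (c v) z * G (a v)) - G z) \<le> \<epsilon>"
      using AEc AE_space
    proof eventually_elim
      fix z assume z: "\<phi> z \<in> Vp" "z \<in> space M"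
      have "\<phi> (a (\<phi> z)) = \<phi> z" using a[OF z(1)] by (auto simp: c_def)
      then have "\<lfloor>G (a (\<phi> z)) / \<epsilon>\<rfloor> = \<lfloor>G z / \<epsilon>\<rfloor>" using G by (auto simp: \<phi>_def fun_eq_iff restrict_def split: if_splits)
      then have "\<bar>G (a (\<phi> z)) / \<epsilon> - G z / \<epsilon>\<bar> \<le> 1" by linarith
      then have "\<bar>G (a (\<phi> z)) - G z\<bar> / \<epsilon> \<le> 1" using eps by (simp add: diff_divide_distrib[symmetric] abs_divide)
      then show "norm ((\<Sum>v\<in>Vp. indicator (c v) z * G (a v)) - G z) \<le> \<epsilon>"
        using eps z by (simp add: step_val[of z "\<lambda>v. G (a v)"] divide_le_eq)
    qed
    have "\<bar>(\<Sum>z\<in>a ` Vp. w z * G z) - (\<integral>z. G z \<partial>M)\<bar> = norm (\<integral>z. (\<Sum>v\<in>Vp. indicator (c v) z * G (a v)) - G z \<partial>M)"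
      unfolding eq using intG intS by simp
    also have "\<dots> \<le> (\<integral>z. norm ((\<Sum>v\<in>Vp. indicator (c v) z * G (a v)) - G z) \<partial>M)"
      by (rule integral_norm_bound)
    also have "\<dots> \<le> (\<integral>z. \<epsilon> \<partial>M)"
      using intG intS AEd by (intro integral_mono_AE) auto
    finally show "\<bar>(\<Sum>z\<in>a ` Vp. w z * G z) - (\<integral>z. G z \<partial>M)\<bar> \<le> \<epsilon>" by (simp add: prob_space)
  qed
qed

text \<open>
  Almost all sections of a null set are null, here the sections at a fixed value of the new
  coordinate, which is the one chosen first in \<open>discretize_product\<close>.
\<close>
lemma (in product_sigma_finite) AE_PiM_insert_rev:
  assumes I: "finite I" "i \<notin> I" and Q: "AE x in PiM (insert i I) M. Q x"
  shows "AE a in M i. AE x in PiM I M. Q (x(i := a))"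
proof -
  from Q obtain N where N: "{x \<in> space (PiM (insert i I) M). \<not> Q x} \<subseteq> N" "N \<in> sets (PiM (insert i I) M)"
    "emeasure (PiM (insert i I) M) N = 0" by (rule AE_E)
  have [measurable]: "N \<in> sets (PiM (insert i I) M)" by fact
  interpret sf: sigma_finite_measure "PiM I M" by (rule sigma_finite[OF I(1)])
  have m: "(\<lambda>(x, y). indicator N (x(i := y)) :: ennreal) \<in> borel_measurable (PiM I M \<Otimes>\<^sub>M M i)"
    using measurable_compose[OF measurable_add_dim[of i I M], of "indicator N :: _ \<Rightarrow> ennreal" borel] by (simp add: split_def)
  have m2: "(\<lambda>(y, x). indicator N (x(i := y)) :: ennreal) \<in> borel_measurable (M i \<Otimes>\<^sub>M PiM I M)"
    using measurable_compose[OF measurable_pair_swap' m] by (simp add: split_def)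
  have "(\<integral>\<^sup>+ y. (\<integral>\<^sup>+ x. indicator N (x(i := y)) \<partial>(PiM I M)) \<partial>(M i)) = emeasure (PiM (insert i I) M) N"
    by (subst product_nn_integral_insert_rev[OF I, symmetric]) auto
  then have "(\<integral>\<^sup>+ y. (\<integral>\<^sup>+ x. indicator N (x(i := y)) \<partial>(PiM I M)) \<partial>(M i)) = 0" using N by simp
  then have "AE y in M i. (\<integral>\<^sup>+ x. indicator N (x(i := y)) \<partial>(PiM I M)) = 0"
    by (subst (asm) nn_integral_0_iff_AE) (use sf.borel_measurable_nn_integral[OF m2] in auto)
  then show ?thesis
    using AE_space
  proof eventually_elim
    fix y assume y: "(\<integral>\<^sup>+ x. indicator N (x(i := y)) \<partial>(PiM I M)) = 0" "y \<in> space (M i)"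
    have "(\<lambda>x. indicator N (x(i := y)) :: ennreal) \<in> borel_measurable (PiM I M)"
      using measurable_Pair2[OF m2 y(2)] by simp
    then have "AE x in PiM I M. indicator N (x(i := y)) = (0::ennreal)"
      using y by (subst (asm) nn_integral_0_iff_AE) auto
    then show "AE x in PiM I M. Q (x(i := y))"
      using AE_space
    proof eventually_elim
      fix x assume "indicator N (x(i := y)) = (0::ennreal)" "x \<in> space (PiM I M)"
      moreover have "x(i := y) \<in> space (PiM (insert i I) M)"
        using \<open>x \<in> space (PiM I M)\<close> y(2) I by (auto simp: space_PiM PiE_iff extensional_def)
      ultimately show "Q (x(i := y))" using N(1) by (auto simp: indicator_def split: if_splits)
    qed
  qed
qed

lemma (in product_sigma_finite) product_integral_insert_rev:
  fixes f :: "_ \<Rightarrow> real"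
  assumes I: "finite I" "i \<notin> I" and f: "integrable (PiM (insert i I) M) f"
  shows "(\<integral>x. f x \<partial>PiM (insert i I) M) = (\<integral>a. (\<integral>x. f (x(i := a)) \<partial>PiM I M) \<partial>M i)"
proof -
  interpret P: pair_sigma_finite "M i" "PiM I M"
    using sigma_finite[OF I(1)] sigma_finite_measures by (simp add: pair_sigma_finite.intro)
  have ins: "insert i I = I \<union> {i}" by auto
  have meas: "(\<lambda>(a, x). x(i := a)) \<in> M i \<Otimes>\<^sub>M PiM I M \<rightarrow>\<^sub>M PiM (insert i I) M"
    using measurable_compose[OF measurable_pair_swap' measurable_add_dim[of i I M]] by (simp add: split_def)
  have D: "distr (M i \<Otimes>\<^sub>M PiM I M) (PiM (insert i I) M) (\<lambda>(a, x). x(i := a)) = PiM (insert i I) M"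
  proof (rule measure_eqI)
    fix N assume "N \<in> sets (distr (M i \<Otimes>\<^sub>M PiM I M) (PiM (insert i I) M) (\<lambda>(a, x). x(i := a)))"
    then have N[measurable]: "N \<in> sets (PiM (insert i I) M)" by simp
    have "emeasure (distr (M i \<Otimes>\<^sub>M PiM I M) (PiM (insert i I) M) (\<lambda>(a, x). x(i := a))) N
      = (\<integral>\<^sup>+ z. indicator N z \<partial>distr (M i \<Otimes>\<^sub>M PiM I M) (PiM (insert i I) M) (\<lambda>(a, x). x(i := a)))"
      by simp
    also have "\<dots> = (\<integral>\<^sup>+ z. indicator N ((\<lambda>(a, x). x(i := a)) z) \<partial>(M i \<Otimes>\<^sub>M PiM I M))"
      by (rule nn_integral_distr[OF meas]) simp
    also have "\<dots> = (\<integral>\<^sup>+ a. (\<integral>\<^sup>+ x. indicator N (x(i := a)) \<partial>PiM I M) \<partial>M i)"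
    proof (subst P.M2.nn_integral_fst[symmetric])
      show "(\<lambda>z. indicator N ((\<lambda>(a, x). x(i := a)) z) :: ennreal) \<in> borel_measurable (M i \<Otimes>\<^sub>M PiM I M)"
        using meas by measurable
    qed simp
    also have "\<dots> = emeasure (PiM (insert i I) M) N"
      by (subst product_nn_integral_insert_rev[OF I, symmetric]) auto
    finally show "emeasure (distr (M i \<Otimes>\<^sub>M PiM I M) (PiM (insert i I) M) (\<lambda>(a, x). x(i := a))) N = emeasure (PiM (insert i I) M) N" .
  qed simp
  have "integrable (M i \<Otimes>\<^sub>M PiM I M) (\<lambda>z. f ((\<lambda>(a, x). x(i := a)) z))"
    using f meas by (intro integrable_distr[OF meas]) (simp add: D)
  then have "(\<integral>a. (\<integral>x. f ((\<lambda>(a, x). x(i := a)) (a, x)) \<partial>PiM I M) \<partial>M i) = (\<integral>z. f ((\<lambda>(a, x). x(i := a)) z) \<partial>(M i \<Otimes>\<^sub>M PiM I M))"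
    by (rule P.integral_fst')
  also have "\<dots> = (\<integral>x. f x \<partial>PiM (insert i I) M)"
    using integral_distr[OF meas, of f] f by (simp add: D borel_measurable_integrable)
  finally show ?thesis by simp
qed

lemma iter_mean_cong:
  assumes "\<And>i. i < k \<Longrightarrow> A i = A' i" "\<And>i. i < k \<Longrightarrow> wt i = wt' i"
  shows "iter_mean A wt k u x = iter_mean A' wt' k u x"
  using assms by (induction k arbitrary: x) (simp_all add: coord_mean_def)

lemma iter_mean_fun_upd:
  "k \<le> i \<Longrightarrow> iter_mean A wt k u (x(i := a)) = iter_mean A wt k (\<lambda>x. u (x(i := a))) x"
proof (induction k arbitrary: x)
  case (Suc k)
  have "x(i := a, k := c) = (x(k := c))(i := a)" for c using Suc.prems by (simp add: fun_upd_twist)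
  then have "iter_mean A wt (Suc k) u (x(i := a)) = (\<Sum>c\<in>A k. wt k c * iter_mean A wt k u ((x(k := c))(i := a)))"
    by (simp only: iter_mean.simps coord_mean_def)
  also have "\<dots> = (\<Sum>c\<in>A k. wt k c * iter_mean A wt k (\<lambda>x. u (x(i := a))) (x(k := c)))"
    using Suc by (intro sum.cong refl arg_cong2[where f = "(*)"] Suc.IH) simp
  finally show ?case by (simp only: iter_mean.simps coord_mean_def)
qed simp

text \<open>
  Finitely many bounded measurable functions on a product space can be integrated approximately by one
  product grid, all of whose points satisfy an almost sure property \<open>Q\<close>. It would not suffice to know
  that most grid points satisfy \<open>Q\<close>, because mixed differences involve all of them.

  The points of the last coordinate are chosen first, with \<open>discretize_functions\<close> applied to the partial
  integrals and among those \<open>a\<close> for which almost every \<open>x\<close> in the other coordinates satisfies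
  \<open>Q (x(n := a))\<close>. There are finitely many, so almost every \<open>x\<close> is good for all of them at once, and the
  induction hypothesis applies to this property and to the finitely many sections of the functions. The
  base point \<open>\<lambda>_. undefined\<close> is the only element of the empty product.
\<close>
theorem discretize_product:
  fixes M :: "nat \<Rightarrow> 'a measure"
  assumes M: "\<And>i. prob_space (M i)" and fin: "finite FF"
    and meas: "\<And>F. F \<in> FF \<Longrightarrow> F \<in> borel_measurable (PiM {..<n} M)"
    and bdd: "\<And>F x. F \<in> FF \<Longrightarrow> x \<in> space (PiM {..<n} M) \<Longrightarrow> \<bar>F x\<bar> \<le> B"
    and Q: "AE x in PiM {..<n} M. Q x" and eps: "\<epsilon> > 0"
  shows "\<exists>A wt. finite_product n A wt \<and> (\<forall>i<n. A i \<subseteq> space (M i)) \<and> (\<forall>x\<in>PiE {..<n} A. Q x) \<and>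
    (\<forall>F\<in>FF. \<bar>iter_mean A wt n F (\<lambda>_. undefined) - (\<integral>x. F x \<partial>PiM {..<n} M)\<bar> \<le> \<epsilon>)"
  using fin meas bdd Q eps
proof (induction n arbitrary: FF Q \<epsilon>)
  case 0
  have "Q (\<lambda>_. undefined)"
  proof -
    have "AE x in count_space {\<lambda>_. undefined}. Q x" using 0(4) by (simp only: lessThan_0 PiM_empty)
    then show ?thesis by (subst (asm) AE_count_space) simp
  qed
  moreover have "(\<integral>x. F x \<partial>PiM {} M) = F (\<lambda>_. undefined)" for F :: "_ \<Rightarrow> real"
    by (simp add: PiM_empty lebesgue_integral_count_space_finite)
  ultimately show ?case using 0(5)
    by (intro exI[of _ "\<lambda>_. {}"] exI[of _ "\<lambda>_ _. 0"]) (auto simp: finite_product_def)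
next
  case (Suc n)
  interpret product_prob_space M "{..<Suc n}"
    using M by (simp add: product_prob_space_def product_prob_space_axioms_def product_sigma_finite_def prob_space_imp_sigma_finite)
  interpret Mn: prob_space "M n" by (rule M)
  interpret PP: prob_space "PiM {..<n} M" by (rule prob_space_PiM) (rule M)
  have ins: "{..<Suc n} = insert n {..<n}" by auto
  define P where "P = PiM {..<n} M"
  have upd: "x(n := a) \<in> space (PiM {..<Suc n} M)" if "x \<in> space P" "a \<in> space (M n)" for x a
    using that by (auto simp: space_PiM PiE_iff extensional_def P_def less_Suc_eq)
  have measF: "(\<lambda>(a, x). F (x(n := a))) \<in> borel_measurable (M n \<Otimes>\<^sub>M P)" if "F \<in> FF" for F
  proof -
    have "(\<lambda>(a, x). x(n := a)) \<in> M n \<Otimes>\<^sub>M P \<rightarrow>\<^sub>M PiM (insert n {..<n}) M"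
      unfolding P_def
      using measurable_compose[OF measurable_pair_swap' measurable_add_dim[of n "{..<n}" M]] by (simp add: split_def)
    from measurable_compose[OF this Suc.prems(2)[OF that, unfolded ins]] show ?thesis by (simp only: split_def)
  qed
  have measFa: "(\<lambda>x. F (x(n := a))) \<in> borel_measurable P" if "F \<in> FF" "a \<in> space (M n)" for F a
    using measurable_Pair2[OF measF[OF that(1)] that(2)] by simp
  define G where "G F a = (\<integral>x. F (x(n := a)) \<partial>P)" for F :: "(nat \<Rightarrow> 'a) \<Rightarrow> real" and a
  have G_meas: "G F \<in> borel_measurable (M n)" if "F \<in> FF" for F
    unfolding G_def P_def using PP.borel_measurable_lebesgue_integral[OF measF[OF that, unfolded P_def]] by simp
  have G_bdd: "\<bar>G F a\<bar> \<le> B" if "F \<in> FF" "a \<in> space (M n)" for F a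
  proof -
    have "integrable P (\<lambda>x. F (x(n := a)))"
      unfolding P_def
    proof (rule PP.integrable_const_bound[of _ B])
      show "AE x in PiM {..<n} M. norm (F (x(n := a))) \<le> B"
        by (rule AE_I2) (simp only: real_norm_def, rule Suc.prems(3)[OF that(1) upd[unfolded P_def, OF _ that(2)]])
    qed (rule measFa[OF that, unfolded P_def])
    then have "norm (G F a) \<le> (\<integral>x. norm (F (x(n := a))) \<partial>P)" unfolding G_def by (intro integral_norm_bound)
    also have "\<dots> \<le> (\<integral>x. B \<partial>P)"
    proof (rule integral_mono)
      show "norm (F (x(n := a))) \<le> B" if "x \<in> space P" for x
        by (simp only: real_norm_def, rule Suc.prems(3)[OF \<open>F \<in> FF\<close> upd[OF that \<open>a \<in> space (M n)\<close>]])
    qed (use \<open>integrable P _\<close> in \<open>auto simp: P_def\<close>)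
    finally show ?thesis by (simp add: P_def PP.prob_space)
  qed
  have Q1: "AE a in M n. AE x in P. Q (x(n := a))"
    unfolding P_def by (rule AE_PiM_insert_rev) (use Suc.prems(4)[unfolded ins] in auto)
  have "\<exists>A w. finite A \<and> A \<subseteq> space (M n) \<and> (\<forall>a\<in>A. (AE x in P. Q (x(n := a))) \<and> w a \<ge> 0) \<and> (\<Sum>a\<in>A. w a) = 1 \<and>
     (\<forall>H\<in>G ` FF. \<bar>(\<Sum>a\<in>A. w a * H a) - (\<integral>a. H a \<partial>M n)\<bar> \<le> \<epsilon> / 2)"
    by (rule prob_space.discretize_functions[OF M, where B = B])
       (use Suc.prems(1,5) G_meas G_bdd Q1 in auto)
  then obtain An w where An0: "finite An \<and> An \<subseteq> space (M n) \<and> (\<forall>a\<in>An. (AE x in P. Q (x(n := a))) \<and> w a \<ge> 0) \<and> (\<Sum>a\<in>An. w a) = 1 \<and>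
     (\<forall>H\<in>G ` FF. \<bar>(\<Sum>a\<in>An. w a * H a) - (\<integral>a. H a \<partial>M n)\<bar> \<le> \<epsilon> / 2)" by (elim exE)
  have An: "finite An" "An \<subseteq> space (M n)" "\<And>a. a \<in> An \<Longrightarrow> AE x in P. Q (x(n := a))"
    "\<And>a. a \<in> An \<Longrightarrow> w a \<ge> 0" "(\<Sum>a\<in>An. w a) = 1"
    "\<And>F. F \<in> FF \<Longrightarrow> \<bar>(\<Sum>a\<in>An. w a * G F a) - (\<integral>a. G F a \<partial>M n)\<bar> \<le> \<epsilon> / 2"
    using An0 by (blast, blast, blast, blast, blast, blast)
  define FF' where "FF' = (\<lambda>(F, a) x. F (x(n := a))) ` (FF \<times> An)"
  have FF': "(\<lambda>x. F (x(n := a))) \<in> FF'" if "F \<in> FF" "a \<in> An" for F a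
    using that by (force simp: FF'_def)
  have "\<exists>A wt. finite_product n A wt \<and> (\<forall>i<n. A i \<subseteq> space (M i)) \<and> (\<forall>x\<in>PiE {..<n} A. \<forall>a\<in>An. Q (x(n := a))) \<and>
    (\<forall>F\<in>FF'. \<bar>iter_mean A wt n F (\<lambda>_. undefined) - (\<integral>x. F x \<partial>PiM {..<n} M)\<bar> \<le> \<epsilon> / 2)"
  proof (rule Suc.IH)
    show "finite FF'" using Suc.prems(1) An(1) by (simp add: FF'_def)
    show "F \<in> borel_measurable (PiM {..<n} M)" if "F \<in> FF'" for F
      using that measFa An(2) by (auto simp: FF'_def P_def)
    show "\<bar>F x\<bar> \<le> B" if "F \<in> FF'" "x \<in> space (PiM {..<n} M)" for F x
      using that Suc.prems(3) upd An(2) by (auto simp: FF'_def P_def)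
    show "AE x in PiM {..<n} M. \<forall>a\<in>An. Q (x(n := a))"
      by (rule AE_finite_allI[OF An(1) An(3)[unfolded P_def]])
  qed (use Suc.prems(5) in auto)
  then obtain A' wt' where A': "finite_product n A' wt'" "\<And>i. i < n \<Longrightarrow> A' i \<subseteq> space (M i)"
    "\<And>x a. x \<in> PiE {..<n} A' \<Longrightarrow> a \<in> An \<Longrightarrow> Q (x(n := a))"
    "\<And>F. F \<in> FF' \<Longrightarrow> \<bar>iter_mean A' wt' n F (\<lambda>_. undefined) - (\<integral>x. F x \<partial>P)\<bar> \<le> \<epsilon> / 2"
    unfolding P_def by auto
  define A where "A = A'(n := An)"
  define wt where "wt = wt'(n := w)"
  show ?case
  proof (intro exI[of _ A] exI[of _ wt] conjI ballI allI impI)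
    show "finite_product (Suc n) A wt"
      using A'(1) An by (auto simp: finite_product_def A_def wt_def less_Suc_eq)
    show "A i \<subseteq> space (M i)" if "i < Suc n" for i
      using that A'(2) An(2) by (auto simp: A_def less_Suc_eq)
    show "Q x" if x: "x \<in> PiE {..<Suc n} A" for x
    proof -
      have "x(n := undefined) \<in> PiE {..<n} A'"
        using x by (auto simp: PiE_iff extensional_def A_def less_Suc_eq split: if_splits)
      moreover have "x n \<in> An" using PiE_mem[OF x, of n] by (simp add: A_def)
      ultimately have "Q ((x(n := undefined))(n := x n))" by (rule A'(3))
      then show ?thesis by simp
    qed
    fix F assume F: "F \<in> FF"
    have int: "integrable (PiM (insert n {..<n}) M) F"
      using Suc.prems(2,3)[OF F] unfolding ins[symmetric]
      by (intro integrable_const_bound[of _ B]) auto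
    have "(\<integral>x. F x \<partial>PiM {..<Suc n} M) = (\<integral>a. G F a \<partial>M n)"
      unfolding ins G_def P_def by (rule product_integral_insert_rev) (use int in auto)
    moreover have "iter_mean A wt (Suc n) F (\<lambda>_. undefined) = (\<Sum>a\<in>An. w a * iter_mean A' wt' n (\<lambda>x. F (x(n := a))) (\<lambda>_. undefined))"
    proof -
      have "iter_mean A wt n F ((\<lambda>_. undefined)(n := a)) = iter_mean A' wt' n (\<lambda>x. F (x(n := a))) (\<lambda>_. undefined)" for a
        by (subst iter_mean_fun_upd) (auto intro!: iter_mean_cong simp: A_def wt_def)
      then show ?thesis by (simp add: coord_mean_def A_def wt_def)
    qed
    moreover have "\<bar>(\<Sum>a\<in>An. w a * iter_mean A' wt' n (\<lambda>x. F (x(n := a))) (\<lambda>_. undefined)) - (\<Sum>a\<in>An. w a * G F a)\<bar> \<le> \<epsilon> / 2"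
    proof -
      have "\<bar>(\<Sum>a\<in>An. w a * iter_mean A' wt' n (\<lambda>x. F (x(n := a))) (\<lambda>_. undefined)) - (\<Sum>a\<in>An. w a * G F a)\<bar>
        = \<bar>\<Sum>a\<in>An. w a * (iter_mean A' wt' n (\<lambda>x. F (x(n := a))) (\<lambda>_. undefined) - G F a)\<bar>"
        by (simp add: sum_subtractf right_diff_distrib)
      also have "\<dots> \<le> (\<Sum>a\<in>An. w a * (\<epsilon> / 2))"
      proof (rule order_trans[OF sum_abs], rule sum_mono)
        fix a assume a: "a \<in> An"
        show "\<bar>w a * (iter_mean A' wt' n (\<lambda>x. F (x(n := a))) (\<lambda>_. undefined) - G F a)\<bar> \<le> w a * (\<epsilon> / 2)"
          unfolding abs_mult abs_of_nonneg[OF An(4)[OF a]]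
          using A'(4)[OF FF'[OF F a]] An(4)[OF a] by (intro mult_left_mono) (simp_all add: G_def)
      qed
      also have "\<dots> = \<epsilon> / 2" unfolding sum_distrib_right[symmetric] An(5) by simp
      finally show ?thesis .
    qed
    moreover note An(6)[OF F]
    ultimately show "\<bar>iter_mean A wt (Suc n) F (\<lambda>_. undefined) - (\<integral>x. F x \<partial>PiM {..<Suc n} M)\<bar> \<le> \<epsilon>" by linarith
  qed
qed

section \<open>The expansion on product spaces\<close>

lemma iter_mean_indep:
  assumes "\<And>i. k \<le> i \<Longrightarrow> x i = x' i"
  shows "iter_mean A wt k u x = iter_mean A wt k u x'"
  using assms
proof (induction k arbitrary: x x')
  case 0
  then have "x = x'" by auto
  then show ?case by simp
next
  case (Suc k)
  have "iter_mean A wt k u (x(k := a)) = iter_mean A wt k u (x'(k := a))" for a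
    by (intro Suc.IH) (metis fun_upd_apply Suc_leI le_neq_implies_less Suc.prems)
  then show ?case by (simp only: iter_mean.simps coord_mean_def)
qed

lemma (in finite_product) iter_mean_cong_S:
  assumes "\<And>x. x \<in> S \<Longrightarrow> u x = v x" "k \<le> n" "x \<in> S"
  shows "iter_mean A wt k u x = iter_mean A wt k v x"
  using assms(2,3)
proof (induction k arbitrary: x)
  case (Suc k)
  then show ?case by (simp add: coord_mean_def upd_S cong: sum.cong)
qed (use assms(1) in simp)

text \<open>
  Each coefficient of a power or of a composition is a polynomial in finitely many coefficients of the
  argument; hence cumulants depend continuously on moments.
\<close>
lemma tendsto_fps_power_nth:
  fixes a :: "nat \<Rightarrow> real fps"
  assumes "\<And>s. s \<le> r \<Longrightarrow> (\<lambda>k. fps_nth (a k) s) \<longlonglongrightarrow> fps_nth b s"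
  shows "(\<lambda>k. fps_nth (a k ^ i) r) \<longlonglongrightarrow> fps_nth (b ^ i) r"
  using assms
proof (induction i arbitrary: r)
  case (Suc i)
  then show ?case
    unfolding power_Suc fps_mult_nth by (intro tendsto_intros) auto
qed simp

lemma tendsto_fps_compose_nth:
  fixes a :: "nat \<Rightarrow> real fps"
  assumes "\<And>s. s \<le> r \<Longrightarrow> (\<lambda>k. fps_nth (a k) s) \<longlonglongrightarrow> fps_nth b s"
  shows "(\<lambda>k. fps_nth (fps_compose c (a k)) r) \<longlonglongrightarrow> fps_nth (fps_compose c b) r"
  unfolding fps_compose_nth by (intro tendsto_intros tendsto_fps_power_nth assms)

text \<open>
  Two versions of the function appear: \<open>f\<close>, whose differences are bounded at all points of \<open>X\<close>, and the
  measurable \<open>f'\<close>, whose integrals are meant. They agree almost surely. On grids that lie in \<open>X\<close> and in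
  the set where both agree, \<open>cumulant_expansion\<close> applies to \<open>f\<close>, while the means converge to the
  integrals of \<open>e^f'\<close> and of the powers of \<open>f'\<close> up to order \<open>m\<close>, the only ones that matter.
\<close>
theorem cumulant_expansion_PiM:
  fixes M :: "nat \<Rightarrow> 'a measure" and f f' :: "(nat \<Rightarrow> 'a) \<Rightarrow> real" and d :: "nat set \<Rightarrow> real"
  assumes M: "\<And>i. prob_space (M i)"
    and f': "f' \<in> borel_measurable (PiM {..<n} M)"
    and bdd: "\<And>x. x \<in> space (PiM {..<n} M) \<Longrightarrow> \<bar>f' x\<bar> \<le> B"
    and AE: "AE x in PiM {..<n} M. f x = f' x \<and> x \<in> X"
    and m: "m \<ge> 1"
    and d: "\<And>V x y. V \<subseteq> {..<n} \<Longrightarrow> card V \<in> {1..m} \<Longrightarrow> x \<in> X \<Longrightarrow> y \<in> X \<Longrightarrow> \<bar>mixed_diff V y f x\<bar> \<le> d V"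
    and alpha: "\<And>l j. l \<in> {1..m} \<Longrightarrow> j < n \<Longrightarrow> (\<Sum>V | V \<subseteq> {..<n} \<and> card V = l \<and> j \<in> V. d V) \<le> \<alpha>"
    and R: "R \<ge> 1" "R * \<alpha> \<le> 1 / 50"
  shows "\<bar>ln (\<integral>x. exp (f' x) \<partial>PiM {..<n} M)
      - (\<Sum>r=1..m. fps_nth (fln (moment_series (PiM {..<n} M) f' - 1)) r)\<bar> \<le> n * (5 / 2) / R ^ (m + 1)"
proof -
  define P where "P = PiM {..<n} M"
  interpret P: prob_space P unfolding P_def by (rule prob_space_PiM) (rule M)
  define B' where "B' = max 1 (max (exp B) (\<bar>B\<bar> + 1)) ^ m + exp B"
  define FF where "FF = insert (\<lambda>x. exp (f' x)) ((\<lambda>r x. f' x ^ r) ` {..m})"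
  have fm: "F \<in> borel_measurable (PiM {..<n} M)" if "F \<in> FF" for F
    using that f' by (auto simp: FF_def)
  have Fb: "\<bar>F x\<bar> \<le> B'" if "F \<in> FF" "x \<in> space (PiM {..<n} M)" for F x
  proof -
    let ?c = "max 1 (max (exp B) (\<bar>B\<bar> + 1))"
    have b: "\<bar>f' x\<bar> \<le> B" using bdd[OF that(2)] .
    have "exp (f' x) \<le> B'"
    proof -
      have "exp (f' x) \<le> exp B" using b by simp
      then show ?thesis unfolding B'_def by (intro add_increasing) auto
    qed
    moreover have "\<bar>f' x ^ r\<bar> \<le> B'" if "r \<le> m" for r
    proof -
      have "\<bar>f' x ^ r\<bar> \<le> ?c ^ r" unfolding power_abs using b by (intro power_mono) auto
      also have "\<dots> \<le> ?c ^ m" using that by (intro power_increasing) auto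
      finally show ?thesis unfolding B'_def by (intro add_increasing2) auto
    qed
    moreover have "F x = exp (f' x) \<or> (\<exists>r\<le>m. F x = f' x ^ r)" using that(1) by (auto simp: FF_def)
    ultimately show ?thesis by auto
  qed
  have "\<exists>A wt. finite_product n A wt \<and> (\<forall>i<n. A i \<subseteq> space (M i)) \<and> (\<forall>x\<in>PiE {..<n} A. f x = f' x \<and> x \<in> X) \<and>
    (\<forall>F\<in>FF. \<bar>iter_mean A wt n F (\<lambda>_. undefined) - (\<integral>x. F x \<partial>PiM {..<n} M)\<bar> \<le> 1 / real (Suc k))" for k
  proof (rule discretize_product[where B = B'])
    show "finite FF" by (simp add: FF_def)
  qed (use M fm Fb AE in simp_all)
  then obtain A wt where AW: "\<And>k. finite_product n (A k) (wt k)"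
      "\<And>k x. x \<in> PiE {..<n} (A k) \<Longrightarrow> f x = f' x \<and> x \<in> X"
      "\<And>k F. F \<in> FF \<Longrightarrow> \<bar>iter_mean (A k) (wt k) n F (\<lambda>_. undefined) - (\<integral>x. F x \<partial>P)\<bar> \<le> 1 / real (Suc k)"
    unfolding P_def by metis
  have lim: "(\<lambda>k. iter_mean (A k) (wt k) n F (\<lambda>_. undefined)) \<longlonglongrightarrow> (\<integral>x. F x \<partial>P)" if "F \<in> FF" for F
  proof (rule LIM_zero_cancel, rule Lim_null_comparison)
    show "\<forall>\<^sub>F k in sequentially. norm (iter_mean (A k) (wt k) n F (\<lambda>_. undefined) - (\<integral>x. F x \<partial>P)) \<le> 1 / real (Suc k)"
      using AW(3)[OF that] by simp
    show "(\<lambda>k. 1 / real (Suc k)) \<longlonglongrightarrow> 0" by (rule LIMSEQ_Suc[OF lim_1_over_n])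
  qed
  define ms where "ms k = Abs_fps (\<lambda>r. iter_mean (A k) (wt k) n (\<lambda>x. f' x ^ r) (\<lambda>_. undefined) / fact r)" for k
  have fin: "\<bar>ln (iter_mean (A k) (wt k) n (\<lambda>x. exp (f' x)) (\<lambda>_. undefined)) - (\<Sum>r=1..m. fps_nth (fln (ms k - 1)) r)\<bar> \<le> n * (5 / 2) / R ^ (m + 1)" for k
  proof -
    interpret W: weighted_product n "A k" "wt k" R
      using AW(1) R(1) by (simp add: weighted_product_def weighted_product_axioms_def)
    obtain x where x: "x \<in> W.S" using W.S_nonempty by auto
    have ind: "iter_mean (A k) (wt k) n u (\<lambda>_. undefined) = iter_mean (A k) (wt k) n u x" for u :: "(nat \<Rightarrow> 'a) \<Rightarrow> real"
      by (rule iter_mean_indep) (use x in \<open>auto simp: W.S_def PiE_iff extensional_def\<close>)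
    have SX: "z \<in> X" "f z = f' z" if "z \<in> W.S" for z using AW(2) that by (auto simp: W.S_def)
    have e: "iter_mean (A k) (wt k) n (\<lambda>x. h (f' x)) x = iter_mean (A k) (wt k) n (\<lambda>x. h (f x)) x" for h :: "real \<Rightarrow> real"
      by (rule W.iter_mean_cong_S) (use SX x in auto)
    have "\<bar>ln (iter_mean (A k) (wt k) n (\<lambda>x. exp (f x)) x)
      - (\<Sum>r=1..m. fps_nth (fln (Abs_fps (\<lambda>r. iter_mean (A k) (wt k) n (\<lambda>x. f x ^ r) x / fact r) - 1)) r)\<bar> \<le> n * (5 / 2) / R ^ (m + 1)"
    proof (rule W.cumulant_expansion[OF m _ R(2) x])
      fix l j assume l: "l \<in> {1..m}" and j: "j < n"
      have "(\<Sum>V | V \<subseteq> {..<n} \<and> card V = l \<and> j \<in> V. W.max_diff V f) \<le> (\<Sum>V | V \<subseteq> {..<n} \<and> card V = l \<and> j \<in> V. d V)"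
        using l by (intro sum_mono W.max_diff_le d) (auto intro: SX)
      also have "\<dots> \<le> \<alpha>" by (rule alpha[OF l j])
      finally show "(\<Sum>V | V \<subseteq> {..<n} \<and> card V = l \<and> j \<in> V. W.max_diff V f) \<le> \<alpha>" .
    qed
    then show ?thesis unfolding ms_def ind e[of exp] e[of "\<lambda>t. t ^ r" for r] .
  qed
  have pos: "(\<integral>x. exp (f' x) \<partial>P) > 0"
  proof -
    have int: "integrable P (\<lambda>x. exp (f' x))"
      using fm[of "\<lambda>x. exp (f' x)"] Fb[of "\<lambda>x. exp (f' x)"]
      by (intro P.integrable_const_bound[of _ B']) (auto simp: P_def FF_def)
    have "(\<integral>x. exp (- B) \<partial>P) \<le> (\<integral>x. exp (f' x) \<partial>P)"
    proof (rule integral_mono)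
      show "exp (- B) \<le> exp (f' x)" if "x \<in> space P" for x
        using bdd[of x] that by (simp add: P_def)
    qed (use int in auto)
    moreover have "(\<integral>x. exp (- B) \<partial>P) > 0" by (simp add: P.prob_space)
    ultimately show ?thesis by linarith
  qed
  have l1: "(\<lambda>k. ln (iter_mean (A k) (wt k) n (\<lambda>x. exp (f' x)) (\<lambda>_. undefined))) \<longlonglongrightarrow> ln (\<integral>x. exp (f' x) \<partial>P)"
    using pos by (intro tendsto_ln lim) (auto simp: FF_def)
  have l2: "(\<lambda>k. \<Sum>r=1..m. fps_nth (fln (ms k - 1)) r) \<longlonglongrightarrow> (\<Sum>r=1..m. fps_nth (fln (moment_series P f' - 1)) r)"
  proof (intro tendsto_sum tendsto_fps_compose_nth)
    fix r s assume "r \<in> {1..m}" "s \<le> r"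
    then have "(\<lambda>k. iter_mean (A k) (wt k) n (\<lambda>x. f' x ^ s) (\<lambda>_. undefined)) \<longlonglongrightarrow> (\<integral>x. f' x ^ s \<partial>P)"
      by (intro lim) (auto simp: FF_def)
    then show "(\<lambda>k. fps_nth (ms k - 1) s) \<longlonglongrightarrow> fps_nth (moment_series P f' - 1) s"
      by (auto simp: ms_def moment_series_def intro!: tendsto_intros)
  qed
  have "(\<lambda>k. \<bar>ln (iter_mean (A k) (wt k) n (\<lambda>x. exp (f' x)) (\<lambda>_. undefined)) - (\<Sum>r=1..m. fps_nth (fln (ms k - 1)) r)\<bar>)
    \<longlonglongrightarrow> \<bar>ln (\<integral>x. exp (f' x) \<partial>P) - (\<Sum>r=1..m. fps_nth (fln (moment_series P f' - 1)) r)\<bar>"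
    by (intro tendsto_rabs tendsto_diff l1 l2)
  then have "\<bar>ln (\<integral>x. exp (f' x) \<partial>P) - (\<Sum>r=1..m. fps_nth (fln (moment_series P f' - 1)) r)\<bar> \<le> n * (5 / 2) / R ^ (m + 1)"
    by (rule LIMSEQ_le_const2) (use fin in auto)
  then show ?thesis by (simp only: P_def)
qed

text \<open>
  The best choice is \<open>R = 1/(50\<alpha>)\<close>, with the limit \<open>R \<rightarrow> \<infinity>\<close> if \<open>\<alpha> = 0\<close>.
\<close>
corollary cumulant_expansion_PiM_optimized:
  fixes M :: "nat \<Rightarrow> 'a measure" and f f' :: "(nat \<Rightarrow> 'a) \<Rightarrow> real" and d :: "nat set \<Rightarrow> real"
  assumes M: "\<And>i. prob_space (M i)"
    and f': "f' \<in> borel_measurable (PiM {..<n} M)"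
    and bdd: "\<And>x. x \<in> space (PiM {..<n} M) \<Longrightarrow> \<bar>f' x\<bar> \<le> B"
    and AE: "AE x in PiM {..<n} M. f x = f' x \<and> x \<in> X"
    and m: "m \<ge> 1"
    and d: "\<And>V x y. V \<subseteq> {..<n} \<Longrightarrow> card V \<in> {1..m} \<Longrightarrow> x \<in> X \<Longrightarrow> y \<in> X \<Longrightarrow> \<bar>mixed_diff V y f x\<bar> \<le> d V"
    and alpha: "\<And>l j. l \<in> {1..m} \<Longrightarrow> j < n \<Longrightarrow> (\<Sum>V | V \<subseteq> {..<n} \<and> card V = l \<and> j \<in> V. d V) \<le> \<alpha>"
    and \<alpha>: "0 \<le> \<alpha>" "\<alpha> \<le> 1 / 50"
  shows "\<bar>ln (\<integral>x. exp (f' x) \<partial>PiM {..<n} M)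
      - (\<Sum>r=1..m. fps_nth (fln (moment_series (PiM {..<n} M) f' - 1)) r)\<bar> \<le> n * (5 / 2) * (50 * \<alpha>) ^ (m + 1)"
    (is "?e \<le> _")
proof -
  note main = cumulant_expansion_PiM[OF M f' bdd AE m d alpha]
  show ?thesis
  proof (cases "\<alpha> = 0")
    case False
    define R where "R = 1 / (50 * \<alpha>)"
    have "?e \<le> n * (5 / 2) / R ^ (m + 1)"
      by (rule main) (use \<alpha> False in \<open>auto simp: R_def field_simps\<close>)
    then show ?thesis by (simp add: R_def power_divide power_one_over)
  next
    case True
    have "(\<lambda>k. n * (5 / 2) / real (Suc k) ^ (m + 1)) \<longlonglongrightarrow> 0"
    proof -
      have "(\<lambda>k. n * (5 / 2) * (1 / real (Suc k)) ^ (m + 1)) \<longlonglongrightarrow> n * (5 / 2) * 0 ^ (m + 1)"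
        by (intro tendsto_intros LIMSEQ_Suc[OF lim_1_over_n])
      then show ?thesis by (simp add: power_divide)
    qed
    moreover have "?e \<le> n * (5 / 2) / real (Suc k) ^ (m + 1)" for k
      by (rule main) (use True in auto)
    ultimately have "?e \<le> 0" by (intro LIMSEQ_le_const) auto
    then show ?thesis using True by simp
  qed
qed

section \<open>Tails under exponential tilting\<close>

text \<open>
  The sections are now those at fixed values of the old coordinates, as needed for conditional laws of the
  new one.
\<close>
lemma (in product_sigma_finite) AE_PiM_insert:
  assumes I: "finite I" "i \<notin> I" and Q: "AE x in PiM (insert i I) M. Q x"
  shows "AE x in PiM I M. AE a in M i. Q (x(i := a))"
proof -
  from Q obtain N where N: "{x \<in> space (PiM (insert i I) M). \<not> Q x} \<subseteq> N" "N \<in> sets (PiM (insert i I) M)"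
    "emeasure (PiM (insert i I) M) N = 0" by (rule AE_E)
  have [measurable]: "N \<in> sets (PiM (insert i I) M)" by fact
  have m: "(\<lambda>(x, y). indicator N (x(i := y)) :: ennreal) \<in> borel_measurable (PiM I M \<Otimes>\<^sub>M M i)"
    using measurable_compose[OF measurable_add_dim[of i I M], of "indicator N :: _ \<Rightarrow> ennreal" borel] by (simp add: split_def)
  have "(\<integral>\<^sup>+ x. (\<integral>\<^sup>+ y. indicator N (x(i := y)) \<partial>(M i)) \<partial>(PiM I M)) = emeasure (PiM (insert i I) M) N"
    by (subst product_nn_integral_insert[OF I, symmetric]) auto
  then have "(\<integral>\<^sup>+ x. (\<integral>\<^sup>+ y. indicator N (x(i := y)) \<partial>(M i)) \<partial>(PiM I M)) = 0" using N by simp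
  then have "AE x in PiM I M. (\<integral>\<^sup>+ y. indicator N (x(i := y)) \<partial>(M i)) = 0"
    by (subst (asm) nn_integral_0_iff_AE) (use sigma_finite_measure.borel_measurable_nn_integral[OF sigma_finite_measures m] in auto)
  then show ?thesis
    using AE_space
  proof eventually_elim
    fix x assume x: "(\<integral>\<^sup>+ y. indicator N (x(i := y)) \<partial>(M i)) = 0" "x \<in> space (PiM I M)"
    have "(\<lambda>y. indicator N (x(i := y)) :: ennreal) \<in> borel_measurable (M i)"
      using measurable_Pair2[OF m x(2)] by simp
    then have "AE y in M i. indicator N (x(i := y)) = (0::ennreal)"
      using x by (subst (asm) nn_integral_0_iff_AE) auto
    then show "AE y in M i. Q (x(i := y))"
      using AE_space
    proof eventually_elim
      fix y assume "indicator N (x(i := y)) = (0::ennreal)" "y \<in> space (M i)"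
      moreover have "x(i := y) \<in> space (PiM (insert i I) M)"
        using \<open>y \<in> space (M i)\<close> x(2) I by (auto simp: space_PiM PiE_iff extensional_def)
      ultimately show "Q (x(i := y))" using N(1) by (auto simp: indicator_def split: if_splits)
    qed
  qed
qed

text \<open>
  If resampling coordinate \<open>j\<close> changes \<open>f'\<close> by at most \<open>\<alpha>\<close>, then under the measure with density
  proportional to \<open>e^f'\<close> the conditional law of coordinate \<open>j\<close> given the others is within a factor \<open>e^\<alpha>\<close>
  of \<open>M j\<close>. To see this without dividing by the normalization, average \<open>f' (x(j := b)) \<le> \<alpha> + f' (x(j := a))\<close>
  over \<open>a\<close>.
\<close>
lemma tilted_tail_le:
  fixes M :: "nat \<Rightarrow> 'a measure" and f' :: "(nat \<Rightarrow> 'a) \<Rightarrow> real"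
  assumes M: "\<And>i. prob_space (M i)"
    and f': "f' \<in> borel_measurable (PiM {..<n} M)"
    and Q: "AE x in PiM {..<n} M. Q x"
    and lip: "\<And>x a. Q x \<Longrightarrow> Q (x(j := a)) \<Longrightarrow> f' x \<le> \<alpha> + f' (x(j := a))"
    and j: "j < n" and U: "U \<in> sets (M j)"
  shows "(\<integral>\<^sup>+x. ennreal (exp (f' x)) * indicator U (x j) \<partial>PiM {..<n} M)
    \<le> ennreal (exp \<alpha>) * emeasure (M j) U * (\<integral>\<^sup>+x. ennreal (exp (f' x)) \<partial>PiM {..<n} M)"
proof -
  interpret product_prob_space M "{..<n}"
    using M by (simp add: product_prob_space_def product_prob_space_axioms_def product_sigma_finite_def prob_space_imp_sigma_finite)
  define J where "J = {..<n} - {j}"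
  have ins: "{..<n} = insert j J" and J: "finite J" "j \<notin> J" using j by (auto simp: J_def)
  have [measurable]: "f' \<in> borel_measurable (PiM (insert j J) M)" using f' by (simp add: ins)
  have [measurable]: "U \<in> sets (M j)" by fact
  have m2: "(\<lambda>(x, y). f' (x(j := y))) \<in> borel_measurable (PiM J M \<Otimes>\<^sub>M M j)"
    using measurable_compose[OF measurable_add_dim[of j J M], of f' borel] by (simp add: split_def)
  have fa: "(\<lambda>b. f' (x(j := b))) \<in> borel_measurable (M j)" if "x \<in> space (PiM J M)" for x
    using measurable_Pair2[OF m2 that] by simp
  have inner_m: "(\<lambda>x. \<integral>\<^sup>+a. ennreal (exp (f' (x(j := a)))) \<partial>M j) \<in> borel_measurable (PiM J M)"
  proof -
    have "(\<lambda>(x, y). ennreal (exp (f' (x(j := y))))) \<in> borel_measurable (PiM J M \<Otimes>\<^sub>M M j)"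
      using m2 by (simp add: split_def)
    then show ?thesis by (rule sigma_finite_measure.borel_measurable_nn_integral[OF sigma_finite_measures])
  qed
  have gm: "(\<lambda>x. ennreal (exp (f' x)) * indicator U (x j)) \<in> borel_measurable (PiM (insert j J) M)"
  proof -
    have [measurable]: "(\<lambda>x. x j) \<in> PiM (insert j J) M \<rightarrow>\<^sub>M M j" by (rule measurable_component_singleton) simp
    show ?thesis by measurable
  qed
  have "(\<integral>\<^sup>+x. ennreal (exp (f' x)) * indicator U (x j) \<partial>PiM {..<n} M)
     = (\<integral>\<^sup>+x. (\<integral>\<^sup>+b. ennreal (exp (f' (x(j := b)))) * indicator U b \<partial>M j) \<partial>PiM J M)"
    unfolding ins by (subst product_nn_integral_insert[OF J]) (use gm in auto)
  also have "\<dots> \<le> (\<integral>\<^sup>+x. ennreal (exp \<alpha>) * emeasure (M j) U * (\<integral>\<^sup>+a. ennreal (exp (f' (x(j := a)))) \<partial>M j) \<partial>PiM J M)"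
  proof (rule nn_integral_mono_AE)
    show "AE x in PiM J M. (\<integral>\<^sup>+b. ennreal (exp (f' (x(j := b)))) * indicator U b \<partial>M j)
        \<le> ennreal (exp \<alpha>) * emeasure (M j) U * (\<integral>\<^sup>+a. ennreal (exp (f' (x(j := a)))) \<partial>M j)"
      using AE_PiM_insert[OF J Q[unfolded ins]] AE_space
    proof eventually_elim
      fix x assume Qx: "AE a in M j. Q (x(j := a))" and x: "x \<in> space (PiM J M)"
      define c where "c = ennreal (exp \<alpha>) * (\<integral>\<^sup>+a. ennreal (exp (f' (x(j := a)))) \<partial>M j)"
      have "(\<integral>\<^sup>+b. ennreal (exp (f' (x(j := b)))) * indicator U b \<partial>M j) \<le> (\<integral>\<^sup>+b. c * indicator U b \<partial>M j)"
      proof (rule nn_integral_mono_AE)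
        show "AE b in M j. ennreal (exp (f' (x(j := b)))) * indicator U b \<le> c * indicator U b"
          using Qx
        proof eventually_elim
          fix b assume b: "Q (x(j := b))"
          have "ennreal (exp (f' (x(j := b)))) = (\<integral>\<^sup>+a. ennreal (exp (f' (x(j := b)))) \<partial>M j)"
            by (simp add: prob_space.emeasure_space_1[OF M])
          also have "\<dots> \<le> (\<integral>\<^sup>+a. ennreal (exp \<alpha>) * ennreal (exp (f' (x(j := a)))) \<partial>M j)"
          proof (rule nn_integral_mono_AE)
            show "AE a in M j. ennreal (exp (f' (x(j := b)))) \<le> ennreal (exp \<alpha>) * ennreal (exp (f' (x(j := a))))"
              using Qx
            proof eventually_elim
              fix a assume a: "Q (x(j := a))"
              have "f' (x(j := b)) \<le> \<alpha> + f' (x(j := a))"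
                using lip[OF b, of a] a by simp
              then have "exp (f' (x(j := b))) \<le> exp \<alpha> * exp (f' (x(j := a)))" by (simp add: exp_add[symmetric])
              then show "ennreal (exp (f' (x(j := b)))) \<le> ennreal (exp \<alpha>) * ennreal (exp (f' (x(j := a))))"
                by (simp add: ennreal_mult[symmetric] ennreal_leI)
            qed
          qed
          also have "\<dots> = c" unfolding c_def using fa[OF x] by (intro nn_integral_cmult) auto
          finally show "ennreal (exp (f' (x(j := b)))) * indicator U b \<le> c * indicator U b"
            by (intro mult_right_mono) auto
        qed
      qed
      also have "\<dots> = c * emeasure (M j) U" by (simp add: nn_integral_cmult_indicator)
      finally show "(\<integral>\<^sup>+b. ennreal (exp (f' (x(j := b)))) * indicator U b \<partial>M j)
        \<le> ennreal (exp \<alpha>) * emeasure (M j) U * (\<integral>\<^sup>+a. ennreal (exp (f' (x(j := a)))) \<partial>M j)"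
        by (simp add: c_def mult_ac)
    qed
  qed
  also have "\<dots> = ennreal (exp \<alpha>) * emeasure (M j) U * (\<integral>\<^sup>+x. (\<integral>\<^sup>+a. ennreal (exp (f' (x(j := a)))) \<partial>M j) \<partial>PiM J M)"
    by (rule nn_integral_cmult[OF inner_m])
  also have "(\<integral>\<^sup>+x. (\<integral>\<^sup>+a. ennreal (exp (f' (x(j := a)))) \<partial>M j) \<partial>PiM J M) = (\<integral>\<^sup>+x. ennreal (exp (f' x)) \<partial>PiM {..<n} M)"
    unfolding ins by (subst product_nn_integral_insert[OF J]) auto
  finally show ?thesis .
qed

section \<open>Linear changes of variables\<close>

abbreviation leb_pi :: "nat \<Rightarrow> (nat \<Rightarrow> real) measure" where
  "leb_pi n \<equiv> PiM {..<n} (\<lambda>_. lborel)"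

definition mat_app :: "nat \<Rightarrow> real mat \<Rightarrow> (nat \<Rightarrow> real) \<Rightarrow> nat \<Rightarrow> real" where
  "mat_app n T z = (\<lambda>i\<in>{..<n}. \<Sum>j<n. T $$ (i, j) * z j)"

lemma mult_vec_eq_mat_app:
  assumes "T \<in> carrier_mat n n"
  shows "T *\<^sub>v Matrix.vec n z = Matrix.vec n (mat_app n T z)"
  using assms by (intro eq_vecI) (auto simp: mat_app_def scalar_prod_def lessThan_atLeast0)

lemma mat_app_mult:
  assumes "T \<in> carrier_mat n n" "U \<in> carrier_mat n n"
  shows "mat_app n (T * U) z = mat_app n T (mat_app n U z)"
proof
  fix i
  show "mat_app n (T * U) z i = mat_app n T (mat_app n U z) i"
  proof (cases "i < n")
    case True
    have "mat_app n (T * U) z i = (\<Sum>j<n. (\<Sum>k<n. T $$ (i, k) * U $$ (k, j)) * z j)"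
      using True assms by (auto simp: mat_app_def scalar_prod_def lessThan_atLeast0 intro!: sum.cong)
    also have "\<dots> = (\<Sum>k<n. T $$ (i, k) * (\<Sum>j<n. U $$ (k, j) * z j))"
      unfolding sum_distrib_left sum_distrib_right by (subst sum.swap) (simp add: mult.assoc)
    finally show ?thesis using True by (simp add: mat_app_def)
  qed (simp add: mat_app_def)
qed

lemma mat_app_measurable [measurable]: "mat_app n T \<in> leb_pi n \<rightarrow>\<^sub>M leb_pi n"
  unfolding mat_app_def
proof (rule measurable_restrict)
  fix i assume "i \<in> {..<n}"
  have "(\<lambda>z. \<Sum>j<n. T $$ (i, j) * z j) \<in> borel_measurable (leb_pi n)"
    by (intro borel_measurable_sum borel_measurable_times borel_measurable_const)
       (use measurable_component_singleton[of _ "{..<n}" "\<lambda>_. lborel :: real measure"] in auto)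
  then show "(\<lambda>z. \<Sum>j<n. T $$ (i, j) * z j) \<in> leb_pi n \<rightarrow>\<^sub>M lborel" by simp
qed

text \<open>
  Change of variables for nonnegative functions. The property passes to products of matrices, which reduces
  its proof to elementary row operations.
\<close>
definition scales :: "nat \<Rightarrow> real mat \<Rightarrow> bool" where
  "scales n T \<longleftrightarrow> (\<forall>h\<in>borel_measurable (leb_pi n).
     (\<integral>\<^sup>+z. h z \<partial>leb_pi n) = ennreal \<bar>Determinant.det T\<bar> * (\<integral>\<^sup>+z. h (mat_app n T z) \<partial>leb_pi n))"

lemma scales_mult:
  assumes T: "T \<in> carrier_mat n n" and U: "U \<in> carrier_mat n n" and "scales n T" "scales n U"
  shows "scales n (T * U)"
  unfolding scales_def
proof
  fix h :: "(nat \<Rightarrow> real) \<Rightarrow> ennreal" assume h[measurable]: "h \<in> borel_measurable (leb_pi n)"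
  have hm: "(\<lambda>z. h (mat_app n T z)) \<in> borel_measurable (leb_pi n)"
    by (rule measurable_compose[OF mat_app_measurable h])
  have "(\<integral>\<^sup>+z. h z \<partial>leb_pi n) = ennreal \<bar>Determinant.det T\<bar> * (\<integral>\<^sup>+z. h (mat_app n T z) \<partial>leb_pi n)"
    using bspec[OF assms(3)[unfolded scales_def], of h] h by blast
  also have "(\<integral>\<^sup>+z. h (mat_app n T z) \<partial>leb_pi n) = ennreal \<bar>Determinant.det U\<bar> * (\<integral>\<^sup>+z. h (mat_app n T (mat_app n U z)) \<partial>leb_pi n)"
    using bspec[OF assms(4)[unfolded scales_def], of "\<lambda>z. h (mat_app n T z)"] hm by blast
  finally show "(\<integral>\<^sup>+z. h z \<partial>leb_pi n) = ennreal \<bar>Determinant.det (T * U)\<bar> * (\<integral>\<^sup>+z. h (mat_app n (T * U) z) \<partial>leb_pi n)"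
    by (simp only: mat_app_mult[OF T U] det_mult[OF T U] abs_mult ennreal_mult[OF abs_ge_zero abs_ge_zero] mult.assoc)
qed

text \<open>
  A shear or scaling of one coordinate, where the shift \<open>t\<close> depends on the other coordinates only: by Fubini
  it is the one-dimensional affine substitution in the innermost integral.
\<close>
lemma nn_integral_coordinate_affine:
  fixes t :: "(nat \<Rightarrow> real) \<Rightarrow> real"
  assumes k: "k < n" and c: "c \<noteq> 0" and t: "t \<in> borel_measurable (leb_pi n)" "\<And>z y. t (z(k := y)) = t z"
    and h: "h \<in> borel_measurable (leb_pi n)"
  shows "(\<integral>\<^sup>+z. h z \<partial>leb_pi n) = ennreal \<bar>c\<bar> * (\<integral>\<^sup>+z. h (z(k := t z + c * z k)) \<partial>leb_pi n)"
proof -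
  interpret product_sigma_finite "\<lambda>_. lborel :: real measure" by standard
  define J where "J = {..<n} - {k}"
  have ins: "{..<n} = insert k J" and J: "finite J" "k \<notin> J" using k by (auto simp: J_def)
  have [measurable]: "t \<in> borel_measurable (PiM (insert k J) (\<lambda>_. lborel))" using t(1) by (simp only: ins)
  have h'[measurable]: "h \<in> borel_measurable (PiM (insert k J) (\<lambda>_. lborel))" using h by (simp only: ins)
  have comp: "(\<lambda>z. z k) \<in> borel_measurable (PiM (insert k J) (\<lambda>_. lborel :: real measure))"
    using measurable_component_singleton[of k "insert k J" "\<lambda>_. lborel :: real measure"] by simp
  have "(\<lambda>z. z(k := t z + c * z k)) \<in> PiM (insert k J) (\<lambda>_. lborel) \<rightarrow>\<^sub>M PiM (insert k J) (\<lambda>_. lborel :: real measure)"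
    by (rule measurable_fun_upd[where J = "insert k J"]) (use comp in auto)
  then have hm: "(\<lambda>z. h (z(k := t z + c * z k))) \<in> borel_measurable (PiM (insert k J) (\<lambda>_. lborel))"
    by (rule measurable_compose) (rule h')
  have hx: "(\<lambda>y. h (x(k := y))) \<in> borel_measurable borel" if "x \<in> space (PiM J (\<lambda>_. lborel))" for x
  proof -
    have "(\<lambda>y. x(k := y)) \<in> lborel \<rightarrow>\<^sub>M PiM (insert k J) (\<lambda>_. lborel :: real measure)"
      by (rule measurable_fun_upd[where J = J]) (use that in auto)
    then have "(\<lambda>y. h (x(k := y))) \<in> borel_measurable lborel" by (rule measurable_compose) (rule h')
    then show ?thesis by simp
  qed
  have "ennreal \<bar>c\<bar> * (\<integral>\<^sup>+z. h (z(k := t z + c * z k)) \<partial>leb_pi n)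
     = ennreal \<bar>c\<bar> * (\<integral>\<^sup>+x. (\<integral>\<^sup>+y. h (x(k := t x + c * y)) \<partial>lborel) \<partial>PiM J (\<lambda>_. lborel))"
    unfolding ins by (subst product_nn_integral_insert[OF J hm]) (simp only: t(2) fun_upd_upd fun_upd_same)
  also have "\<dots> = (\<integral>\<^sup>+x. ennreal \<bar>c\<bar> * (\<integral>\<^sup>+y. h (x(k := t x + c * y)) \<partial>lborel) \<partial>PiM J (\<lambda>_. lborel))"
  proof (rule nn_integral_cmult[symmetric])
    have "(\<lambda>(x, y). h ((x(k := y))(k := t (x(k := y)) + c * (x(k := y)) k))) \<in> borel_measurable (PiM J (\<lambda>_. lborel) \<Otimes>\<^sub>M lborel)"
      using measurable_compose[OF measurable_add_dim[of k J "\<lambda>_. lborel :: real measure"] hm] by (simp only: split_def)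
    then have "(\<lambda>(x, y). h (x(k := t x + c * y))) \<in> borel_measurable (PiM J (\<lambda>_. lborel) \<Otimes>\<^sub>M lborel)"
      by (simp only: t(2) fun_upd_upd fun_upd_same)
    then show "(\<lambda>x. \<integral>\<^sup>+y. h (x(k := t x + c * y)) \<partial>lborel) \<in> borel_measurable (PiM J (\<lambda>_. lborel))"
      by (rule lborel.borel_measurable_nn_integral)
  qed
  also have "\<dots> = (\<integral>\<^sup>+x. (\<integral>\<^sup>+y. h (x(k := y)) \<partial>lborel) \<partial>PiM J (\<lambda>_. lborel))"
  proof (rule nn_integral_cong)
    fix x assume "x \<in> space (PiM J (\<lambda>_. lborel :: real measure))"
    from nn_integral_real_affine[OF hx[OF this] c, of "t x"]
    show "ennreal \<bar>c\<bar> * (\<integral>\<^sup>+y. h (x(k := t x + c * y)) \<partial>lborel) = (\<integral>\<^sup>+y. h (x(k := y)) \<partial>lborel)" by simp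
  qed
  also have "\<dots> = (\<integral>\<^sup>+z. h z \<partial>leb_pi n)"
    unfolding ins by (rule product_nn_integral_insert[OF J h', symmetric])
  finally show ?thesis ..
qed

lemma leb_pi_undefined: "z \<in> space (leb_pi n) \<Longrightarrow> \<not> i < n \<Longrightarrow> z i = undefined"
  by (auto simp: space_PiM PiE_def extensional_def)

lemma scales_addrow_mat:
  assumes "k < n" "l < n" "k \<noteq> l"
  shows "scales n (addrow_mat n a k l)"
  unfolding scales_def
proof
  fix h :: "(nat \<Rightarrow> real) \<Rightarrow> ennreal" assume h: "h \<in> borel_measurable (leb_pi n)"
  have eq: "mat_app n (addrow_mat n a k l) z = z(k := a * z l + 1 * z k)" if "z \<in> space (leb_pi n)" for z
  proof
    fix i
    have "(\<Sum>j<n. addrow_mat n a k l $$ (i, j) * z j) = (\<Sum>j<n. (if j = i then z i else 0) + (if j = l then (if i = k then a * z l else 0) else 0))" if "i < n"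
      using that assms by (intro sum.cong) (auto simp: algebra_simps)
    then have "(\<Sum>j<n. addrow_mat n a k l $$ (i, j) * z j) = z i + (if i = k then a * z l else 0)" if "i < n"
      using that assms by (simp add: sum.distrib)
    then show "mat_app n (addrow_mat n a k l) z i = (z(k := a * z l + 1 * z k)) i"
      using leb_pi_undefined[OF that, of i] assms by (auto simp: mat_app_def)
  qed
  have "(\<lambda>z. z l) \<in> borel_measurable (leb_pi n)"
    using measurable_component_singleton[of l "{..<n}" "\<lambda>_. lborel :: real measure"] assms by simp
  then have m: "(\<lambda>z. a * z l) \<in> borel_measurable (leb_pi n)" by simp
  have "(\<integral>\<^sup>+z. h z \<partial>leb_pi n) = ennreal \<bar>1\<bar> * (\<integral>\<^sup>+z. h (z(k := a * z l + 1 * z k)) \<partial>leb_pi n)"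
    by (rule nn_integral_coordinate_affine[OF assms(1) _ m _ h]) (use assms in auto)
  also have "\<dots> = ennreal \<bar>Determinant.det (addrow_mat n a k l)\<bar> * (\<integral>\<^sup>+z. h (mat_app n (addrow_mat n a k l) z) \<partial>leb_pi n)"
    by (simp only: det_addrow_mat[OF assms(3)] eq cong: nn_integral_cong)
  finally show "(\<integral>\<^sup>+z. h z \<partial>leb_pi n) = \<dots>" .
qed

lemma scales_multrow_mat:
  assumes "k < n" "c \<noteq> 0"
  shows "scales n (multrow_mat n k c)"
  unfolding scales_def
proof
  fix h :: "(nat \<Rightarrow> real) \<Rightarrow> ennreal" assume h: "h \<in> borel_measurable (leb_pi n)"
  have eq: "mat_app n (multrow_mat n k c) z = z(k := 0 + c * z k)" if "z \<in> space (leb_pi n)" for z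
  proof
    fix i
    have "(\<Sum>j<n. multrow_mat n k c $$ (i, j) * z j) = (\<Sum>j<n. (if j = i then (if i = k then c * z i else z i) else 0))" if "i < n"
      using that assms by (intro sum.cong) auto
    then show "mat_app n (multrow_mat n k c) z i = (z(k := 0 + c * z k)) i"
      using leb_pi_undefined[OF that, of i] assms by (auto simp: mat_app_def)
  qed
  have "(\<integral>\<^sup>+z. h z \<partial>leb_pi n) = ennreal \<bar>c\<bar> * (\<integral>\<^sup>+z. h (z(k := 0 + c * z k)) \<partial>leb_pi n)"
    by (rule nn_integral_coordinate_affine[OF assms(1,2) _ _ h]) auto
  also have "\<dots> = ennreal \<bar>Determinant.det (multrow_mat n k c)\<bar> * (\<integral>\<^sup>+z. h (mat_app n (multrow_mat n k c) z) \<partial>leb_pi n)"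
    by (simp only: det_multrow_mat[OF assms(1)] eq cong: nn_integral_cong)
  finally show "(\<integral>\<^sup>+z. h z \<partial>leb_pi n) = \<dots>" .
qed

text \<open>
  Elementary operations are invertible, so \<open>scales\<close> may be proved after a row operation.
\<close>
lemma scales_addrowD:
  assumes T: "T \<in> carrier_mat n n" and kl: "k < n" "l < n" "k \<noteq> l" and G: "scales n (addrow a k l T)"
  shows "scales n T"
proof -
  have "addrow_mat n (- a) k l * (addrow_mat n a k l * T) = (addrow_mat n (- a) k l * addrow_mat n a k l) * T"
    using T by (intro assoc_mult_mat[symmetric]) auto
  also have "addrow_mat n (- a) k l * addrow_mat n a k l = 1\<^sub>m n"
    using addrow_mat_inv[OF kl, of "- a"] by simp
  finally have "T = addrow_mat n (- a) k l * addrow a k l T"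
    using T by (simp add: addrow_mat[OF T kl(2)])
  moreover have "scales n (addrow_mat n (- a) k l * addrow a k l T)"
    using T by (intro scales_mult G scales_addrow_mat kl) auto
  ultimately show ?thesis by simp
qed

lemma scales_multrowD:
  assumes T: "T \<in> carrier_mat n n" and k: "k < n" and c: "c \<noteq> 0" and G: "scales n (multrow k c T)"
  shows "scales n T"
proof -
  have "multrow_mat n k (inverse c) * (multrow_mat n k c * T) = (multrow_mat n k (inverse c) * multrow_mat n k c) * T"
    using T by (intro assoc_mult_mat[symmetric]) auto
  also have "multrow_mat n k (inverse c) * multrow_mat n k c = 1\<^sub>m n"
    using multrow_mat_inv[OF k, of "inverse c"] c by simp
  finally have "T = multrow_mat n k (inverse c) * multrow k c T"
    using T by (simp add: multrow_mat[OF T])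
  moreover have "scales n (multrow_mat n k (inverse c) * multrow k c T)"
    using T c by (intro scales_mult G scales_multrow_mat k) auto
  ultimately show ?thesis by simp
qed

text \<open>
  Progress of Gauss elimination: the first \<open>k\<close> columns are those of the identity matrix.
\<close>
definition unit_cols :: "nat \<Rightarrow> nat \<Rightarrow> real mat \<Rightarrow> bool" where
  "unit_cols n k T \<longleftrightarrow> (\<forall>c<k. \<forall>i<n. T $$ (i, c) = (if i = c then 1 else 0))"

text \<open>
  Otherwise column \<open>k\<close> would be a linear combination of the \<open>k\<close> unit columns to its left, which yields a
  nonzero vector in the kernel.
\<close>
lemma exists_pivot:
  assumes T: "T \<in> carrier_mat n n" and det: "Determinant.det T \<noteq> 0" and u: "unit_cols n k T" and k: "k < n"
  shows "\<exists>i. k \<le> i \<and> i < n \<and> T $$ (i, k) \<noteq> 0"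
proof (rule ccontr)
  assume "\<not> ?thesis"
  then have z: "T $$ (i, k) = 0" if "k \<le> i" "i < n" for i using that by auto
  define v where "v = Matrix.vec n (\<lambda>i. if i = k then 1 else if i < k then - (T $$ (i, k)) else 0)"
  have "T *\<^sub>v v = 0\<^sub>v n"
  proof (rule eq_vecI)
    fix i assume i: "i < dim_vec (0\<^sub>v n :: real Matrix.vec)"
    then have i: "i < n" by simp
    have "(T *\<^sub>v v) $ i = (\<Sum>j<n. T $$ (i, j) * (if j = k then 1 else if j < k then - (T $$ (j, k)) else 0))"
      using T i by (simp add: v_def scalar_prod_def lessThan_atLeast0)
    also have "\<dots> = (\<Sum>j<n. (if j = k then T $$ (i, k) else 0) + (if j = i then (if i < k then - (T $$ (i, k)) else 0) else 0))"
      using u i by (intro sum.cong) (auto simp: unit_cols_def)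
    also have "\<dots> = T $$ (i, k) + (if i < k then - (T $$ (i, k)) else 0)"
      using i k by (simp add: sum.distrib)
    also have "\<dots> = 0" using z i by auto
    finally show "(T *\<^sub>v v) $ i = 0\<^sub>v n $ i" using i by simp
  qed (use T in auto)
  moreover have "v \<in> carrier_vec n" by (simp add: v_def)
  moreover have "v \<noteq> 0\<^sub>v n"
  proof
    assume "v = 0\<^sub>v n"
    then have "v $ k = 0\<^sub>v n $ k" by simp
    then show False using k by (simp add: v_def)
  qed
  ultimately have "Determinant.det T = 0" using det_0_iff_vec_prod_zero[OF T] by blast
  then show False using det by simp
qed

text \<open>
  Gauss elimination read backwards, by downward induction on the number \<open>k\<close> of columns already reduced. A zero
  on the diagonal is removed by adding a lower row rather than by a transposition; so row additions and row
  multiplications are the only operations.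
\<close>
lemma scales_invertible_aux:
  assumes "k \<le> n" "T \<in> carrier_mat n n" "Determinant.det T \<noteq> 0" "unit_cols n k T"
  shows "scales n T"
  using assms
proof (induction k arbitrary: T rule: inc_induct)
  case base
  have "T = 1\<^sub>m n"
    using base by (intro eq_matI) (auto simp: unit_cols_def)
  moreover have "scales n (1\<^sub>m n)"
  proof -
    have "mat_app n (1\<^sub>m n) z = z" if "z \<in> space (leb_pi n)" for z
    proof
      fix i
      have "(\<Sum>j<n. 1\<^sub>m n $$ (i, j) * z j) = (\<Sum>j<n. if j = i then z i else 0)" if "i < n"
        using that by (intro sum.cong) auto
      then show "mat_app n (1\<^sub>m n) z i = z i"
        using leb_pi_undefined[OF that, of i] by (auto simp: mat_app_def)
    qed
    then show ?thesis by (simp add: scales_def cong: nn_integral_cong)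
  qed
  ultimately show ?case by simp
next
  case (step k)
  have k: "k < n" by fact
  \<comment> \<open>With pivot 1, the entries of column \<open>k\<close> in the rows \<open>j, j + 1, \<dots>\<close> are cleared, again read backwards.\<close>
  have clear: "scales n T" if "j \<le> n" "T \<in> carrier_mat n n" "Determinant.det T \<noteq> 0" "unit_cols n k T"
      "T $$ (k, k) = 1" "\<forall>l<j. l \<noteq> k \<longrightarrow> T $$ (l, k) = 0" for j T
    using that
  proof (induction j arbitrary: T rule: inc_induct)
    case base
    then show ?case by (intro step.IH) (auto simp: unit_cols_def less_Suc_eq)
  next
    case (step j)
    have j: "j < n" by fact
    show ?case
    proof (cases "j = k")
      case True
      then show ?thesis using step.prems by (intro step.IH) (auto simp: less_Suc_eq)
    next
      case False
      have "scales n (addrow (- (T $$ (j, k))) j k T)"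
        using step.prems False j k
        by (intro step.IH) (auto simp: unit_cols_def less_Suc_eq det_addrow[OF k False])
      then show ?thesis by (rule scales_addrowD[OF step.prems(1) j k False])
    qed
  qed
  have pivot: "scales n T" if T: "T \<in> carrier_mat n n" "Determinant.det T \<noteq> 0" "unit_cols n k T" "T $$ (k, k) \<noteq> 0" for T
  proof -
    have "scales n (multrow k (1 / (T $$ (k, k))) T)"
      by (rule clear[of 0]) (use T k in \<open>auto simp: unit_cols_def det_multrow[OF k T(1)]\<close>)
    then show ?thesis by (rule scales_multrowD[OF T(1) k, rotated]) (use T in auto)
  qed
  show ?case
  proof (cases "T $$ (k, k) = 0")
    case False
    then show ?thesis using pivot step.prems by blast
  next
    case True
    obtain i where i: "k \<le> i" "i < n" "T $$ (i, k) \<noteq> 0"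
      using exists_pivot[OF step.prems k] by auto
    have ik: "k \<noteq> i" using i True by auto
    have "scales n (addrow 1 k i T)"
      by (rule pivot) (use step.prems k i ik True in \<open>auto simp: unit_cols_def det_addrow[OF i(2) ik]\<close>)
    then show ?thesis by (rule scales_addrowD[OF step.prems(1) k i(2) ik])
  qed
qed

theorem scales_invertible:
  assumes "T \<in> carrier_mat n n" "Determinant.det T \<noteq> 0"
  shows "scales n T"
  by (rule scales_invertible_aux[of 0]) (use assms in \<open>auto simp: unit_cols_def\<close>)

section \<open>Comparison of cumulants\<close>

text \<open>
  The value bounded here is less than \<open>e^(1/2) - 1\<close>. That it is below \<open>3/4\<close> lets the inductions in
  \<open>cumulant_bound\<close> and \<open>cumulant_difference_bound\<close> close with powers of \<open>2\<close>.
\<close>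
lemma sum_half_powers_fact_le: "(\<Sum>j=1..N. (1/2::real) ^ j / fact j) \<le> 2 / 3"
proof -
  have s: "(\<lambda>j. (1/2::real) ^ j / fact j) sums exp (1/2)"
    using exp_converges[of "1/2::real"] by (simp add: scaleR_conv_of_real field_simps)
  have "(\<Sum>j=0..N. (1/2::real) ^ j / fact j) \<le> exp (1/2)"
    using sum_le_suminf[OF sums_summable[OF s], of "{0..N}"] sums_unique[OF s] by simp
  moreover have "(\<Sum>j=0..N. (1/2::real) ^ j / fact j) = 1 + (\<Sum>j=1..N. (1/2::real) ^ j / fact j)"
    by (subst sum.atLeast_Suc_atMost) simp_all
  \<comment> \<open>The bound \<open>e^x \<le> 1 + x + x\<^sup>2\<close> is too weak at \<open>1/2\<close>; it is applied at \<open>1/32\<close> and raised to the power 16.\<close>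
  moreover have "exp (1/2::real) \<le> 5 / 3"
  proof -
    have "exp (1/32::real) \<le> 1 + 1/32 + (1/32)\<^sup>2" by (rule exp_bound) auto
    then have "exp (1/32::real) \<le> 1057/1024" by (simp add: power2_eq_square)
    then have "exp (1/32::real) ^ 16 \<le> (1057/1024) ^ 16" by (rule power_mono) simp
    also have "\<dots> \<le> 5 / 3" by (simp add: power_divide)
    finally have "exp (1/32::real) ^ 16 \<le> 5 / 3" .
    then show ?thesis by (simp add: exp_of_nat_mult[symmetric])
  qed
  ultimately show ?thesis by linarith
qed

text \<open>
  The recurrence expressing cumulants by moments: compare coefficients in \<open>w' = (ln w)' w\<close>.
\<close>
lemma fln_recurrence:
  fixes w :: "real fps"
  assumes w0: "fps_nth w 0 = 1"
  shows "real r * fps_nth (fln (w - 1)) r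
    = real r * fps_nth w r - (\<Sum>k=1..<r. real k * fps_nth (fln (w - 1)) k * fps_nth w (r - k))"
proof (cases r)
  case (Suc q)
  define h where "h = fln (w - 1)"
  have "fexp h = w" unfolding h_def using fexp_fln[of "w - 1"] w0 by simp
  then have "fps_deriv w = fps_deriv h * w"
    using fps_compose_deriv[of h "fps_exp 1"] by (simp add: h_def)
  then have "fps_nth (fps_deriv w) q = (\<Sum>i=0..q. fps_nth (fps_deriv h) i * fps_nth w (q - i))"
    by (simp add: fps_mult_nth)
  then have "real r * fps_nth w r = (\<Sum>i=0..q. real (Suc i) * fps_nth h (Suc i) * fps_nth w (q - i))"
    using Suc by simp
  also have "\<dots> = (\<Sum>k=1..r. real k * fps_nth h k * fps_nth w (r - k))"
    using Suc by (intro sum.reindex_bij_witness[of _ "\<lambda>k. k - 1" Suc]) auto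
  also have "{1..r} = insert r {1..<r}" using Suc by auto
  also have "(\<Sum>k\<in>insert r {1..<r}. real k * fps_nth h k * fps_nth w (r - k))
    = real r * fps_nth h r + (\<Sum>k=1..<r. real k * fps_nth h k * fps_nth w (r - k))"
    using w0 by simp
  finally show ?thesis by (simp add: h_def)
qed simp

lemma sum_two_powers_fact_le:
  "(\<Sum>k=1..<r. 2 ^ k / fact (r - k)) \<le> (2/3) * (2::real) ^ r"
proof -
  have "(\<Sum>k=1..<r. 2 ^ k / fact (r - k)) = (\<Sum>j=1..<r. 2 ^ r * ((1/2::real) ^ j / fact j))"
  proof (rule sum.reindex_bij_witness[of _ "\<lambda>j. r - j" "\<lambda>k. r - k"])
    fix k assume k: "k \<in> {1..<r}"
    have "(2::real) ^ r = 2 ^ k * 2 ^ (r - k)" using k by (simp add: power_add[symmetric])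
    then show "2 ^ r * ((1/2::real) ^ (r - k) / fact (r - k)) = 2 ^ k / fact (r - k)"
      by (simp add: power_one_over)
  qed auto
  also have "\<dots> = 2 ^ r * (\<Sum>j=1..r-1. (1/2::real) ^ j / fact j)"
    unfolding sum_distrib_left by (intro sum.cong) auto
  also have "\<dots> \<le> 2 ^ r * (2/3)" by (intro mult_left_mono sum_half_powers_fact_le) simp
  finally show ?thesis by simp
qed

text \<open>
  Moments of geometric growth have cumulants that, divided by \<open>r!\<close>, grow at most geometrically, with the
  ratio doubled.
\<close>
lemma cumulant_bound:
  fixes a :: "nat \<Rightarrow> real"
  assumes a0: "a 0 = 1" and a: "\<And>r. 1 \<le> r \<Longrightarrow> r \<le> m \<Longrightarrow> \<bar>a r\<bar> \<le> s ^ r" and s: "s \<ge> 0" and r: "1 \<le> r" "r \<le> m"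
  shows "real r * \<bar>fps_nth (fln (Abs_fps (\<lambda>r. a r / fact r) - 1)) r\<bar> \<le> 2 ^ r * s ^ r"
  using r
proof (induction r rule: less_induct)
  case (less r)
  define w where "w = Abs_fps (\<lambda>r. a r / fact r)"
  define h where "h = fln (w - 1)"
  have w0: "fps_nth w 0 = 1" by (simp add: w_def a0)
  have wb: "\<bar>fps_nth w k\<bar> \<le> s ^ k / fact k" if "1 \<le> k" "k \<le> m" for k
    using a[OF that] by (simp add: w_def divide_right_mono)
  have "real r * \<bar>fps_nth h r\<bar> = \<bar>real r * fps_nth w r - (\<Sum>k=1..<r. real k * fps_nth h k * fps_nth w (r - k))\<bar>"
    using fln_recurrence[OF w0, of r, folded h_def] by (metis abs_mult abs_of_nat)
  also have "\<dots> \<le> real r * (s ^ r / fact r) + (\<Sum>k=1..<r. 2 ^ k * s ^ k * (s ^ (r - k) / fact (r - k)))"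
  proof (rule order_trans[OF abs_triangle_ineq4], rule add_mono)
    show "\<bar>real r * fps_nth w r\<bar> \<le> real r * (s ^ r / fact r)"
      unfolding abs_mult using wb[of r] less.prems by (intro mult_mono) auto
    show "\<bar>\<Sum>k=1..<r. real k * fps_nth h k * fps_nth w (r - k)\<bar> \<le> (\<Sum>k=1..<r. 2 ^ k * s ^ k * (s ^ (r - k) / fact (r - k)))"
    proof (rule order_trans[OF sum_abs], rule sum_mono)
      fix k assume k: "k \<in> {1..<r}"
      have "real k * \<bar>fps_nth h k\<bar> \<le> 2 ^ k * s ^ k"
        unfolding h_def w_def using k less.prems by (intro less.IH) auto
      moreover have "\<bar>fps_nth w (r - k)\<bar> \<le> s ^ (r - k) / fact (r - k)" using k less.prems by (intro wb) auto
      ultimately show "\<bar>real k * fps_nth h k * fps_nth w (r - k)\<bar> \<le> 2 ^ k * s ^ k * (s ^ (r - k) / fact (r - k))"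
        unfolding abs_mult using s by (intro mult_mono[of "\<bar>real k\<bar> * \<bar>fps_nth h k\<bar>"]) auto
    qed
  qed
  also have "real r * (s ^ r / fact r) = s ^ r * (1 / fact (r - 1))"
    using less.prems fact_reduce[of r, where ?'a = real] by simp
  also have "(\<Sum>k=1..<r. 2 ^ k * s ^ k * (s ^ (r - k) / fact (r - k))) = s ^ r * (\<Sum>k=1..<r. 2 ^ k / fact (r - k))"
    unfolding sum_distrib_left
  proof (intro sum.cong refl)
    fix k assume "k \<in> {1..<r}"
    then have "s ^ r = s ^ k * s ^ (r - k)" by (simp add: power_add[symmetric])
    then show "2 ^ k * s ^ k * (s ^ (r - k) / fact (r - k)) = s ^ r * (2 ^ k / fact (r - k))" by simp
  qed
  also have "s ^ r * (1 / fact (r - 1)) + s ^ r * (\<Sum>k=1..<r. 2 ^ k / fact (r - k))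
     = s ^ r * (1 / fact (r - 1) + (\<Sum>k=1..<r. 2 ^ k / fact (r - k)))" by (simp add: distrib_left)
  also have "\<dots> \<le> s ^ r * 2 ^ r"
  proof (rule mult_left_mono)
    show "1 / fact (r - 1) + (\<Sum>k=1..<r. 2 ^ k / fact (r - k)) \<le> (2::real) ^ r"
    proof (cases "r = 1")
      case False
      then have "(2::real) ^ 2 \<le> 2 ^ r" using less.prems by (intro power_increasing) auto
      moreover have "1 / fact (r - 1) \<le> (1::real)" by (simp add: divide_simps)
      moreover note sum_two_powers_fact_le[of r]
      ultimately show ?thesis unfolding power2_eq_square by linarith
    qed simp
  qed (use s in simp)
  finally show ?case by (simp add: h_def w_def mult.commute)
qed

text \<open>
  Cumulants are Lipschitz in the moments: subtract the recurrences for both sequences and use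
  \<open>cumulant_bound\<close> for one of them.
\<close>
lemma cumulant_difference_bound:
  fixes a a' :: "nat \<Rightarrow> real"
  assumes a0: "a 0 = 1" "a' 0 = 1" and a: "\<And>r. 1 \<le> r \<Longrightarrow> r \<le> m \<Longrightarrow> \<bar>a r\<bar> \<le> s ^ r"
    and a': "\<And>r. 1 \<le> r \<Longrightarrow> r \<le> m \<Longrightarrow> \<bar>a' r\<bar> \<le> s ^ r"
    and d: "\<And>r. 1 \<le> r \<Longrightarrow> r \<le> m \<Longrightarrow> \<bar>a r - a' r\<bar> \<le> \<tau> * s ^ r"
    and s: "s \<ge> 0" and \<tau>: "\<tau> \<ge> 0" and r: "1 \<le> r" "r \<le> m"
  shows "real r * \<bar>fps_nth (fln (Abs_fps (\<lambda>r. a r / fact r) - 1)) r - fps_nth (fln (Abs_fps (\<lambda>r. a' r / fact r) - 1)) r\<bar>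
    \<le> 3 * \<tau> * (2 ^ r * s ^ r)"
  using r
proof (induction r rule: less_induct)
  case (less r)
  define w where "w = Abs_fps (\<lambda>r. a r / fact r)"
  define h where "h = fln (w - 1)"
  define w' where "w' = Abs_fps (\<lambda>r. a' r / fact r)"
  define h' where "h' = fln (w' - 1)"
  have w0: "fps_nth w 0 = 1" "fps_nth w' 0 = 1" by (simp_all add: w_def w'_def a0)
  have wb: "\<bar>fps_nth w k\<bar> \<le> s ^ k / fact k" if "1 \<le> k" "k \<le> m" for k
    using a[OF that] by (simp add: w_def divide_right_mono)
  have wd: "\<bar>fps_nth w k - fps_nth w' k\<bar> \<le> \<tau> * s ^ k / fact k" if "1 \<le> k" "k \<le> m" for k
    using d[OF that] by (simp add: w_def w'_def divide_right_mono diff_divide_distrib[symmetric])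
  have h'b: "real k * \<bar>fps_nth h' k\<bar> \<le> 2 ^ k * s ^ k" if "1 \<le> k" "k \<le> m" for k
    unfolding h'_def w'_def by (rule cumulant_bound[OF a0(2) a' s that])
  let ?D = "\<lambda>k. real k * (fps_nth h k - fps_nth h' k) * fps_nth w (r - k) + real k * fps_nth h' k * (fps_nth w (r - k) - fps_nth w' (r - k))"
  have "real r * (fps_nth h r - fps_nth h' r) = real r * (fps_nth w r - fps_nth w' r) - (\<Sum>k=1..<r. ?D k)"
  proof -
    have "(\<Sum>k=1..<r. ?D k) = (\<Sum>k=1..<r. real k * fps_nth h k * fps_nth w (r - k)) - (\<Sum>k=1..<r. real k * fps_nth h' k * fps_nth w' (r - k))"
      unfolding sum_subtractf[symmetric] by (intro sum.cong refl) (simp add: algebra_simps)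
    then show ?thesis
      unfolding right_diff_distrib
      using fln_recurrence[OF w0(1), of r, folded h_def] fln_recurrence[OF w0(2), of r, folded h'_def] by linarith
  qed
  then have "real r * \<bar>fps_nth h r - fps_nth h' r\<bar> = \<bar>real r * (fps_nth w r - fps_nth w' r) - (\<Sum>k=1..<r. ?D k)\<bar>"
    by (metis abs_mult abs_of_nat)
  also have "\<dots> \<le> real r * (\<tau> * s ^ r / fact r) + (\<Sum>k=1..<r. 4 * \<tau> * (2 ^ k * s ^ k) * (s ^ (r - k) / fact (r - k)))"
  proof (rule order_trans[OF abs_triangle_ineq4], rule add_mono)
    show "\<bar>real r * (fps_nth w r - fps_nth w' r)\<bar> \<le> real r * (\<tau> * s ^ r / fact r)"
      unfolding abs_mult using wd[of r] less.prems by (intro mult_mono) auto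
    show "\<bar>\<Sum>k=1..<r. ?D k\<bar> \<le> (\<Sum>k=1..<r. 4 * \<tau> * (2 ^ k * s ^ k) * (s ^ (r - k) / fact (r - k)))"
    proof (rule order_trans[OF sum_abs], rule sum_mono)
      fix k assume k: "k \<in> {1..<r}"
      have 1: "real k * \<bar>fps_nth h k - fps_nth h' k\<bar> \<le> 3 * \<tau> * (2 ^ k * s ^ k)"
        unfolding h_def w_def h'_def w'_def using k less.prems by (intro less.IH) auto
      have 2: "\<bar>fps_nth w (r - k)\<bar> \<le> s ^ (r - k) / fact (r - k)" using k less.prems by (intro wb) auto
      have 3: "real k * \<bar>fps_nth h' k\<bar> \<le> 2 ^ k * s ^ k" using k less.prems by (intro h'b) auto
      have 4: "\<bar>fps_nth w (r - k) - fps_nth w' (r - k)\<bar> \<le> \<tau> * s ^ (r - k) / fact (r - k)"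
        using k less.prems by (intro wd) auto
      have "\<bar>?D k\<bar> \<le> real k * \<bar>fps_nth h k - fps_nth h' k\<bar> * \<bar>fps_nth w (r - k)\<bar>
         + real k * \<bar>fps_nth h' k\<bar> * \<bar>fps_nth w (r - k) - fps_nth w' (r - k)\<bar>"
        by (rule order_trans[OF abs_triangle_ineq]) (simp add: abs_mult)
      also have "\<dots> \<le> 3 * \<tau> * (2 ^ k * s ^ k) * (s ^ (r - k) / fact (r - k)) + 2 ^ k * s ^ k * (\<tau> * s ^ (r - k) / fact (r - k))"
        using s \<tau> by (intro add_mono mult_mono 1 2 3 4) auto
      also have "\<dots> = 4 * \<tau> * (2 ^ k * s ^ k) * (s ^ (r - k) / fact (r - k))" by (simp add: field_simps)
      finally show "\<bar>?D k\<bar> \<le> 4 * \<tau> * (2 ^ k * s ^ k) * (s ^ (r - k) / fact (r - k))" .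
    qed
  qed
  also have "real r * (\<tau> * s ^ r / fact r) = \<tau> * s ^ r * (1 / fact (r - 1))"
    using less.prems fact_reduce[of r, where ?'a = real] by simp
  also have "(\<Sum>k=1..<r. 4 * \<tau> * (2 ^ k * s ^ k) * (s ^ (r - k) / fact (r - k))) = \<tau> * s ^ r * (4 * (\<Sum>k=1..<r. 2 ^ k / fact (r - k)))"
    unfolding sum_distrib_left
  proof (intro sum.cong refl)
    fix k assume "k \<in> {1..<r}"
    then have "s ^ r = s ^ k * s ^ (r - k)" by (simp add: power_add[symmetric])
    then show "4 * \<tau> * (2 ^ k * s ^ k) * (s ^ (r - k) / fact (r - k)) = \<tau> * s ^ r * (4 * (2 ^ k / fact (r - k)))" by simp
  qed
  also have "\<tau> * s ^ r * (1 / fact (r - 1)) + \<tau> * s ^ r * (4 * (\<Sum>k=1..<r. 2 ^ k / fact (r - k)))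
     = \<tau> * s ^ r * (1 / fact (r - 1) + 4 * (\<Sum>k=1..<r. 2 ^ k / fact (r - k)))" by (simp add: distrib_left)
  also have "\<dots> \<le> \<tau> * s ^ r * (3 * 2 ^ r)"
  proof (rule mult_left_mono)
    show "1 / fact (r - 1) + 4 * (\<Sum>k=1..<r. 2 ^ k / fact (r - k)) \<le> 3 * (2::real) ^ r"
    proof (cases "r = 1")
      case False
      then have "(2::real) ^ 2 \<le> 2 ^ r" using less.prems by (intro power_increasing) auto
      moreover have "1 / fact (r - 1) \<le> (1::real)" by (simp add: divide_simps)
      moreover note sum_two_powers_fact_le[of r]
      ultimately show ?thesis unfolding power2_eq_square by linarith
    qed simp
  qed (use s \<tau> in simp)
  finally show ?case by (simp add: h_def w_def h'_def w'_def mult_ac)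
qed

section \<open>Conditional means\<close>

text \<open>
  The conditional expectation given the event \<open>B\<close>, written as an integral against \<open>M\<close> itself so that
  different events can be compared.
\<close>
definition cond_mean :: "'a measure \<Rightarrow> 'a set \<Rightarrow> ('a \<Rightarrow> real) \<Rightarrow> real" where
  "cond_mean M B u = (\<integral>x. indicator B x * u x \<partial>M) / measure M B"

lemma (in prob_space) cond_mean_space: "cond_mean M (space M) u = (\<integral>x. u x \<partial>M)"
  unfolding cond_mean_def prob_space by (simp cong: Bochner_Integration.integral_cong)

lemma (in prob_space) integral_uniform_measure_eq_cond_mean:
  assumes "B \<in> sets M" "prob B > 0" "u \<in> borel_measurable M"
  shows "(\<integral>x. u x \<partial>uniform_measure M B) = cond_mean M B u"
proof -
  have "uniform_measure M B = density M (\<lambda>x. ennreal (indicator B x / prob B))"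
    unfolding uniform_measure_def emeasure_eq_measure
    using assms by (intro density_cong) (use divide_ennreal[of 1 "prob B"] in \<open>auto simp: indicator_def\<close>)
  then have "(\<integral>x. u x \<partial>uniform_measure M B) = (\<integral>x. (indicator B x / prob B) * u x \<partial>M)"
    using assms by (simp add: integral_density)
  also have "\<dots> = (\<integral>x. (indicator B x * u x) / prob B \<partial>M)" by (simp add: field_simps)
  finally show ?thesis by (simp add: cond_mean_def)
qed

lemma nn_integral_bound_integral:
  assumes "u \<in> borel_measurable M" "(\<integral>\<^sup>+x. ennreal \<bar>u x\<bar> \<partial>M) \<le> ennreal c" "c \<ge> 0"
  shows "integrable M u" "\<bar>\<integral>x. u x \<partial>M\<bar> \<le> c"
proof -
  have "(\<integral>\<^sup>+x. ennreal \<bar>u x\<bar> \<partial>M) < \<infinity>" using assms(2) by (simp add: le_less_trans[OF _ ennreal_less_top])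
  then show i: "integrable M u" using assms(1) by (intro integrableI_bounded) simp_all
  have "ennreal (\<integral>x. \<bar>u x\<bar> \<partial>M) = (\<integral>\<^sup>+x. ennreal \<bar>u x\<bar> \<partial>M)"
    using i by (intro nn_integral_eq_integral[symmetric]) auto
  then have "ennreal (\<integral>x. \<bar>u x\<bar> \<partial>M) \<le> ennreal c" using assms(2) by simp
  then have "(\<integral>x. \<bar>u x\<bar> \<partial>M) \<le> c" using assms(3) by (simp add: ennreal_le_iff)
  moreover have "\<bar>\<integral>x. u x \<partial>M\<bar> \<le> (\<integral>x. \<bar>u x\<bar> \<partial>M)" using integral_norm_bound[of M u] by simp
  ultimately show "\<bar>\<integral>x. u x \<partial>M\<bar> \<le> c" by linarith
qed

text \<open>
  Passing from \<open>B\<close> to \<open>A\<close> changes the numerator by the integral over \<open>B - A\<close>, at most \<open>s t\<close>, and the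
  denominator by at most \<open>t\<close>; both denominators are at least \<open>1/2\<close>.
\<close>
lemma (in prob_space) cond_mean_compare:
  assumes A: "A \<in> sets M" and B: "B \<in> sets M" and sub: "A \<subseteq> B" and u: "u \<in> borel_measurable M"
    and s: "s \<ge> 0" and t: "t \<ge> 0"
    and 1: "(\<integral>\<^sup>+x. ennreal \<bar>u x\<bar> * indicator B x \<partial>M) \<le> ennreal s"
    and 2: "(\<integral>\<^sup>+x. ennreal \<bar>u x\<bar> * indicator (B - A) x \<partial>M) \<le> ennreal (s * t)"
    and A1: "1 - prob A \<le> t" "prob A \<ge> 1 / 2"
  shows "\<bar>cond_mean M A u\<bar> \<le> 2 * s" "\<bar>cond_mean M B u\<bar> \<le> 2 * s" "\<bar>cond_mean M A u - cond_mean M B u\<bar> \<le> 6 * t * s"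
proof -
  have eqi: "ennreal \<bar>indicator X x * u x\<bar> = ennreal \<bar>u x\<bar> * indicator X x" for X x
    by (auto simp: indicator_def)
  have m: "(\<lambda>x. indicator X x * u x) \<in> borel_measurable M" if "X \<in> sets M" for X
    using that u by measurable
  have B': "integrable M (\<lambda>x. indicator B x * u x)" "\<bar>\<integral>x. indicator B x * u x \<partial>M\<bar> \<le> s"
    using nn_integral_bound_integral[OF m[OF B], of s] 1 s by (simp_all add: eqi)
  have D': "integrable M (\<lambda>x. indicator (B - A) x * u x)" "\<bar>\<integral>x. indicator (B - A) x * u x \<partial>M\<bar> \<le> s * t"
    using nn_integral_bound_integral[OF m[of "B - A"], of "s * t"] 2 s t A B by (simp_all add: eqi)
  have "(\<integral>\<^sup>+x. ennreal \<bar>u x\<bar> * indicator A x \<partial>M) \<le> (\<integral>\<^sup>+x. ennreal \<bar>u x\<bar> * indicator B x \<partial>M)"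
    using sub by (intro nn_integral_mono) (auto simp: indicator_def)
  then have A': "integrable M (\<lambda>x. indicator A x * u x)" "\<bar>\<integral>x. indicator A x * u x \<partial>M\<bar> \<le> s"
    using nn_integral_bound_integral[OF m[OF A], of s] 1 s by (simp_all add: eqi)
  have pAB: "prob A \<le> prob B" by (rule finite_measure_mono[OF sub B])
  have pB: "prob B \<ge> 1 / 2" using pAB A1 by linarith
  have half: "\<bar>z / p\<bar> \<le> 2 * \<bar>z\<bar>" if "p \<ge> 1 / 2" for z p :: real
  proof -
    have "\<bar>z\<bar> / p \<le> \<bar>z\<bar> / (1 / 2)" using that by (intro divide_left_mono) auto
    then show ?thesis using that by (simp add: abs_divide)
  qed
  show "\<bar>cond_mean M A u\<bar> \<le> 2 * s" "\<bar>cond_mean M B u\<bar> \<le> 2 * s"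
    unfolding cond_mean_def
    using order_trans[OF half[OF A1(2)] mult_left_mono[OF A'(2)]] order_trans[OF half[OF pB] mult_left_mono[OF B'(2)]]
    by simp_all
  have eq: "(\<integral>x. indicator B x * u x \<partial>M) = (\<integral>x. indicator A x * u x \<partial>M) + (\<integral>x. indicator (B - A) x * u x \<partial>M)"
    using sub by (subst Bochner_Integration.integral_add[OF A'(1) D'(1), symmetric])
      (auto intro!: Bochner_Integration.integral_cong simp: indicator_def)
  define z where "z = (\<integral>x. indicator A x * u x \<partial>M)"
  define y where "y = (\<integral>x. indicator (B - A) x * u x \<partial>M)"
  have "cond_mean M A u - cond_mean M B u = z * (prob B - prob A) / prob A / prob B - y / prob B"
    unfolding cond_mean_def eq z_def[symmetric] y_def[symmetric] using A1(2) pB by (simp add: field_simps)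
  then have "\<bar>cond_mean M A u - cond_mean M B u\<bar> \<le> \<bar>z * (prob B - prob A) / prob A / prob B\<bar> + \<bar>y / prob B\<bar>"
    by linarith
  also have "\<dots> \<le> 2 * (2 * \<bar>z * (prob B - prob A)\<bar>) + 2 * \<bar>y\<bar>"
    using half[OF pB, of "z * (prob B - prob A) / prob A"] half[OF A1(2), of "z * (prob B - prob A)"] half[OF pB, of y] by linarith
  also have "\<bar>z * (prob B - prob A)\<bar> \<le> s * t"
    unfolding abs_mult using A'(2) pAB A1(1) s by (intro mult_mono) (auto simp: z_def intro: order_trans[OF diff_right_mono[OF prob_le_1]])
  also have "\<bar>y\<bar> \<le> s * t" using D'(2) by (simp add: y_def)
  finally show "\<bar>cond_mean M A u - cond_mean M B u\<bar> \<le> 6 * t * s" by (simp add: mult_ac)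
qed

section \<open>The Gaussian measure\<close>

text \<open>
  The law \<open>N(0, 1/2)\<close>, with density proportional to \<open>e^(-t^2)\<close>.
\<close>
definition gauss1 :: "real measure" where
  "gauss1 = density lborel (\<lambda>t. ennreal (normal_density 0 (1 / sqrt 2) t))"

abbreviation gauss_pi :: "nat \<Rightarrow> (nat \<Rightarrow> real) measure" where
  "gauss_pi n \<equiv> PiM {..<n} (\<lambda>_. gauss1)"

definition cube :: "nat \<Rightarrow> real \<Rightarrow> (nat \<Rightarrow> real) set" where
  "cube n \<rho> = {z \<in> PiE {..<n} (\<lambda>_. UNIV). \<forall>i<n. \<bar>z i\<bar> \<le> \<rho>}"

lemma sets_gauss1 [simp, measurable_cong]: "sets gauss1 = sets borel"
  by (simp add: gauss1_def)

lemma space_gauss1 [simp]: "space gauss1 = UNIV"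
  by (simp add: gauss1_def)

lemma space_gauss_pi: "space (gauss_pi n) = PiE {..<n} (\<lambda>_. UNIV)"
  by (simp add: space_PiM)

lemma prob_space_gauss1: "prob_space gauss1"
  unfolding gauss1_def by (rule prob_space_normal_density) simp

lemma prob_space_gauss_pi: "prob_space (gauss_pi n)"
  by (rule prob_space_PiM) (rule prob_space_gauss1)

lemma normal_density_scaled:
  assumes "s > 0"
  shows "normal_density 0 (1 / sqrt (2 * s)) t = sqrt s / sqrt pi * exp (- (s * t\<^sup>2))"
  using assms by (simp add: normal_density_def power_divide real_sqrt_divide field_simps)

lemma nn_integral_gauss1_exp:
  assumes "x < 1"
  shows "(\<integral>\<^sup>+t. ennreal (exp (x * t\<^sup>2)) \<partial>gauss1) = ennreal (1 / sqrt (1 - x))"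
proof -
  let ?\<sigma> = "1 / sqrt (2 * (1 - x))"
  have pt: "normal_density 0 (1 / sqrt 2) t * exp (x * t\<^sup>2) = 1 / sqrt (1 - x) * normal_density 0 ?\<sigma> t" for t
    using normal_density_scaled[of 1 t] normal_density_scaled[of "1 - x" t] assms
    by (simp add: exp_add[symmetric] algebra_simps)
  have "(\<integral>\<^sup>+t. ennreal (exp (x * t\<^sup>2)) \<partial>gauss1) = (\<integral>\<^sup>+t. ennreal (normal_density 0 (1 / sqrt 2) t) * ennreal (exp (x * t\<^sup>2)) \<partial>lborel)"
    unfolding gauss1_def by (rule nn_integral_density) auto
  also have "\<dots> = (\<integral>\<^sup>+t. ennreal (1 / sqrt (1 - x)) * ennreal (normal_density 0 ?\<sigma> t) \<partial>lborel)"
    using assms by (intro nn_integral_cong) (simp add: ennreal_mult[symmetric] pt)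
  also have "\<dots> = ennreal (1 / sqrt (1 - x)) * (\<integral>\<^sup>+t. ennreal (normal_density 0 ?\<sigma> t) \<partial>lborel)"
    by (rule nn_integral_cmult) auto
  also have "(\<integral>\<^sup>+t. ennreal (normal_density 0 ?\<sigma> t) \<partial>lborel) = 1"
    using prob_space.emeasure_space_1[OF prob_space_normal_density[of ?\<sigma> 0]] assms
    by (simp add: emeasure_density)
  finally show ?thesis by simp
qed

text \<open>
  This is a Chernoff bound. The exponent \<open>5/8\<close> exceeds the \<open>1/2\<close> of the final estimate, which leaves room for powers of
  \<open>n\<close> (\<open>tail_absorb\<close>), and \<open>x + 5/8 \<le> 3/4\<close> stays below \<open>1\<close>, so that the exponential moment is at most
  \<open>1 / sqrt (1/4) = 2\<close>.
\<close>
lemma nn_integral_gauss1_tail: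
  assumes x: "0 \<le> x" "x \<le> 1 / 8" and \<rho>: "\<rho> \<ge> 0"
  shows "(\<integral>\<^sup>+t. ennreal (exp (x * t\<^sup>2)) * indicator {t. \<rho> < \<bar>t\<bar>} t \<partial>gauss1) \<le> ennreal (2 * exp (- (5/8) * \<rho>\<^sup>2))"
proof -
  have "(\<integral>\<^sup>+t. ennreal (exp (x * t\<^sup>2)) * indicator {t. \<rho> < \<bar>t\<bar>} t \<partial>gauss1)
    \<le> (\<integral>\<^sup>+t. ennreal (exp (- (5/8) * \<rho>\<^sup>2)) * ennreal (exp ((x + 5/8) * t\<^sup>2)) \<partial>gauss1)"
  proof (rule nn_integral_mono)
    fix t
    show "ennreal (exp (x * t\<^sup>2)) * indicator {t. \<rho> < \<bar>t\<bar>} t \<le> ennreal (exp (- (5/8) * \<rho>\<^sup>2)) * ennreal (exp ((x + 5/8) * t\<^sup>2))"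
    proof (cases "\<rho> < \<bar>t\<bar>")
      case True
      then have "\<rho>\<^sup>2 \<le> \<bar>t\<bar>\<^sup>2" using \<rho> by (intro power_mono) auto
      then have "\<rho>\<^sup>2 \<le> t\<^sup>2" by simp
      then have "exp (x * t\<^sup>2) \<le> exp (- (5/8) * \<rho>\<^sup>2) * exp ((x + 5/8) * t\<^sup>2)"
        by (simp add: exp_add[symmetric] algebra_simps)
      then show ?thesis using True by (simp add: ennreal_mult[symmetric] ennreal_leI)
    qed simp
  qed
  also have "\<dots> = ennreal (exp (- (5/8) * \<rho>\<^sup>2)) * (\<integral>\<^sup>+t. ennreal (exp ((x + 5/8) * t\<^sup>2)) \<partial>gauss1)"
    by (rule nn_integral_cmult) measurable
  also have "(\<integral>\<^sup>+t. ennreal (exp ((x + 5/8) * t\<^sup>2)) \<partial>gauss1) = ennreal (1 / sqrt (1 - (x + 5/8)))"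
    using x by (intro nn_integral_gauss1_exp) auto
  also have "ennreal (exp (- (5/8) * \<rho>\<^sup>2)) * ennreal (1 / sqrt (1 - (x + 5/8))) \<le> ennreal (2 * exp (- (5/8) * \<rho>\<^sup>2))"
  proof -
    have "1 / 2 = sqrt (1 / 4)" by (simp add: real_sqrt_divide)
    also have "\<dots> \<le> sqrt (1 - (x + 5/8))" using x by simp
    finally have "1 / sqrt (1 - (x + 5/8)) \<le> 1 / (1 / 2)" using x by (intro divide_left_mono) auto
    then have "exp (- (5/8) * \<rho>\<^sup>2) * (1 / sqrt (1 - (x + 5/8))) \<le> exp (- (5/8) * \<rho>\<^sup>2) * 2"
      by (intro mult_left_mono) auto
    then show ?thesis using x by (simp add: ennreal_mult[symmetric] ennreal_leI mult.commute)
  qed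
  finally show ?thesis .
qed

lemma exp_sum_squares:
  fixes n :: nat
  shows "ennreal (exp (x * (\<Sum>i<n. (z i)\<^sup>2))) = (\<Prod>i<n. ennreal (exp (x * (z i)\<^sup>2)))"
  unfolding sum_distrib_left exp_sum[OF finite_lessThan] by (rule prod_ennreal[symmetric]) simp

lemma nn_integral_gauss_pi_exp:
  assumes "x < 1"
  shows "(\<integral>\<^sup>+z. ennreal (exp (x * (\<Sum>i<n. (z i)\<^sup>2))) \<partial>gauss_pi n) = ennreal ((1 / sqrt (1 - x)) ^ n)"
proof -
  interpret product_sigma_finite "\<lambda>_. gauss1"
    by (rule product_sigma_finite.intro, rule prob_space_imp_sigma_finite, rule prob_space_gauss1)
  have "(\<integral>\<^sup>+z. ennreal (exp (x * (\<Sum>i<n. (z i)\<^sup>2))) \<partial>gauss_pi n) = (\<Prod>i<n. \<integral>\<^sup>+t. ennreal (exp (x * t\<^sup>2)) \<partial>gauss1)"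
    unfolding exp_sum_squares by (rule product_nn_integral_prod) auto
  also have "\<dots> = ennreal ((1 / sqrt (1 - x)) ^ n)"
    using assms by (simp add: nn_integral_gauss1_exp ennreal_power)
  finally show ?thesis .
qed

lemma nn_integral_gauss_pi_tail1:
  assumes x: "0 \<le> x" "x \<le> 1 / 8" and \<rho>: "\<rho> \<ge> 0" and j: "j < n"
  shows "(\<integral>\<^sup>+z. ennreal (exp (x * (\<Sum>i<n. (z i)\<^sup>2))) * indicator {t. \<rho> < \<bar>t\<bar>} (z j) \<partial>gauss_pi n)
    \<le> ennreal (2 * exp (- (5/8) * \<rho>\<^sup>2) * (1 / sqrt (1 - x)) ^ n)"
proof -
  interpret product_sigma_finite "\<lambda>_. gauss1"
    by (rule product_sigma_finite.intro, rule prob_space_imp_sigma_finite, rule prob_space_gauss1)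
  define q where "q = 1 / sqrt (1 - x)"
  have q1: "q \<ge> 1" using x unfolding q_def by (simp add: le_divide_eq)
  let ?U = "{t::real. \<rho> < \<bar>t\<bar>}"
  let ?f = "\<lambda>i t. ennreal (exp (x * t\<^sup>2)) * (if i = j then indicator ?U t else 1)"
  have U: "?U \<in> sets borel" by measurable
  have fm: "?f i \<in> borel_measurable gauss1" for i using U by (cases "i = j") auto
  have "(\<integral>\<^sup>+z. ennreal (exp (x * (\<Sum>i<n. (z i)\<^sup>2))) * indicator ?U (z j) \<partial>gauss_pi n) = (\<integral>\<^sup>+z. (\<Prod>i<n. ?f i (z i)) \<partial>gauss_pi n)"
    unfolding exp_sum_squares using j by (intro nn_integral_cong) (simp add: prod.distrib prod.delta)
  also have "\<dots> = (\<Prod>i<n. \<integral>\<^sup>+t. ?f i t \<partial>gauss1)"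
    by (rule product_nn_integral_prod) (use fm in auto)
  also have "\<dots> = (\<integral>\<^sup>+t. ?f j t \<partial>gauss1) * (\<Prod>i\<in>{..<n} - {j}. \<integral>\<^sup>+t. ?f i t \<partial>gauss1)"
    by (rule prod.remove) (use j in auto)
  also have "(\<Prod>i\<in>{..<n} - {j}. \<integral>\<^sup>+t. ?f i t \<partial>gauss1) = (\<Prod>i\<in>{..<n} - {j}. ennreal q)"
    using x by (intro prod.cong) (auto simp: nn_integral_gauss1_exp q_def)
  also have "\<dots> = ennreal (q ^ (n - 1))" using j q1 by (simp add: ennreal_power)
  also have "(\<integral>\<^sup>+t. ?f j t \<partial>gauss1) * ennreal (q ^ (n - 1)) \<le> ennreal (2 * exp (- (5/8) * \<rho>\<^sup>2)) * ennreal (q ^ n)"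
    using nn_integral_gauss1_tail[OF x \<rho>] q1 by (intro mult_mono ennreal_leI power_increasing) auto
  also have "\<dots> = ennreal (2 * exp (- (5/8) * \<rho>\<^sup>2) * q ^ n)" using q1 by (simp add: ennreal_mult)
  finally show ?thesis by (simp add: q_def)
qed

lemma cube_sets [measurable]: "cube n \<rho> \<in> sets (gauss_pi n)"
proof -
  have "cube n \<rho> = PiE {..<n} (\<lambda>_. {-\<rho>..\<rho>})" 
  proof -
    have "\<bar>t\<bar> \<le> \<rho> \<longleftrightarrow> t \<in> {-\<rho>..\<rho>}" for t :: real by auto
    then have "z \<in> cube n \<rho> \<longleftrightarrow> z \<in> PiE {..<n} (\<lambda>_. {-\<rho>..\<rho>})" for z
      unfolding cube_def mem_Collect_eq PiE_iff by auto
    then show ?thesis by blast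
  qed
  also have "\<dots> \<in> sets (gauss_pi n)" by (rule sets_PiM_I_finite) auto
  finally show ?thesis .
qed

lemma nn_integral_gauss_pi_outside_box:
  assumes x: "0 \<le> x" "x \<le> 1 / 8" and \<rho>: "\<rho> \<ge> 0"
  shows "(\<integral>\<^sup>+z. ennreal (exp (x * (\<Sum>i<n. (z i)\<^sup>2))) * indicator (space (gauss_pi n) - cube n \<rho>) z \<partial>gauss_pi n)
    \<le> ennreal (n * (2 * exp (- (5/8) * \<rho>\<^sup>2) * (1 / sqrt (1 - x)) ^ n))"
proof -
  have "(\<integral>\<^sup>+z. ennreal (exp (x * (\<Sum>i<n. (z i)\<^sup>2))) * indicator (space (gauss_pi n) - cube n \<rho>) z \<partial>gauss_pi n)
    \<le> (\<integral>\<^sup>+z. (\<Sum>j<n. ennreal (exp (x * (\<Sum>i<n. (z i)\<^sup>2))) * indicator {t. \<rho> < \<bar>t\<bar>} (z j)) \<partial>gauss_pi n)"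
  proof (rule nn_integral_mono)
    fix z assume z: "z \<in> space (gauss_pi n)"
    show "ennreal (exp (x * (\<Sum>i<n. (z i)\<^sup>2))) * indicator (space (gauss_pi n) - cube n \<rho>) z
      \<le> (\<Sum>j<n. ennreal (exp (x * (\<Sum>i<n. (z i)\<^sup>2))) * indicator {t. \<rho> < \<bar>t\<bar>} (z j))"
    proof (cases "z \<in> cube n \<rho>")
      case False
      then obtain j where j: "j < n" "\<rho> < \<bar>z j\<bar>" using z by (auto simp: cube_def space_gauss_pi not_le)
      have "ennreal (exp (x * (\<Sum>i<n. (z i)\<^sup>2))) * indicator (space (gauss_pi n) - cube n \<rho>) z
         \<le> ennreal (exp (x * (\<Sum>i<n. (z i)\<^sup>2))) * indicator {t. \<rho> < \<bar>t\<bar>} (z j)"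
        using j by (auto simp: indicator_def)
      also have "\<dots> \<le> (\<Sum>j<n. ennreal (exp (x * (\<Sum>i<n. (z i)\<^sup>2))) * indicator {t. \<rho> < \<bar>t\<bar>} (z j))"
        using j by (intro member_le_sum) auto
      finally show ?thesis .
    qed simp
  qed
  also have "\<dots> = (\<Sum>j<n. \<integral>\<^sup>+z. ennreal (exp (x * (\<Sum>i<n. (z i)\<^sup>2))) * indicator {t. \<rho> < \<bar>t\<bar>} (z j) \<partial>gauss_pi n)"
  proof (rule nn_integral_sum)
    fix j assume "j \<in> {..<n}"
    then have [measurable]: "(\<lambda>z. z j) \<in> borel_measurable (gauss_pi n)"
      using measurable_component_singleton[of j "{..<n}" "\<lambda>_. gauss1"] by (simp cong: measurable_cong_sets)
    have [measurable]: "(\<lambda>z. \<Sum>i<n. (z i)\<^sup>2) \<in> borel_measurable (gauss_pi n)"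
      using measurable_component_singleton[of _ "{..<n}" "\<lambda>_. gauss1"]
      by (intro borel_measurable_sum borel_measurable_power) (simp cong: measurable_cong_sets)
    have [measurable]: "{t::real. \<rho> < \<bar>t\<bar>} \<in> sets borel" by measurable
    show "(\<lambda>z. ennreal (exp (x * (\<Sum>i<n. (z i)\<^sup>2))) * indicator {t. \<rho> < \<bar>t\<bar>} (z j)) \<in> borel_measurable (gauss_pi n)"
      by measurable
  qed
  also have "\<dots> \<le> (\<Sum>j<n. ennreal (2 * exp (- (5/8) * \<rho>\<^sup>2) * (1 / sqrt (1 - x)) ^ n))"
    by (intro sum_mono nn_integral_gauss_pi_tail1 x \<rho>) auto
  also have "\<dots> = ennreal (n * (2 * exp (- (5/8) * \<rho>\<^sup>2) * (1 / sqrt (1 - x)) ^ n))"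
    using x by (simp add: ennreal_mult ennreal_of_nat_eq_real_of_nat)
  finally show ?thesis .
qed

lemma inverse_sqrt_power_le:
  assumes "0 \<le> x" "x \<le> 1 / 2"
  shows "(1 / sqrt (1 - x)) ^ n \<le> exp (n * (x + 2 * x\<^sup>2) / 2)"
proof -
  have "ln (1 - x) \<ge> - x - 2 * x\<^sup>2" using assms by (intro ln_one_minus_pos_lower_bound) auto
  then have "exp (- x - 2 * x\<^sup>2) \<le> 1 - x" using assms by (subst (asm) ln_ge_iff) auto
  then have "sqrt (exp (- x - 2 * x\<^sup>2)) \<le> sqrt (1 - x)" by simp
  moreover have "sqrt (exp (- x - 2 * x\<^sup>2)) = exp (- ((x + 2 * x\<^sup>2) / 2))"
  proof (rule real_sqrt_unique)
    show "(exp (- ((x + 2 * x\<^sup>2) / 2)))\<^sup>2 = exp (- x - 2 * x\<^sup>2)"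
      unfolding power2_eq_square[of "exp _"] exp_add[symmetric] by (rule arg_cong[where f = exp]) simp
  qed simp
  ultimately have "1 / sqrt (1 - x) \<le> 1 / exp (- ((x + 2 * x\<^sup>2) / 2))"
    using assms by (intro divide_left_mono) auto
  then have "1 / sqrt (1 - x) \<le> exp ((x + 2 * x\<^sup>2) / 2)" by (simp add: exp_minus field_simps)
  then have "(1 / sqrt (1 - x)) ^ n \<le> exp ((x + 2 * x\<^sup>2) / 2) ^ n" using assms by (intro power_mono) auto
  then show ?thesis by (simp add: exp_of_nat_mult[symmetric])
qed

text \<open>
  Half of the hypothesis \<open>\<rho>\<^sup>2 \<ge> 16 ln n\<close>, times the surplus \<open>5/8 - 1/2 = 1/8\<close> in the exponent, would give one
  factor \<open>1/n\<close>; all of it gives \<open>1/n\<^sup>2\<close>. One of them is lost in a union bound over the coordinates, the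
  other one absorbs constants.
\<close>
lemma tail_absorb:
  assumes n: "n \<ge> (1::nat)" and \<rho>: "16 * ln (real n) \<le> \<rho>\<^sup>2"
  shows "exp (- (5/8) * \<rho>\<^sup>2) \<le> exp (- \<rho>\<^sup>2 / 2) / (real n)\<^sup>2"
proof -
  have "exp (- (5/8) * \<rho>\<^sup>2) \<le> exp (- \<rho>\<^sup>2 / 2 + - (2 * ln (real n)))"
    using \<rho> by (subst exp_le_cancel_iff) simp
  also have "\<dots> = exp (- \<rho>\<^sup>2 / 2) / (real n)\<^sup>2"
  proof -
    have "exp (- (2 * ln (real n))) = inverse (exp (ln (real n)) * exp (ln (real n)))"
      unfolding exp_minus exp_add[symmetric] by simp
    also have "\<dots> = inverse ((real n)\<^sup>2)" using n by (simp only: exp_ln of_nat_0_less_iff power2_eq_square)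
    finally show ?thesis unfolding exp_add by (simp only: divide_inverse)
  qed
  finally show ?thesis .
qed

text \<open>
  The \<open>k\<close>-th power of the growth bound is \<open>C^k\<close> times an exponential moment of \<open>x = b k / n\<close>, which equals
  \<open>(1 - x)^(-n/2)\<close> and so is at most \<open>e^(b k/2 + b^2 k^2/n)\<close>. The condition \<open>b m + b^2 m^2 \<le> n\<close> keeps
  the second term at most \<open>1\<close>, and for \<open>n \<ge> 144\<close> it also forces \<open>x \<le> 1/12\<close>, within the range of the tail
  bounds.
\<close>
lemma moment_bounds:
  assumes n: "n \<ge> 144" and \<rho>: "\<rho> \<ge> 0" "16 * ln (real n) \<le> \<rho>\<^sup>2"
    and k: "1 \<le> k" "k \<le> m" and b: "b \<ge> 0" "b * real m + b\<^sup>2 * (real m)\<^sup>2 \<le> real n" and C: "C \<ge> 0"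
    and Z: "AE z in gauss_pi n. z \<in> B \<longrightarrow> \<bar>Z z\<bar> \<le> C * exp (b * (\<Sum>i<n. (z i)\<^sup>2) / n)"
    and B: "B \<subseteq> space (gauss_pi n)"
  defines "s \<equiv> C * exp (b / 2 + b\<^sup>2 * real m / real n)"
  shows "(\<integral>\<^sup>+z. ennreal \<bar>Z z ^ k\<bar> * indicator B z \<partial>gauss_pi n) \<le> ennreal (s ^ k)"
    and "(\<integral>\<^sup>+z. ennreal \<bar>Z z ^ k\<bar> * indicator (B - cube n \<rho>) z \<partial>gauss_pi n) \<le> ennreal (s ^ k * (2 / real n * exp (- \<rho>\<^sup>2 / 2)))"
proof -
  define x where "x = b * real k / real n"
  have n0: "real n > 0" using n by simp
  have bm: "b * real m \<le> real n / 12"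
  proof -
    have "0 \<le> b * real m" using b by simp
    then have "(b * real m)\<^sup>2 \<le> real n" unfolding power_mult_distrib using b(2) by linarith
    also have "\<dots> \<le> (real n / 12)\<^sup>2"
      using n by (simp add: power2_eq_square field_simps)
    finally show ?thesis by (rule power2_le_imp_le) simp
  qed
  have bk: "b * real k \<le> b * real m" using k b by (intro mult_left_mono) auto
  have x: "0 \<le> x" "x \<le> 1 / 8"
    using b n0 bk bm by (auto simp: x_def divide_le_eq)
  define q where "q = (1 / sqrt (1 - x)) ^ n"
  have sk: "C ^ k * q \<le> s ^ k"
  proof -
    have "q \<le> exp (n * (x + 2 * x\<^sup>2) / 2)" unfolding q_def using x by (intro inverse_sqrt_power_le) auto
    also have "n * (x + 2 * x\<^sup>2) / 2 = b * real k / 2 + b\<^sup>2 * real k * real k / real n"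
      using n0 by (simp add: x_def field_simps power2_eq_square)
    also have "exp \<dots> \<le> exp (real k * (b / 2 + b\<^sup>2 * real m / real n))"
    proof (subst exp_le_cancel_iff)
      have "b\<^sup>2 * real k * real k / real n \<le> b\<^sup>2 * real k * real m / real n"
        using k n0 by (intro divide_right_mono mult_left_mono) auto
      then show "b * real k / 2 + b\<^sup>2 * real k * real k / real n \<le> real k * (b / 2 + b\<^sup>2 * real m / real n)"
        by (simp add: algebra_simps)
    qed
    also have "\<dots> = exp (b / 2 + b\<^sup>2 * real m / real n) ^ k" by (simp add: exp_of_nat_mult)
    finally show ?thesis using C by (simp add: s_def power_mult_distrib mult_left_mono)
  qed
  have dom: "AE z in gauss_pi n. ennreal \<bar>Z z ^ k\<bar> * indicator X z \<le> ennreal (C ^ k) * (ennreal (exp (x * (\<Sum>i<n. (z i)\<^sup>2))) * indicator X z)"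
    if "X \<subseteq> B" for X
    using Z
  proof eventually_elim
    fix z assume z: "z \<in> B \<longrightarrow> \<bar>Z z\<bar> \<le> C * exp (b * (\<Sum>i<n. (z i)\<^sup>2) / n)"
    show "ennreal \<bar>Z z ^ k\<bar> * indicator X z \<le> ennreal (C ^ k) * (ennreal (exp (x * (\<Sum>i<n. (z i)\<^sup>2))) * indicator X z)"
    proof (cases "z \<in> X")
      case True
      then have "\<bar>Z z\<bar> ^ k \<le> (C * exp (b * (\<Sum>i<n. (z i)\<^sup>2) / n)) ^ k"
        using z that by (intro power_mono) auto
      also have "\<dots> = C ^ k * exp (x * (\<Sum>i<n. (z i)\<^sup>2))"
        by (simp add: power_mult_distrib exp_of_nat_mult[symmetric] x_def mult_ac)
      finally show ?thesis using True C by (simp add: power_abs ennreal_mult[symmetric] ennreal_leI)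
    qed simp
  qed
  have meas: "(\<lambda>z. ennreal (exp (x * (\<Sum>i<n. (z i)\<^sup>2)))) \<in> borel_measurable (gauss_pi n)"
  proof -
    have [measurable]: "(\<lambda>z. \<Sum>i<n. (z i)\<^sup>2) \<in> borel_measurable (gauss_pi n)"
      using measurable_component_singleton[of _ "{..<n}" "\<lambda>_. gauss1"]
      by (intro borel_measurable_sum borel_measurable_power) (simp cong: measurable_cong_sets)
    show ?thesis by measurable
  qed
  have "(\<integral>\<^sup>+z. ennreal \<bar>Z z ^ k\<bar> * indicator B z \<partial>gauss_pi n) \<le> (\<integral>\<^sup>+z. ennreal (C ^ k) * ennreal (exp (x * (\<Sum>i<n. (z i)\<^sup>2))) \<partial>gauss_pi n)"
  proof (rule nn_integral_mono_AE)
    show "AE z in gauss_pi n. ennreal \<bar>Z z ^ k\<bar> * indicator B z \<le> ennreal (C ^ k) * ennreal (exp (x * (\<Sum>i<n. (z i)\<^sup>2)))"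
      using dom[OF order_refl] by eventually_elim (auto simp: indicator_def split: if_splits)
  qed
  also have "\<dots> = ennreal (C ^ k) * ennreal q"
    using x unfolding q_def by (subst nn_integral_cmult[OF meas]) (simp add: nn_integral_gauss_pi_exp)
  also have "\<dots> = ennreal (C ^ k * q)" using C x by (simp add: ennreal_mult q_def)
  also have "\<dots> \<le> ennreal (s ^ k)" by (rule ennreal_leI[OF sk])
  finally show "(\<integral>\<^sup>+z. ennreal \<bar>Z z ^ k\<bar> * indicator B z \<partial>gauss_pi n) \<le> ennreal (s ^ k)" .
  have "(\<integral>\<^sup>+z. ennreal \<bar>Z z ^ k\<bar> * indicator (B - cube n \<rho>) z \<partial>gauss_pi n)
     \<le> (\<integral>\<^sup>+z. ennreal (C ^ k) * (ennreal (exp (x * (\<Sum>i<n. (z i)\<^sup>2))) * indicator (space (gauss_pi n) - cube n \<rho>) z) \<partial>gauss_pi n)"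
  proof (rule nn_integral_mono_AE)
    show "AE z in gauss_pi n. ennreal \<bar>Z z ^ k\<bar> * indicator (B - cube n \<rho>) z \<le>
      ennreal (C ^ k) * (ennreal (exp (x * (\<Sum>i<n. (z i)\<^sup>2))) * indicator (space (gauss_pi n) - cube n \<rho>) z)"
      using dom[of "B - cube n \<rho>", OF Diff_subset] by eventually_elim (use B in \<open>auto simp: indicator_def split: if_splits\<close>)
  qed
  also have "\<dots> = ennreal (C ^ k) * (\<integral>\<^sup>+z. ennreal (exp (x * (\<Sum>i<n. (z i)\<^sup>2))) * indicator (space (gauss_pi n) - cube n \<rho>) z \<partial>gauss_pi n)"
    using meas by (intro nn_integral_cmult) measurable
  also have "\<dots> \<le> ennreal (C ^ k) * ennreal (n * (2 * exp (- (5/8) * \<rho>\<^sup>2) * q))"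
    unfolding q_def by (intro mult_left_mono nn_integral_gauss_pi_outside_box x \<rho>) simp
  also have "\<dots> = ennreal ((C ^ k * q) * (n * (2 * exp (- (5/8) * \<rho>\<^sup>2))))"
    using C x by (simp add: ennreal_mult[symmetric] q_def mult_ac)
  also have "\<dots> \<le> ennreal (s ^ k * (2 / real n * exp (- \<rho>\<^sup>2 / 2)))"
  proof (rule ennreal_leI, rule mult_mono[OF sk])
    have "n * (2 * exp (- (5/8) * \<rho>\<^sup>2)) \<le> n * (2 * (exp (- \<rho>\<^sup>2 / 2) / (real n)\<^sup>2))"
      using tail_absorb[OF _ \<rho>(2)] n by (intro mult_left_mono) auto
    also have "\<dots> = 2 / real n * exp (- \<rho>\<^sup>2 / 2)" using n0 by (simp add: power2_eq_square)
    finally show "n * (2 * exp (- (5/8) * \<rho>\<^sup>2)) \<le> 2 / real n * exp (- \<rho>\<^sup>2 / 2)" .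
  qed (use C in \<open>auto simp: s_def\<close>)
  finally show "(\<integral>\<^sup>+z. ennreal \<bar>Z z ^ k\<bar> * indicator (B - cube n \<rho>) z \<partial>gauss_pi n) \<le> ennreal (s ^ k * (2 / real n * exp (- \<rho>\<^sup>2 / 2)))" .
qed

lemma gauss_pi_box_complement:
  assumes n: "n \<ge> 144" and \<rho>: "\<rho> \<ge> 0" "16 * ln (real n) \<le> \<rho>\<^sup>2"
  shows "1 - measure (gauss_pi n) (cube n \<rho>) \<le> 2 / real n * exp (- \<rho>\<^sup>2 / 2)"
    and "measure (gauss_pi n) (cube n \<rho>) \<ge> 1 / 2"
proof -
  interpret prob_space "gauss_pi n" by (rule prob_space_gauss_pi)
  have "emeasure (gauss_pi n) (space (gauss_pi n) - cube n \<rho>) = (\<integral>\<^sup>+z. indicator (space (gauss_pi n) - cube n \<rho>) z \<partial>gauss_pi n)"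
    by (rule nn_integral_indicator[symmetric]) measurable
  also have "\<dots> = (\<integral>\<^sup>+z. ennreal (exp (0 * (\<Sum>i<n. (z i)\<^sup>2))) * indicator (space (gauss_pi n) - cube n \<rho>) z \<partial>gauss_pi n)" by simp
  also have "\<dots> \<le> ennreal (n * (2 * exp (- (5/8) * \<rho>\<^sup>2) * (1 / sqrt (1 - 0)) ^ n))"
    by (rule nn_integral_gauss_pi_outside_box) (use \<rho> in auto)
  finally have "prob (space (gauss_pi n) - cube n \<rho>) \<le> n * (2 * exp (- (5/8) * \<rho>\<^sup>2))"
    by (simp add: emeasure_eq_measure ennreal_le_iff)
  also have "\<dots> \<le> n * (2 * (exp (- \<rho>\<^sup>2 / 2) / (real n)\<^sup>2))"
    using tail_absorb[OF _ \<rho>(2)] n by (intro mult_left_mono) auto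
  also have "\<dots> = 2 / real n * exp (- \<rho>\<^sup>2 / 2)" using n by (simp add: power2_eq_square)
  finally show 1: "1 - measure (gauss_pi n) (cube n \<rho>) \<le> 2 / real n * exp (- \<rho>\<^sup>2 / 2)"
    by (simp add: prob_compl)
  have "2 / real n * exp (- \<rho>\<^sup>2 / 2) \<le> 2 / real n * 1" by (intro mult_left_mono) auto
  also have "\<dots> \<le> 1 / 2" using n by (simp add: divide_le_eq)
  finally show "measure (gauss_pi n) (cube n \<rho>) \<ge> 1 / 2" using 1 by linarith
qed

text \<open>
  The coefficient of \<open>t^r\<close> is the \<open>r\<close>-th cumulant of \<open>Z\<close> conditioned on \<open>B\<close>, divided by \<open>r!\<close>.
\<close>
definition cond_cumulants :: "'a measure \<Rightarrow> 'a set \<Rightarrow> ('a \<Rightarrow> real) \<Rightarrow> real fps" where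
  "cond_cumulants M B Z = fln (Abs_fps (\<lambda>r. cond_mean M B (\<lambda>z. Z z ^ r) / fact r) - 1)"

text \<open>
  Outside the cube the moments carry only a fraction \<open>T = (2/n) e^(-\<rho>^2/2)\<close> of their bound, so
  conditioning on the cube perturbs them by \<open>6 T s^r\<close>, and \<open>cumulant_difference_bound\<close> turns this into a
  bound on cumulants. Its factor \<open>2^r\<close> and the \<open>2^r\<close> from \<open>2 s^r \<le> (2 s)^r\<close> sum up to \<open>(4/3) 4^m\<close>, and
  the constants multiply to \<open>144\<close>, which is at most \<open>n\<close>. The lemma is applied twice, to a larger cube and
  to the whole space in the role of \<open>B\<close>.
\<close>
lemma cumulants_box_compare:
  assumes n: "n \<ge> 144" and m: "m \<ge> 1" and \<rho>: "\<rho> \<ge> 0" "16 * ln (real n) \<le> \<rho>\<^sup>2"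
    and b: "b \<ge> 0" "b * real m + b\<^sup>2 * (real m)\<^sup>2 \<le> real n" and C: "C \<ge> 0"
    and Zm: "Z \<in> borel_measurable (gauss_pi n)"
    and Z: "AE z in gauss_pi n. z \<in> B \<longrightarrow> \<bar>Z z\<bar> \<le> C * exp (b * (\<Sum>i<n. (z i)\<^sup>2) / n)"
    and B: "B \<in> sets (gauss_pi n)" "cube n \<rho> \<subseteq> B"
  shows "\<bar>(\<Sum>r=1..m. fps_nth (cond_cumulants (gauss_pi n) (cube n \<rho>) Z) r) - (\<Sum>r=1..m. fps_nth (cond_cumulants (gauss_pi n) B Z) r)\<bar>
    \<le> 6 ^ m * ((C ^ m + C) * exp (- (\<rho>\<^sup>2 - b * real m) / 2))"
proof -
  interpret prob_space "gauss_pi n" by (rule prob_space_gauss_pi)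
  define T where "T = 2 / real n * exp (- \<rho>\<^sup>2 / 2)"
  define c where "c = b / 2 + b\<^sup>2 * real m / real n"
  define s where "s = C * exp c"
  have s0: "s \<ge> 0" and T0: "T \<ge> 0" using C by (auto simp: s_def T_def)
  have n0: "real n > 0" using n by simp
  have Bs: "B \<subseteq> space (gauss_pi n)" using B(1) by (rule sets.sets_into_space)
  note bc = gauss_pi_box_complement[OF n \<rho>]
  have pB: "prob B > 0" using bc(2) finite_measure_mono[OF B(2) B(1)] by linarith
  have cm: "\<bar>cond_mean (gauss_pi n) (cube n \<rho>) (\<lambda>z. Z z ^ r)\<bar> \<le> 2 * s ^ r"
      "\<bar>cond_mean (gauss_pi n) B (\<lambda>z. Z z ^ r)\<bar> \<le> 2 * s ^ r"
      "\<bar>cond_mean (gauss_pi n) (cube n \<rho>) (\<lambda>z. Z z ^ r) - cond_mean (gauss_pi n) B (\<lambda>z. Z z ^ r)\<bar> \<le> 6 * T * s ^ r"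
    if r: "1 \<le> r" "r \<le> m" for r
  proof -
    have Zr: "(\<lambda>z. Z z ^ r) \<in> borel_measurable (gauss_pi n)" using Zm by measurable
    note mb = moment_bounds[OF n \<rho> r b C Z Bs, folded c_def, folded s_def, folded T_def]
    note cc = cond_mean_compare[OF cube_sets B(1,2) Zr _ T0 mb(1) mb(2) _ bc(2)]
    have "s ^ r \<ge> 0" using s0 by simp
    then show "\<bar>cond_mean (gauss_pi n) (cube n \<rho>) (\<lambda>z. Z z ^ r)\<bar> \<le> 2 * s ^ r"
      "\<bar>cond_mean (gauss_pi n) B (\<lambda>z. Z z ^ r)\<bar> \<le> 2 * s ^ r"
      "\<bar>cond_mean (gauss_pi n) (cube n \<rho>) (\<lambda>z. Z z ^ r) - cond_mean (gauss_pi n) B (\<lambda>z. Z z ^ r)\<bar> \<le> 6 * T * s ^ r"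
      using cc bc(1) by (simp_all add: T_def)
  qed
  have two: "2 * s ^ r \<le> (2 * s) ^ r" "s ^ r \<le> (2 * s) ^ r" if "1 \<le> r" for r
  proof -
    have "(2::real) ^ 1 \<le> 2 ^ r" using that by (intro power_increasing) auto
    then show "2 * s ^ r \<le> (2 * s) ^ r" using s0 by (simp add: power_mult_distrib mult_right_mono)
    moreover have "s ^ r \<ge> 0" using s0 by simp
    ultimately show "s ^ r \<le> (2 * s) ^ r" by linarith
  qed
  have zero: "cond_mean (gauss_pi n) X (\<lambda>z. Z z ^ 0) = 1" if "X \<in> sets (gauss_pi n)" "prob X > 0" for X
    using that by (simp add: cond_mean_def)
  let ?K = "\<lambda>X r. fps_nth (cond_cumulants (gauss_pi n) X Z) r"
  have diff: "\<bar>?K (cube n \<rho>) r - ?K B r\<bar> \<le> 18 * T * ((C ^ m + C) * (3 * exp (b * real m / 2))) * 4 ^ r" if r: "1 \<le> r" "r \<le> m" for r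
  proof -
    have "real r * \<bar>?K (cube n \<rho>) r - ?K B r\<bar> \<le> 3 * (6 * T) * (2 ^ r * (2 * s) ^ r)"
      unfolding cond_cumulants_def
    proof (rule cumulant_difference_bound[OF _ _ _ _ _ _ _ r])
      show "cond_mean (gauss_pi n) (cube n \<rho>) (\<lambda>z. Z z ^ 0) = 1" using bc(2) by (intro zero) auto
      show "cond_mean (gauss_pi n) B (\<lambda>z. Z z ^ 0) = 1" using pB B by (intro zero) auto
      show "\<bar>cond_mean (gauss_pi n) (cube n \<rho>) (\<lambda>z. Z z ^ r)\<bar> \<le> (2 * s) ^ r" if "1 \<le> r" "r \<le> m" for r
        using cm(1)[OF that] two(1)[OF that(1)] by linarith
      show "\<bar>cond_mean (gauss_pi n) B (\<lambda>z. Z z ^ r)\<bar> \<le> (2 * s) ^ r" if "1 \<le> r" "r \<le> m" for r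
        using cm(2)[OF that] two(1)[OF that(1)] by linarith
      show "\<bar>cond_mean (gauss_pi n) (cube n \<rho>) (\<lambda>z. Z z ^ r) - cond_mean (gauss_pi n) B (\<lambda>z. Z z ^ r)\<bar> \<le> 6 * T * (2 * s) ^ r"
        if "1 \<le> r" "r \<le> m" for r
        using cm(3)[OF that] mult_left_mono[OF two(2)[OF that(1)], of "6 * T"] T0 by linarith
    qed (use s0 T0 in auto)
    moreover have "1 * \<bar>?K (cube n \<rho>) r - ?K B r\<bar> \<le> real r * \<bar>?K (cube n \<rho>) r - ?K B r\<bar>"
      using r by (intro mult_right_mono) auto
    ultimately have "\<bar>?K (cube n \<rho>) r - ?K B r\<bar> \<le> 18 * T * (2 ^ r * (2 * s) ^ r)" by simp
    also have "2 ^ r * (2 * s) ^ r = s ^ r * 4 ^ r"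
    proof -
      have four: "(4::real) = 2 * 2" by simp
      show ?thesis unfolding four power_mult_distrib by (simp only: mult_ac)
    qed
    also have "18 * T * (s ^ r * 4 ^ r) \<le> 18 * T * (((C ^ m + C) * (3 * exp (b * real m / 2))) * 4 ^ r)"
    proof (intro mult_left_mono mult_right_mono)
      have "C ^ r \<le> C ^ m + C"
      proof (cases "C \<le> 1")
        case True
        then have "C ^ r \<le> C ^ 1" using C r by (intro power_decreasing) auto
        then show ?thesis using C by (simp add: add_increasing)
      next
        case False
        then have "C ^ r \<le> C ^ m" using r by (intro power_increasing) auto
        then show ?thesis using C by simp
      qed
      moreover have "exp c ^ r \<le> 3 * exp (b * real m / 2)"
      proof -
        have c0: "c \<ge> 0" using b n0 by (simp add: c_def)
        have "exp c ^ r = exp (real r * c)" by (simp add: exp_of_nat_mult)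
        also have "\<dots> \<le> exp (b * real m / 2 + 1)"
        proof (subst exp_le_cancel_iff)
          have "real r * c \<le> real m * c" using r c0 by (intro mult_right_mono) auto
          also have "real m * c = b * real m / 2 + b\<^sup>2 * (real m)\<^sup>2 / real n"
            by (simp add: c_def field_simps power2_eq_square)
          finally have 1: "real r * c \<le> b * real m / 2 + b\<^sup>2 * (real m)\<^sup>2 / real n" .
          have "0 \<le> b * real m" using b by simp
          then have "b\<^sup>2 * (real m)\<^sup>2 \<le> real n" using b(2) by linarith
          then have "b\<^sup>2 * (real m)\<^sup>2 / real n \<le> 1" using n0 by (simp only: pos_divide_le_eq mult_1)
          then show "real r * c \<le> b * real m / 2 + 1" using 1 by linarith
        qed
        also have "\<dots> \<le> exp (b * real m / 2) * 3"
          unfolding exp_add using exp_le by (intro mult_left_mono) auto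
        finally show ?thesis by simp
      qed
      ultimately show "s ^ r \<le> (C ^ m + C) * (3 * exp (b * real m / 2))"
        unfolding s_def power_mult_distrib using C by (intro mult_mono) auto
    qed (use T0 in auto)
    finally show ?thesis by (simp add: mult_ac)
  qed
  have "\<bar>(\<Sum>r=1..m. ?K (cube n \<rho>) r) - (\<Sum>r=1..m. ?K B r)\<bar> \<le> (\<Sum>r=1..m. \<bar>?K (cube n \<rho>) r - ?K B r\<bar>)"
    unfolding sum_subtractf[symmetric] by (rule sum_abs)
  also have "\<dots> \<le> (\<Sum>r=1..m. 18 * T * ((C ^ m + C) * (3 * exp (b * real m / 2))) * 4 ^ r)"
    by (intro sum_mono diff) auto
  also have "\<dots> = 18 * T * ((C ^ m + C) * (3 * exp (b * real m / 2))) * (\<Sum>r=1..m. 4 ^ r)"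
    by (simp add: sum_distrib_left)
  also have "\<dots> \<le> 18 * T * ((C ^ m + C) * (3 * exp (b * real m / 2))) * (4 * 4 ^ m / 3)"
  proof (rule mult_left_mono)
    show "(\<Sum>r=1..m. 4 ^ r) \<le> 4 * (4::real) ^ m / 3" by (induction m) auto
  qed (use T0 C in auto)
  also have "\<dots> = (144 / real n) * (4 ^ m * ((C ^ m + C) * (exp (- \<rho>\<^sup>2 / 2) * exp (b * real m / 2))))"
    using n0 by (simp add: T_def)
  also have "\<dots> \<le> 1 * (6 ^ m * ((C ^ m + C) * (exp (- \<rho>\<^sup>2 / 2) * exp (b * real m / 2))))"
    using n n0 C by (intro mult_mono power_mono) auto
  also have "exp (- \<rho>\<^sup>2 / 2) * exp (b * real m / 2) = exp (- (\<rho>\<^sup>2 - b * real m) / 2)"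
    by (simp add: exp_add[symmetric] diff_divide_distrib add_divide_distrib[symmetric])
  finally show ?thesis by simp
qed

section \<open>Gaussian integrals over nearly cubic domains\<close>

text \<open>
  Conditioning a product law on a cube keeps the coordinates independent.
\<close>
lemma PiM_uniform_measure_gauss:
  assumes pos: "measure gauss1 {-\<rho>..\<rho>} > 0"
  shows "PiM {..<n} (\<lambda>_. uniform_measure gauss1 {-\<rho>..\<rho>}) = uniform_measure (gauss_pi n) (cube n \<rho>)"
proof -
  interpret g: prob_space gauss1 by (rule prob_space_gauss1)
  define I where "I = {-\<rho>..\<rho>}"
  define U where "U = uniform_measure gauss1 I"
  have I: "I \<in> sets gauss1" by (simp add: I_def)
  have e0: "emeasure gauss1 I \<noteq> 0" using pos by (simp add: g.emeasure_eq_measure I_def)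
  have pU: "prob_space U" unfolding U_def using e0 by (intro prob_space_uniform_measure) (auto simp: g.emeasure_eq_measure)
  interpret U: product_sigma_finite "\<lambda>_::nat. U"
    by (rule product_sigma_finite.intro, rule prob_space_imp_sigma_finite, rule pU)
  interpret gg: product_sigma_finite "\<lambda>_::nat. gauss1"
    by (rule product_sigma_finite.intro, rule prob_space_imp_sigma_finite, rule prob_space_gauss1)
  have sU: "sets U = sets gauss1" by (simp add: U_def)
  have cube: "cube n \<rho> = PiE {..<n} (\<lambda>_. I)"
  proof -
    have "\<bar>t\<bar> \<le> \<rho> \<longleftrightarrow> t \<in> I" for t :: real by (auto simp: I_def)
    then have "z \<in> cube n \<rho> \<longleftrightarrow> z \<in> PiE {..<n} (\<lambda>_. I)" for z
      unfolding cube_def mem_Collect_eq PiE_iff by auto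
    then show ?thesis by blast
  qed
  have "uniform_measure (gauss_pi n) (cube n \<rho>) = PiM {..<n} (\<lambda>_. U)"
  proof (rule U.PiM_eqI)
    show "sets (uniform_measure (gauss_pi n) (cube n \<rho>)) = sets (PiM {..<n} (\<lambda>_. U))"
      unfolding sets_uniform_measure by (rule sets_PiM_cong) (auto simp: sU)
    fix X :: "nat \<Rightarrow> real set" assume "\<And>i. i \<in> {..<n} \<Longrightarrow> X i \<in> sets U"
    then have X: "X i \<in> sets gauss1" if "i < n" for i using that by (simp add: sU)
    have XP: "PiE {..<n} X \<in> sets (gauss_pi n)" using X by (intro sets_PiM_I_finite) auto
    have "cube n \<rho> \<inter> PiE {..<n} X = PiE {..<n} (\<lambda>i. I \<inter> X i)"
      unfolding cube PiE_Int by simp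
    then have "emeasure (uniform_measure (gauss_pi n) (cube n \<rho>)) (PiE {..<n} X)
       = emeasure (gauss_pi n) (PiE {..<n} (\<lambda>i. I \<inter> X i)) / emeasure (gauss_pi n) (PiE {..<n} (\<lambda>_. I))"
      using XP by (subst emeasure_uniform_measure) (auto simp: cube[symmetric])
    also have "\<dots> = (\<Prod>i<n. emeasure gauss1 (I \<inter> X i)) / (\<Prod>i<n. emeasure gauss1 I)"
      using X I by (subst (1 2) gg.emeasure_PiM) auto
    also have "\<dots> = ennreal (\<Prod>i<n. g.prob (I \<inter> X i)) / ennreal (\<Prod>i<n. g.prob I)"
      by (simp add: g.emeasure_eq_measure prod_ennreal ennreal_power)
    also have "\<dots> = ennreal ((\<Prod>i<n. g.prob (I \<inter> X i)) / (\<Prod>i<n. g.prob I))"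
      using pos by (intro divide_ennreal prod_nonneg prod_pos) (auto simp: I_def)
    also have "(\<Prod>i<n. g.prob (I \<inter> X i)) / (\<Prod>i<n. g.prob I) = (\<Prod>i<n. g.prob (I \<inter> X i) / g.prob I)"
      by (rule prod_dividef[symmetric])
    also have "ennreal \<dots> = (\<Prod>i<n. ennreal (g.prob (I \<inter> X i) / g.prob I))"
      by (rule prod_ennreal[symmetric]) simp
    also have "\<dots> = (\<Prod>i<n. emeasure U (X i))"
    proof (intro prod.cong refl)
      fix i assume "i \<in> {..<n}"
      then have "emeasure U (X i) = emeasure gauss1 (I \<inter> X i) / emeasure gauss1 I"
        unfolding U_def using X I by (intro emeasure_uniform_measure) auto
      also have "\<dots> = ennreal (g.prob (I \<inter> X i) / g.prob I)"
        unfolding g.emeasure_eq_measure using pos by (intro divide_ennreal) (auto simp: I_def)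
      finally show "ennreal (g.prob (I \<inter> X i) / g.prob I) = emeasure U (X i)" ..
    qed
    finally show "emeasure (uniform_measure (gauss_pi n) (cube n \<rho>)) (PiE {..<n} X) = (\<Prod>i<n. emeasure U (X i))" .
  qed simp
  then show ?thesis by (simp add: U_def I_def)
qed

lemma gauss1_tail:
  assumes n: "n \<ge> 144" and \<rho>: "\<rho> \<ge> 0" "16 * ln (real n) \<le> \<rho>\<^sup>2"
  shows "measure gauss1 {t. \<rho> < \<bar>t\<bar>} \<le> 2 / (real n)\<^sup>2 * exp (- \<rho>\<^sup>2 / 2)"
    and "measure gauss1 {-\<rho>..\<rho>} \<ge> 1 / 2"
proof -
  interpret g: prob_space gauss1 by (rule prob_space_gauss1)
  have S: "{t. \<rho> < \<bar>t\<bar>} \<in> sets gauss1" by simp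
  have "emeasure gauss1 {t. \<rho> < \<bar>t\<bar>} = (\<integral>\<^sup>+t. ennreal (exp (0 * t\<^sup>2)) * indicator {t. \<rho> < \<bar>t\<bar>} t \<partial>gauss1)"
    using S by simp
  also have "\<dots> \<le> ennreal (2 * exp (- (5/8) * \<rho>\<^sup>2))" by (rule nn_integral_gauss1_tail) (use \<rho> in auto)
  finally have "g.prob {t. \<rho> < \<bar>t\<bar>} \<le> 2 * exp (- (5/8) * \<rho>\<^sup>2)" by (simp add: g.emeasure_eq_measure)
  also have "\<dots> \<le> 2 * (exp (- \<rho>\<^sup>2 / 2) / (real n)\<^sup>2)"
    using tail_absorb[OF _ \<rho>(2)] n by (intro mult_left_mono) auto
  finally show 1: "g.prob {t. \<rho> < \<bar>t\<bar>} \<le> 2 / (real n)\<^sup>2 * exp (- \<rho>\<^sup>2 / 2)" by simp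
  have "2 / (real n)\<^sup>2 * exp (- \<rho>\<^sup>2 / 2) \<le> 2 / (144::real)\<^sup>2 * 1"
    using n by (intro mult_mono divide_left_mono power_mono) auto
  then have 2: "g.prob {t. \<rho> < \<bar>t\<bar>} \<le> 1 / 2" using 1 by simp
  have "{-\<rho>..\<rho>} = space gauss1 - {t. \<rho> < \<bar>t\<bar>}" by auto
  then have "g.prob {-\<rho>..\<rho>} = 1 - g.prob {t. \<rho> < \<bar>t\<bar>}" using S by (simp only: g.prob_compl)
  then show "g.prob {-\<rho>..\<rho>} \<ge> 1 / 2" using 2 by linarith
qed

lemma ln_lower_bound_near_1:
  fixes y :: real
  assumes "0 \<le> y" "y \<le> 1 / 2"
  shows "- 2 * y \<le> ln (1 - y)"
proof -
  have "- y - 2 * y\<^sup>2 \<le> ln (1 - y)" using assms by (intro ln_one_minus_pos_lower_bound) auto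
  moreover have "2 * y\<^sup>2 \<le> y" using mult_left_mono[of y "1/2" y] assms by (simp add: power2_eq_square)
  ultimately show ?thesis by linarith
qed

lemma mixed_diff_singleton: "mixed_diff {j} y f x = f x - f (x(j := y j))"
  using mixed_diff_insert[of "{}" j y f x] by simp

text \<open>
  With \<open>Q\<close> the cube of radius \<open>\<rho>\<^sub>2\<close>, \<open>p\<close> its probability and \<open>D\<close> the law conditioned on it,
  \<open>J = p E\<^sub>D[1_Om e^g]\<close>. The four terms of the bound come from the cumulant expansion of
  \<open>E\<^sub>D[e^g]\<close>, from \<open>p\<close> and the restriction to \<open>Om\<close> together, and from the two comparisons of cumulants.
  As in \<open>cumulant_expansion_PiM\<close>, \<open>g\<close> carries the pointwise bounds and \<open>g0\<close> is its measurable version.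
\<close>
theorem gaussian_cumulant_expansion:
  fixes g g0 :: "(nat \<Rightarrow> real) \<Rightarrow> real" and d :: "nat set \<Rightarrow> real"
  assumes n: "n \<ge> 144" and m: "m \<ge> 1"
    and g0: "g0 \<in> borel_measurable (gauss_pi n)" and AE: "AE z in gauss_pi n. g z = g0 z"
    and Om: "Om \<in> sets (gauss_pi n)"
    and Om1: "AE z in gauss_pi n. z \<in> cube n \<rho>\<^sub>1 \<longrightarrow> z \<in> Om"
    and Om2: "AE z in gauss_pi n. z \<in> Om \<longrightarrow> z \<in> cube n \<rho>\<^sub>2"
    and \<rho>: "0 \<le> \<rho>\<^sub>1" "\<rho>\<^sub>1 \<le> \<rho>\<^sub>2" "\<rho>\<^sub>2 \<le> \<rho>\<^sub>3" "16 * ln (real n) \<le> \<rho>\<^sub>1\<^sup>2"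
    and d: "\<And>V x y. V \<subseteq> {..<n} \<Longrightarrow> card V \<in> {1..m} \<Longrightarrow> x \<in> cube n \<rho>\<^sub>2 \<Longrightarrow> y \<in> cube n \<rho>\<^sub>2 \<Longrightarrow> \<bar>mixed_diff V y g x\<bar> \<le> d V"
    and alpha: "\<And>l j. l \<in> {1..m} \<Longrightarrow> j < n \<Longrightarrow> (\<Sum>V | V \<subseteq> {..<n} \<and> card V = l \<and> j \<in> V. d V) \<le> \<alpha>"
    and \<alpha>: "0 \<le> \<alpha>" "\<alpha> < 1 / 400"
    and b: "0 \<le> b" "b * real m + b\<^sup>2 * (real m)\<^sup>2 \<le> real n" and C: "0 \<le> C"
    and b': "0 \<le> b'" "b' * real m + b'\<^sup>2 * (real m)\<^sup>2 \<le> real n" and C': "0 \<le> C'"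
    and gb: "\<And>z. z \<in> space (gauss_pi n) \<Longrightarrow> \<bar>g z\<bar> \<le> C * exp (b * (\<Sum>i<n. (z i)\<^sup>2) / n)"
    and gb': "\<And>z. z \<in> cube n \<rho>\<^sub>3 \<Longrightarrow> \<bar>g z\<bar> \<le> C' * exp (b' * (\<Sum>i<n. (z i)\<^sup>2) / n)"
  defines "J \<equiv> (\<integral>z. indicator Om z * exp (g0 z) \<partial>gauss_pi n)"
  shows "J > 0 \<and> \<bar>ln J - (\<Sum>r=1..m. fps_nth (fln (moment_series (gauss_pi n) g0 - 1)) r)\<bar>
      \<le> 2 * real n * (100 * \<alpha>) ^ (m + 1) + exp (- \<rho>\<^sub>1\<^sup>2 / 2)
          + 6 ^ m * ((C ^ m + C) * exp (- (\<rho>\<^sub>3\<^sup>2 - b * real m) / 2)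
                   + (C' ^ m + C') * exp (- (\<rho>\<^sub>1\<^sup>2 - b' * real m) / 2))"
proof -
  define G where "G = gauss_pi n"
  interpret G: prob_space G unfolding G_def by (rule prob_space_gauss_pi)
  interpret g1: prob_space gauss1 by (rule prob_space_gauss1)
  have n0: "real n > 0" using n by simp
  have r2: "\<rho>\<^sub>2 \<ge> 0" "\<rho>\<^sub>1\<^sup>2 \<le> \<rho>\<^sub>2\<^sup>2" "16 * ln (real n) \<le> \<rho>\<^sub>2\<^sup>2"
    using \<rho> power_mono[of \<rho>\<^sub>1 \<rho>\<^sub>2 2] by linarith+
  have r3: "\<rho>\<^sub>3 \<ge> 0" "16 * ln (real n) \<le> \<rho>\<^sub>3\<^sup>2"
    using \<rho> r2 power_mono[of \<rho>\<^sub>2 \<rho>\<^sub>3 2] by linarith+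
  define e1 where "e1 = exp (- \<rho>\<^sub>1\<^sup>2 / 2)"
  have e1: "0 < e1" "e1 \<le> 1" by (auto simp: e1_def)
  have e2: "exp (- \<rho>\<^sub>2\<^sup>2 / 2) \<le> e1" using r2 by (simp add: e1_def)
  define Q where "Q = cube n \<rho>\<^sub>2"
  have Qs: "Q \<in> sets G" by (simp add: Q_def G_def cube_sets)
  define p where "p = G.prob Q"
  have p: "1 - p \<le> 2 / real n * e1" "p \<ge> 1 / 2" "p \<le> 1"
  proof -
    have "1 - p \<le> 2 / real n * exp (- \<rho>\<^sub>2\<^sup>2 / 2)"
      unfolding p_def Q_def G_def by (rule gauss_pi_box_complement(1)[OF n r2(1,3)])
    also have "\<dots> \<le> 2 / real n * e1" using e2 by (intro mult_left_mono) auto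
    finally show "1 - p \<le> 2 / real n * e1" .
    show "p \<ge> 1 / 2" unfolding p_def Q_def G_def by (rule gauss_pi_box_complement(2)[OF n r2(1,3)])
    show "p \<le> 1" by (simp add: p_def)
  qed
  define \<mu> where "\<mu> = uniform_measure gauss1 {-\<rho>\<^sub>2..\<rho>\<^sub>2}"
  have half: "g1.prob {-\<rho>\<^sub>2..\<rho>\<^sub>2} \<ge> 1 / 2" by (rule gauss1_tail(2)[OF n r2(1,3)])
  have p\<mu>: "prob_space \<mu>"
    unfolding \<mu>_def using half by (intro prob_space_uniform_measure) (auto simp: g1.emeasure_eq_measure)
  define D where "D = PiM {..<n} (\<lambda>_. \<mu>)"
  have D: "D = uniform_measure G Q"
    unfolding D_def \<mu>_def G_def Q_def using half by (intro PiM_uniform_measure_gauss) linarith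
  interpret D: prob_space D unfolding D_def by (rule prob_space_PiM) (rule p\<mu>)
  have sD: "sets D = sets G" and spD: "space D = space G" by (simp_all add: D)
  have mD: "u \<in> borel_measurable D \<longleftrightarrow> u \<in> borel_measurable G" for u :: "_ \<Rightarrow> real"
    by (rule measurable_cong_sets[THEN eqset_imp_iff]) (simp_all add: sD)
  have ID: "(\<integral>z. u z \<partial>D) = cond_mean G Q u" if "u \<in> borel_measurable G" for u
    unfolding D using that p Qs by (intro G.integral_uniform_measure_eq_cond_mean) (auto simp: p_def)

  \<comment> \<open>Almost surely \<open>g0\<close> inherits the bound \<open>Bd\<close> of \<open>g\<close> on \<open>Q\<close>. Replacing it by \<open>0\<close> elsewhere makes it
    bounded everywhere and does not affect integrals against \<open>D\<close>.\<close>
  define Bd where "Bd = C * exp (b * \<rho>\<^sub>2\<^sup>2)"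
  have Bd0: "Bd \<ge> 0" using C by (simp add: Bd_def)
  define f where "f z = (if z \<in> Q \<and> \<bar>g0 z\<bar> \<le> Bd then g0 z else 0)" for z
  have g0G[measurable]: "g0 \<in> borel_measurable G" using g0 by (simp add: G_def)
  have [measurable]: "Q \<in> sets G" by (rule Qs)
  have fG[measurable]: "f \<in> borel_measurable G" unfolding f_def by measurable
  have fB: "\<bar>f z\<bar> \<le> Bd" for z using Bd0 by (simp add: f_def)
  have gQ: "\<bar>g z\<bar> \<le> Bd" if z: "z \<in> Q" for z
  proof -
    have zs: "z \<in> space (gauss_pi n)" using z by (simp add: Q_def cube_def space_gauss_pi)
    have "(\<Sum>i<n. (z i)\<^sup>2) \<le> (\<Sum>i<n. \<rho>\<^sub>2\<^sup>2)"
    proof (rule sum_mono)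
      fix i assume "i \<in> {..<n}"
      then have "\<bar>z i\<bar> \<le> \<rho>\<^sub>2" using z by (simp add: Q_def cube_def)
      then show "(z i)\<^sup>2 \<le> \<rho>\<^sub>2\<^sup>2" using power_mono[of "\<bar>z i\<bar>" \<rho>\<^sub>2 2] by simp
    qed
    then have "b * (\<Sum>i<n. (z i)\<^sup>2) / n \<le> b * (n * \<rho>\<^sub>2\<^sup>2) / n"
      using b n0 by (intro divide_right_mono mult_left_mono) auto
    then have "b * (\<Sum>i<n. (z i)\<^sup>2) / n \<le> b * \<rho>\<^sub>2\<^sup>2" using n0 by simp
    then have "C * exp (b * (\<Sum>i<n. (z i)\<^sup>2) / n) \<le> Bd"
      unfolding Bd_def using C by (intro mult_left_mono) auto
    then show ?thesis using gb[OF zs] by linarith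
  qed
  have AEG: "AE z in G. z \<in> Q \<longrightarrow> g z = f z \<and> f z = g0 z"
    using AE unfolding G_def[symmetric]
  proof eventually_elim
    fix z assume "g z = g0 z"
    then show "z \<in> Q \<longrightarrow> g z = f z \<and> f z = g0 z" using gQ[of z] by (auto simp: f_def)
  qed
  have AED: "AE z in D. z \<in> Q \<and> g z = f z \<and> f z = g0 z"
    unfolding D by (rule AE_uniform_measureI[OF Qs]) (use AEG in eventually_elim, auto)

  define \<kappa>Q where "\<kappa>Q = (\<Sum>r=1..m. fps_nth (cond_cumulants G Q g0) r)"
  define E2 where "E2 = (\<integral>z. exp (f z) \<partial>D)"
  have main: "\<bar>ln E2 - \<kappa>Q\<bar> \<le> 2 * real n * (100 * \<alpha>) ^ (m + 1)"
  proof -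
    have h1: "\<bar>ln (\<integral>x. exp (f x) \<partial>PiM {..<n} (\<lambda>_. \<mu>)) - (\<Sum>r=1..m. fps_nth (fln (moment_series (PiM {..<n} (\<lambda>_. \<mu>)) f - 1)) r)\<bar>
      \<le> n * (5 / 2) * (50 * \<alpha>) ^ (m + 1)"
    proof (rule cumulant_expansion_PiM_optimized[where f = g and X = Q and B = Bd and d = d])
      show "f \<in> borel_measurable (PiM {..<n} (\<lambda>_. \<mu>))" using fG mD by (simp add: D_def)
      show "AE x in PiM {..<n} (\<lambda>_. \<mu>). g x = f x \<and> x \<in> Q"
        using AED unfolding D_def by eventually_elim auto
    qed (use p\<mu> fB m d alpha \<alpha> in \<open>auto simp: Q_def\<close>)
    have h2: "moment_series D f = Abs_fps (\<lambda>k. cond_mean G Q (\<lambda>z. g0 z ^ k) / fact k)"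
    proof -
      have "(\<integral>z. f z ^ k \<partial>D) = cond_mean G Q (\<lambda>z. g0 z ^ k)" for k
      proof -
        have "(\<integral>z. f z ^ k \<partial>D) = (\<integral>z. g0 z ^ k \<partial>D)"
        proof (rule integral_cong_AE)
          show "AE z in D. f z ^ k = g0 z ^ k" using AED by eventually_elim auto
        qed (auto simp: mD)
        then show ?thesis by (simp add: ID)
      qed
      then show ?thesis by (simp add: moment_series_def)
    qed
    \<comment> \<open>Passing from \<open>50\<alpha>\<close> to \<open>100\<alpha>\<close> gains \<open>(1/2)^(m+1)\<close>, which brings the constant \<open>5/2\<close> below \<open>2\<close>.\<close>
    have h3: "n * (5 / 2) * (50 * \<alpha>) ^ (m + 1) \<le> 2 * real n * (100 * \<alpha>) ^ (m + 1)"
    proof -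
      have "n * (5 / 2) * (50 * \<alpha>) ^ (m + 1) = n * ((5 / 2) * (1 / 2) ^ (m + 1)) * (100 * \<alpha>) ^ (m + 1)"
        by (simp add: power_mult_distrib power_one_over power_divide[symmetric] flip: mult.assoc)
           (simp add: power_mult_distrib[symmetric] field_simps)
      also have "\<dots> \<le> real n * 2 * (100 * \<alpha>) ^ (m + 1)"
      proof (rule mult_right_mono, rule mult_left_mono)
        have "(1 / 2 :: real) ^ (m + 1) \<le> (1 / 2) ^ 1" by (intro power_decreasing) auto
        then show "(5 / 2) * (1 / 2) ^ (m + 1) \<le> (2 :: real)" by simp
      qed (use \<alpha> in auto)
      finally show ?thesis by simp
    qed
    have "\<bar>ln E2 - \<kappa>Q\<bar> \<le> n * (5 / 2) * (50 * \<alpha>) ^ (m + 1)"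
      using h1 unfolding D_def[symmetric] h2 E2_def \<kappa>Q_def cond_cumulants_def .
    then show ?thesis using h3 by (rule order_trans)
  qed

  \<comment> \<open>Off \<open>Om\<close> some coordinate exceeds \<open>\<rho>\<^sub>1\<close>. Under \<open>D\<close> this has probability at most \<open>(4/n\<^sup>2) e1\<close> for each
    coordinate, the tilt by \<open>e^f\<close> costs a factor \<open>e^\<alpha> \<le> 2\<close>, and a union bound gives \<open>\<theta> = (8/n) e1\<close>.\<close>
  define K where "K = (\<integral>z. indicator Om z * exp (f z) \<partial>D)"
  have [measurable]: "Om \<in> sets G" using Om by (simp add: G_def)
  have OmD[measurable]: "Om \<in> sets D" by (simp add: sD)
  have fD[measurable]: "f \<in> borel_measurable D" using fG by (simp add: mD)
  have intE: "integrable D (\<lambda>z. exp (f z))"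
    by (rule D.integrable_const_bound[of _ "exp Bd"]) (use fB in \<open>auto simp: abs_le_iff\<close>)
  have intK: "integrable D (\<lambda>z. indicator Om z * exp (f z))"
    by (rule Bochner_Integration.integrable_bound[OF intE]) (auto simp: indicator_def)
  have intC: "integrable D (\<lambda>z. indicator (space D - Om) z * exp (f z))"
    by (rule Bochner_Integration.integrable_bound[OF intE]) (auto simp: indicator_def)
  have E2pos: "E2 > 0"
  proof -
    have "(\<integral>z. exp (- Bd) \<partial>D) \<le> E2"
      unfolding E2_def
    proof (rule integral_mono)
      show "exp (- Bd) \<le> exp (f z)" for z using fB[of z] by simp
    qed (use intE in auto)
    moreover have "(\<integral>z. exp (- Bd) \<partial>D) > 0" by (simp add: D.prob_space)
    ultimately show ?thesis by linarith
  qed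
  have JK: "J = p * K"
  proof -
    have "K = cond_mean G Q (\<lambda>z. indicator Om z * exp (f z))"
      unfolding K_def by (rule ID) measurable
    also have "\<dots> = (\<integral>z. indicator Om z * exp (g0 z) \<partial>G) / p"
      unfolding cond_mean_def p_def[symmetric]
    proof (intro arg_cong2[where f = "(/)"] integral_cong_AE)
      show "AE z in G. indicator Q z * (indicator Om z * exp (f z)) = indicator Om z * exp (g0 z)"
        using AEG Om2[folded G_def Q_def] by eventually_elim (auto simp: indicator_def)
    qed auto
    finally show ?thesis using p by (simp add: J_def G_def)
  qed
  define \<theta> where "\<theta> = 8 / real n * e1"
  have \<theta>: "0 \<le> \<theta>" "\<theta> \<le> 1 / 2"
  proof -
    have "\<theta> \<le> 8 / real n * 1" unfolding \<theta>_def using e1 by (intro mult_left_mono) auto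
    also have "\<dots> \<le> 1 / 2" using n by (simp add: divide_le_eq)
    finally show "\<theta> \<le> 1 / 2" .
  qed (use e1 in \<open>auto simp: \<theta>_def\<close>)
  have tail: "E2 - K \<le> \<theta> * E2"
  proof -
    let ?U = "{t::real. \<rho>\<^sub>1 < \<bar>t\<bar>}"
    define \<tau> where "\<tau> = 4 / (real n)\<^sup>2 * e1"
    have \<tau>0: "0 \<le> \<tau>" using e1 by (simp add: \<tau>_def)
    have Us: "?U \<in> sets \<mu>" by (simp add: \<mu>_def)
    have mU: "emeasure \<mu> ?U \<le> ennreal \<tau>"
    proof -
      have "emeasure \<mu> ?U = ennreal (g1.prob ({-\<rho>\<^sub>2..\<rho>\<^sub>2} \<inter> ?U) / g1.prob {-\<rho>\<^sub>2..\<rho>\<^sub>2})"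
        unfolding \<mu>_def using half by (subst emeasure_uniform_measure) (auto simp: g1.emeasure_eq_measure divide_ennreal)
      also have "\<dots> \<le> ennreal (g1.prob ?U / (1 / 2))"
        using half by (intro ennreal_leI frac_le g1.finite_measure_mono) auto
      also have "\<dots> \<le> ennreal \<tau>"
        using gauss1_tail(1)[OF n \<rho>(1,4)] by (intro ennreal_leI) (simp add: \<tau>_def e1_def)
      finally show ?thesis .
    qed
    have EE: "(\<integral>\<^sup>+z. ennreal (exp (f z)) \<partial>D) = ennreal E2"
      unfolding E2_def using intE by (intro nn_integral_eq_integral) auto
    have one: "(\<integral>\<^sup>+z. ennreal (exp (f z)) * indicator ?U (z j) \<partial>D) \<le> ennreal (2 * \<tau> * E2)" if j: "j < n" for j
    proof -
      have "(\<integral>\<^sup>+z. ennreal (exp (f z)) * indicator ?U (z j) \<partial>PiM {..<n} (\<lambda>_. \<mu>))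
         \<le> ennreal (exp \<alpha>) * emeasure \<mu> ?U * (\<integral>\<^sup>+z. ennreal (exp (f z)) \<partial>PiM {..<n} (\<lambda>_. \<mu>))"
      proof (rule tilted_tail_le[where Q = "\<lambda>z. z \<in> Q \<and> g z = f z \<and> f z = g0 z", OF p\<mu> _ _ _ j Us])
        show "f \<in> borel_measurable (PiM {..<n} (\<lambda>_. \<mu>))" using fD by (simp add: D_def)
        show "AE z in PiM {..<n} (\<lambda>_. \<mu>). z \<in> Q \<and> g z = f z \<and> f z = g0 z" using AED unfolding D_def .
        fix x a assume x: "x \<in> Q \<and> g x = f x \<and> f x = g0 x"
          and xa: "x(j := a) \<in> Q \<and> g (x(j := a)) = f (x(j := a)) \<and> f (x(j := a)) = g0 (x(j := a))"
        have xQ: "x \<in> cube n \<rho>\<^sub>2" and xaQ: "x(j := a) \<in> cube n \<rho>\<^sub>2" using x xa unfolding Q_def by blast+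
        have "g x - g (x(j := a)) = mixed_diff {j} (x(j := a)) g x"
          unfolding mixed_diff_singleton by (simp only: fun_upd_same)
        also have "\<bar>\<dots>\<bar> \<le> d {j}" using m j by (intro d xQ xaQ) auto
        also have "d {j} \<le> \<alpha>"
        proof -
          have "{V. V \<subseteq> {..<n} \<and> card V = 1 \<and> j \<in> V} = {{j}}"
            using j by (auto simp: card_1_singleton_iff)
          then show ?thesis using alpha[of 1 j] m j by simp
        qed
        finally have "g x - g (x(j := a)) \<le> \<alpha>" by linarith
        then show "f x \<le> \<alpha> + f (x(j := a))" using x xa by linarith
      qed
      also have "\<dots> = ennreal (exp \<alpha>) * emeasure \<mu> ?U * ennreal E2" unfolding D_def[symmetric] EE ..
      also have "\<dots> \<le> ennreal 2 * ennreal \<tau> * ennreal E2"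
      proof (intro mult_right_mono mult_mono ennreal_leI mU)
        have "exp \<alpha> \<le> 1 + \<alpha> + \<alpha>\<^sup>2" using \<alpha> by (intro exp_bound) auto
        also have "\<dots> \<le> 1 + 1 / 400 + (1 / 400)\<^sup>2" using \<alpha> by (intro add_mono power_mono) auto
        also have "\<dots> \<le> 2" by (simp add: power2_eq_square)
        finally show "exp \<alpha> \<le> 2" .
      qed auto
      also have "\<dots> = ennreal (2 * \<tau> * E2)" 
        by (simp only: ennreal_mult''[OF \<tau>0] ennreal_mult''[OF less_imp_le[OF E2pos]])
      finally show ?thesis by (simp add: D_def)
    qed
    have meas1: "(\<lambda>z. ennreal (exp (f z)) * indicator ?U (z j)) \<in> borel_measurable D" if j: "j < n" for j
    proof -
      have [measurable]: "(\<lambda>z. z j) \<in> D \<rightarrow>\<^sub>M \<mu>"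
        unfolding D_def by (rule measurable_component_singleton) (use j in auto)
      note Us[measurable]
      show ?thesis by measurable
    qed
    have "ennreal (\<integral>z. indicator (space D - Om) z * exp (f z) \<partial>D) = (\<integral>\<^sup>+z. ennreal (indicator (space D - Om) z * exp (f z)) \<partial>D)"
      by (rule nn_integral_eq_integral[symmetric, OF intC]) auto
    also have "\<dots> \<le> (\<integral>\<^sup>+z. (\<Sum>j<n. ennreal (exp (f z)) * indicator ?U (z j)) \<partial>D)"
    proof (rule nn_integral_mono_AE)
      have "AE z in D. z \<in> cube n \<rho>\<^sub>1 \<longrightarrow> z \<in> Om"
        unfolding D by (rule AE_uniform_measureI[OF Qs]) (use Om1[folded G_def] in eventually_elim, auto)
      then show "AE z in D. ennreal (indicator (space D - Om) z * exp (f z)) \<le> (\<Sum>j<n. ennreal (exp (f z)) * indicator ?U (z j))"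
        using AE_space
      proof eventually_elim
        fix z assume z: "z \<in> cube n \<rho>\<^sub>1 \<longrightarrow> z \<in> Om" and zs: "z \<in> space D"
        show "ennreal (indicator (space D - Om) z * exp (f z)) \<le> (\<Sum>j<n. ennreal (exp (f z)) * indicator ?U (z j))"
        proof (cases "z \<in> Om")
          case False
          then have "z \<notin> cube n \<rho>\<^sub>1" using z by auto
          moreover have "z \<in> PiE {..<n} (\<lambda>_. UNIV)" using zs by (simp add: spD G_def space_gauss_pi)
          ultimately obtain j where j: "j < n" "\<rho>\<^sub>1 < \<bar>z j\<bar>" by (auto simp: cube_def not_le)
          have "ennreal (indicator (space D - Om) z * exp (f z)) \<le> ennreal (exp (f z)) * indicator ?U (z j)"
            using j by (auto simp: indicator_def)
          also have "\<dots> \<le> (\<Sum>j<n. ennreal (exp (f z)) * indicator ?U (z j))"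
            using j by (intro member_le_sum) auto
          finally show ?thesis .
        qed simp
      qed
    qed
    also have "\<dots> = (\<Sum>j<n. \<integral>\<^sup>+z. ennreal (exp (f z)) * indicator ?U (z j) \<partial>D)"
      using meas1 by (intro nn_integral_sum) auto
    also have "\<dots> \<le> (\<Sum>j<n. ennreal (2 * \<tau> * E2))" by (intro sum_mono one) auto
    also have "\<dots> = ennreal (n * (2 * \<tau> * E2))"
    proof -
      have "0 \<le> 2 * \<tau> * E2" using \<tau>0 E2pos by simp
      then show ?thesis by (simp only: sum_constant card_lessThan ennreal_of_nat_eq_real_of_nat ennreal_mult'')
    qed
    finally have "(\<integral>z. indicator (space D - Om) z * exp (f z) \<partial>D) \<le> n * (2 * \<tau> * E2)"
      using E2pos e1 by (subst (asm) ennreal_le_iff) (auto simp: \<tau>_def)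
    moreover have "n * (2 * \<tau> * E2) = \<theta> * E2" using n0 by (simp add: \<tau>_def \<theta>_def power2_eq_square)
    moreover have "E2 - K = (\<integral>z. indicator (space D - Om) z * exp (f z) \<partial>D)"
      unfolding E2_def K_def
      by (subst Bochner_Integration.integral_diff[OF intE intK, symmetric])
         (auto intro!: Bochner_Integration.integral_cong simp: indicator_def)
    ultimately show ?thesis by simp
  qed
  have KE: "K \<le> E2"
    unfolding E2_def K_def by (intro integral_mono intE intK) (auto simp: indicator_def)
  have K_ge: "(1 - \<theta>) * E2 \<le> K" using tail by (simp add: algebra_simps)
  have Kpos: "K > 0"
  proof -
    have "0 < (1 - \<theta>) * E2" using \<theta> E2pos by (intro mult_pos_pos) auto
    then show ?thesis using K_ge by linarith
  qed
  have lnK: "ln K \<le> ln E2" "ln E2 - 2 * \<theta> \<le> ln K"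
  proof -
    show "ln K \<le> ln E2" using KE Kpos by simp
    have "ln E2 - 2 * \<theta> \<le> ln (1 - \<theta>) + ln E2" using ln_lower_bound_near_1[OF \<theta>] by simp
    also have "\<dots> = ln ((1 - \<theta>) * E2)" using \<theta> E2pos by (subst ln_mult) auto
    also have "\<dots> \<le> ln K" using K_ge \<theta> E2pos by (subst ln_le_cancel_iff) (auto simp: Kpos)
    finally show "ln E2 - 2 * \<theta> \<le> ln K" .
  qed
  have lnp: "ln p \<le> 0" "- (4 / real n * e1) \<le> ln p"
  proof -
    show "ln p \<le> 0" using p by simp
    show "- (4 / real n * e1) \<le> ln p" using ln_lower_bound_near_1[of "1 - p"] p by simp
  qed
  have Jpos: "J > 0" using JK Kpos p by simp
  have lnJ: "ln J = ln p + ln K" using JK Kpos p by (simp add: ln_mult)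
  \<comment> \<open>Both corrections together are \<open>(20/n) e1\<close>, at most the single term \<open>e1\<close> allowed in the bound.\<close>
  have small: "\<bar>ln p\<bar> + \<bar>ln K - ln E2\<bar> \<le> e1"
  proof -
    have "\<bar>ln p\<bar> + \<bar>ln K - ln E2\<bar> \<le> 4 / real n * e1 + 2 * \<theta>" using lnp lnK by linarith
    also have "\<dots> = 20 / real n * e1" by (simp add: \<theta>_def)
    also have "\<dots> \<le> 1 * e1" using n e1 by (intro mult_right_mono) (auto simp: divide_le_eq)
    finally show ?thesis by simp
  qed

  \<comment> \<open>The growth bound with \<open>C'\<close> and \<open>b'\<close> holds only up to radius \<open>\<rho>\<^sub>3\<close>, so it serves to enlarge the cube from
    \<open>\<rho>\<^sub>2\<close> to \<open>\<rho>\<^sub>3\<close>; from there the global bound with \<open>C\<close> and \<open>b\<close> leads to the whole space.\<close>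
  define \<kappa>3 where "\<kappa>3 = (\<Sum>r=1..m. fps_nth (cond_cumulants G (cube n \<rho>\<^sub>3) g0) r)"
  define \<kappa> where "\<kappa> = (\<Sum>r=1..m. fps_nth (fln (moment_series (gauss_pi n) g0 - 1)) r)"
  have sub: "cube n \<rho>\<^sub>2 \<subseteq> cube n \<rho>\<^sub>3" using \<rho> by (auto simp: cube_def)
  have c1: "\<bar>\<kappa>3 - \<kappa>\<bar> \<le> 6 ^ m * ((C ^ m + C) * exp (- (\<rho>\<^sub>3\<^sup>2 - b * real m) / 2))"
  proof -
    have "cond_cumulants G (space G) g0 = fln (moment_series (gauss_pi n) g0 - 1)"
      by (simp add: cond_cumulants_def G.cond_mean_space moment_series_def) (simp add: G_def)
    moreover have "AE z in gauss_pi n. z \<in> space (gauss_pi n) \<longrightarrow> \<bar>g0 z\<bar> \<le> C * exp (b * (\<Sum>i<n. (z i)\<^sup>2) / n)"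
      using AE
    proof eventually_elim
      fix z assume "g z = g0 z"
      then show "z \<in> space (gauss_pi n) \<longrightarrow> \<bar>g0 z\<bar> \<le> C * exp (b * (\<Sum>i<n. (z i)\<^sup>2) / n)" using gb[of z] by simp
    qed
    ultimately show ?thesis
      using cumulants_box_compare[OF n m r3 b C g0, of "space (gauss_pi n)"]
      unfolding \<kappa>3_def \<kappa>_def G_def by (simp add: sets.sets_into_space)
  qed
  have c2: "\<bar>\<kappa>Q - \<kappa>3\<bar> \<le> 6 ^ m * ((C' ^ m + C') * exp (- (\<rho>\<^sub>1\<^sup>2 - b' * real m) / 2))"
  proof -
    have "AE z in gauss_pi n. z \<in> cube n \<rho>\<^sub>3 \<longrightarrow> \<bar>g0 z\<bar> \<le> C' * exp (b' * (\<Sum>i<n. (z i)\<^sup>2) / n)"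
      using AE
    proof eventually_elim
      fix z assume "g z = g0 z"
      then show "z \<in> cube n \<rho>\<^sub>3 \<longrightarrow> \<bar>g0 z\<bar> \<le> C' * exp (b' * (\<Sum>i<n. (z i)\<^sup>2) / n)" using gb'[of z] by simp
    qed
    then have "\<bar>\<kappa>Q - \<kappa>3\<bar> \<le> 6 ^ m * ((C' ^ m + C') * exp (- (\<rho>\<^sub>2\<^sup>2 - b' * real m) / 2))"
      unfolding \<kappa>Q_def \<kappa>3_def G_def Q_def by (intro cumulants_box_compare n m r2 b' C' g0 cube_sets sub)
    also have "\<dots> \<le> 6 ^ m * ((C' ^ m + C') * exp (- (\<rho>\<^sub>1\<^sup>2 - b' * real m) / 2))"
      using C' r2 by (intro mult_left_mono) auto
    finally show ?thesis .
  qed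
  have "\<bar>ln J - \<kappa>\<bar> \<le> \<bar>ln E2 - \<kappa>Q\<bar> + (\<bar>ln p\<bar> + \<bar>ln K - ln E2\<bar>) + (\<bar>\<kappa>3 - \<kappa>\<bar> + \<bar>\<kappa>Q - \<kappa>3\<bar>)"
    unfolding lnJ by linarith
  also have "\<dots> \<le> 2 * real n * (100 * \<alpha>) ^ (m + 1) + e1
      + (6 ^ m * ((C ^ m + C) * exp (- (\<rho>\<^sub>3\<^sup>2 - b * real m) / 2)) + 6 ^ m * ((C' ^ m + C') * exp (- (\<rho>\<^sub>1\<^sup>2 - b' * real m) / 2)))"
    by (intro add_mono main small c1 c2)
  finally have "\<bar>ln J - (\<Sum>r=1..m. fps_nth (fln (moment_series (gauss_pi n) g0 - 1)) r)\<bar>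
      \<le> 2 * real n * (100 * \<alpha>) ^ (m + 1) + exp (- \<rho>\<^sub>1\<^sup>2 / 2)
          + 6 ^ m * ((C ^ m + C) * exp (- (\<rho>\<^sub>3\<^sup>2 - b * real m) / 2)
                   + (C' ^ m + C') * exp (- (\<rho>\<^sub>1\<^sup>2 - b' * real m) / 2))"
    by (simp only: \<kappa>_def e1_def distrib_left)
  with Jpos show ?thesis by blast
qed

section \<open>From vectors to coordinates\<close>

text \<open>
  The measure whose completion is \<open>lebesgue_vec\<close>.
\<close>
abbreviation borel_vec :: "nat \<Rightarrow> real Matrix.vec measure" where
  "borel_vec n \<equiv> embed_measure (leb_pi n) (Matrix.vec n)"

definition lin_param :: "nat \<Rightarrow> real mat \<Rightarrow> (nat \<Rightarrow> real) \<Rightarrow> real Matrix.vec" where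
  "lin_param n T z = T *\<^sub>v Matrix.vec n z"

lemma vec_measurable: "Matrix.vec n \<in> leb_pi n \<rightarrow>\<^sub>M borel_vec n"
  by (rule measurable_embed_measure2'[OF inj_on_vec])

lemma lin_param_measurable:
  assumes "T \<in> carrier_mat n n"
  shows "lin_param n T \<in> leb_pi n \<rightarrow>\<^sub>M borel_vec n"
proof -
  have "lin_param n T = (\<lambda>z. Matrix.vec n (mat_app n T z))"
    by (rule ext) (simp add: lin_param_def mult_vec_eq_mat_app[OF assms])
  then show ?thesis using measurable_compose[OF mat_app_measurable vec_measurable] by simp
qed

lemma borel_vec_eq_scaled:
  assumes T: "T \<in> carrier_mat n n" and det: "Determinant.det T \<noteq> 0"
  shows "borel_vec n = density (distr (leb_pi n) (borel_vec n) (lin_param n T)) (\<lambda>_. ennreal \<bar>Determinant.det T\<bar>)"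
proof (rule measure_eqI)
  fix B assume "B \<in> sets (borel_vec n)"
  then have B[measurable]: "B \<in> sets (borel_vec n)" .
  note vm[measurable] = vec_measurable[of n]
  note lm[measurable] = lin_param_measurable[OF T]
  define h :: "(nat \<Rightarrow> real) \<Rightarrow> ennreal" where "h z = indicator B (Matrix.vec n z)" for z
  have h: "h \<in> borel_measurable (leb_pi n)" unfolding h_def by measurable
  have hT: "h (mat_app n T z) = indicator B (lin_param n T z)" for z
    by (simp add: h_def lin_param_def mult_vec_eq_mat_app[OF T])
  have "emeasure (borel_vec n) B = (\<integral>\<^sup>+x. indicator B x \<partial>distr (leb_pi n) (borel_vec n) (Matrix.vec n))"
    using embed_measure_eq_distr'[OF inj_on_vec[of n]] by simp
  also have "\<dots> = (\<integral>\<^sup>+z. h z \<partial>leb_pi n)"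
    unfolding h_def by (rule nn_integral_distr) measurable
  also have "\<dots> = ennreal \<bar>Determinant.det T\<bar> * (\<integral>\<^sup>+z. h (mat_app n T z) \<partial>leb_pi n)"
    using bspec[OF scales_invertible[OF T det, unfolded scales_def], of h] h by blast
  also have "(\<integral>\<^sup>+z. h (mat_app n T z) \<partial>leb_pi n) = (\<integral>\<^sup>+x. indicator B x \<partial>distr (leb_pi n) (borel_vec n) (lin_param n T))"
    unfolding hT by (rule nn_integral_distr[symmetric]) measurable
  also have "ennreal \<bar>Determinant.det T\<bar> * \<dots> = (\<integral>\<^sup>+x. ennreal \<bar>Determinant.det T\<bar> * indicator B x \<partial>distr (leb_pi n) (borel_vec n) (lin_param n T))"
    by (rule nn_integral_cmult[symmetric]) simp
  also have "\<dots> = emeasure (density (distr (leb_pi n) (borel_vec n) (lin_param n T)) (\<lambda>_. ennreal \<bar>Determinant.det T\<bar>)) B"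
    by (rule emeasure_density[symmetric]) simp_all
  finally show "emeasure (borel_vec n) B = emeasure (density (distr (leb_pi n) (borel_vec n) (lin_param n T)) (\<lambda>_. ennreal \<bar>Determinant.det T\<bar>)) B" .
qed simp

text \<open>
  The substitution \<open>x = T z\<close> for Lebesgue measurable integrands. Composition with \<open>T\<close> need not preserve
  measurability with respect to the uncompleted product measure, hence the Borel version \<open>F0\<close> on the
  right-hand side.
\<close>
lemma integral_lebesgue_vec:
  fixes F F0 :: "real Matrix.vec \<Rightarrow> real"
  assumes T: "T \<in> carrier_mat n n" and det: "Determinant.det T \<noteq> 0"
    and F: "F \<in> borel_measurable (lebesgue_vec n)" and F0: "F0 \<in> borel_measurable (borel_vec n)"
    and AE: "AE x in borel_vec n. F x = F0 x"
  shows "(\<integral>x. F x \<partial>lebesgue_vec n) = \<bar>Determinant.det T\<bar> * (\<integral>z. F0 (lin_param n T z) \<partial>leb_pi n)"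
proof -
  have "(\<integral>x. F x \<partial>lebesgue_vec n) = (\<integral>x. F0 x \<partial>lebesgue_vec n)"
    unfolding lebesgue_vec_def
    by (rule integral_cong_AE) (use F F0 AE in \<open>auto simp: lebesgue_vec_def intro: AE_completion measurable_completion\<close>)
  also have "\<dots> = (\<integral>x. F0 x \<partial>borel_vec n)"
    unfolding lebesgue_vec_def by (rule integral_completion[OF F0])
  also have "\<dots> = (\<integral>x. \<bar>Determinant.det T\<bar> *\<^sub>R F0 x \<partial>distr (leb_pi n) (borel_vec n) (lin_param n T))"
    by (subst borel_vec_eq_scaled[OF T det], rule integral_density) (use F0 in auto)
  also have "\<dots> = \<bar>Determinant.det T\<bar> * (\<integral>x. F0 x \<partial>distr (leb_pi n) (borel_vec n) (lin_param n T))"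
    by simp
  also have "(\<integral>x. F0 x \<partial>distr (leb_pi n) (borel_vec n) (lin_param n T)) = (\<integral>z. F0 (lin_param n T z) \<partial>leb_pi n)"
    by (rule integral_distr[OF lin_param_measurable[OF T] F0])
  finally show ?thesis .
qed

text \<open>
  Null sets have null preimages because \<open>T\<close> only scales the measure.
\<close>
lemma AE_lin_param:
  assumes T: "T \<in> carrier_mat n n" and det: "Determinant.det T \<noteq> 0" and AE: "AE x in borel_vec n. R x"
  shows "AE z in leb_pi n. R (lin_param n T z)"
proof -
  have "AE x in density (distr (leb_pi n) (borel_vec n) (lin_param n T)) (\<lambda>_. ennreal \<bar>Determinant.det T\<bar>). R x"
    using AE by (subst (asm) borel_vec_eq_scaled[OF T det])
  then have "AE x in distr (leb_pi n) (borel_vec n) (lin_param n T). R x"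
    using det by (simp add: AE_density)
  then show ?thesis by (rule AE_distrD[OF lin_param_measurable[OF T]])
qed

lemma gauss_density_measurable:
  "(\<lambda>z. pi powr (- (real n / 2)) * exp (- (\<Sum>i<n. (z i)\<^sup>2))) \<in> borel_measurable (leb_pi n)"
proof -
  have "(\<lambda>z. \<Sum>i<n. (z i)\<^sup>2) \<in> borel_measurable (leb_pi n)"
    using measurable_component_singleton[of _ "{..<n}" "\<lambda>_. lborel :: real measure"]
    by (intro borel_measurable_sum borel_measurable_power) (simp cong: measurable_cong_sets)
  then show ?thesis by measurable
qed

lemma gauss_pi_eq_density:
  "gauss_pi n = density (leb_pi n) (\<lambda>z. ennreal (pi powr (- (real n / 2)) * exp (- (\<Sum>i<n. (z i)\<^sup>2))))"
proof -
  interpret L: product_sigma_finite "\<lambda>_::nat. lborel :: real measure" by standard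
  interpret g: product_sigma_finite "\<lambda>_::nat. gauss1"
    by (rule product_sigma_finite.intro, rule prob_space_imp_sigma_finite, rule prob_space_gauss1)
  let ?\<delta> = "\<lambda>t. ennreal (normal_density 0 (1 / sqrt 2) t)"
  let ?d = "\<lambda>z. ennreal (pi powr (- (real n / 2)) * exp (- (\<Sum>i<n. (z i)\<^sup>2)))"
  have d: "?d z = (\<Prod>i<n. ?\<delta> (z i))" for z :: "nat \<Rightarrow> real"
  proof -
    have "(\<Prod>i<n. ?\<delta> (z i)) = ennreal (\<Prod>i<n. normal_density 0 (1 / sqrt 2) (z i))"
      by (rule prod_ennreal) simp
    also have "(\<Prod>i<n. normal_density 0 (1 / sqrt 2) (z i)) = (\<Prod>i<n. (1 / sqrt pi) * exp (- (z i)\<^sup>2))"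
    proof (intro prod.cong refl)
      fix i show "normal_density 0 (1 / sqrt 2) (z i) = (1 / sqrt pi) * exp (- (z i)\<^sup>2)"
        using normal_density_scaled[of 1 "z i"] by simp
    qed
    also have "\<dots> = (1 / sqrt pi) ^ n * exp (\<Sum>i<n. - (z i)\<^sup>2)"
      unfolding prod.distrib exp_sum[OF finite_lessThan] by simp
    also have "(1 / sqrt pi) ^ n = pi powr (- (real n / 2))"
    proof -
      have "1 / sqrt pi = pi powr (- (1 / 2))"
        unfolding powr_minus by (simp only: powr_half_sqrt[OF pi_ge_zero] inverse_eq_divide)
      moreover have "(pi powr (- (1 / 2))) ^ n = pi powr (- (1 / 2) * real n)"
        using powr_power[of pi "- (1 / 2)" n] by (simp add: mult.commute)
      ultimately show ?thesis by simp
    qed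
    finally show ?thesis by (simp add: sum_negf)
  qed
  have "density (leb_pi n) ?d = PiM {..<n} (\<lambda>_. gauss1)"
  proof (rule g.PiM_eqI)
    show "sets (density (leb_pi n) ?d) = sets (gauss_pi n)"
      unfolding sets_density by (rule sets_PiM_cong) auto
    fix X :: "nat \<Rightarrow> real set" assume X: "\<And>i. i \<in> {..<n} \<Longrightarrow> X i \<in> sets gauss1"
    have XP: "PiE {..<n} X \<in> sets (leb_pi n)" using X by (intro sets_PiM_I_finite) auto
    have dm: "?d \<in> borel_measurable (leb_pi n)" using gauss_density_measurable by measurable
    have "emeasure (density (leb_pi n) ?d) (PiE {..<n} X) = (\<integral>\<^sup>+z. ?d z * indicator (PiE {..<n} X) z \<partial>leb_pi n)"
      by (rule emeasure_density[OF dm XP])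
    also have "\<dots> = (\<integral>\<^sup>+z. (\<Prod>i<n. ?\<delta> (z i) * indicator (X i) (z i)) \<partial>leb_pi n)"
    proof (rule nn_integral_cong)
      fix z :: "nat \<Rightarrow> real" assume z: "z \<in> space (leb_pi n)"
      have "indicator (PiE {..<n} X) z = (\<Prod>i<n. indicator (X i) (z i) :: ennreal)"
      proof (cases "z \<in> PiE {..<n} X")
        case True
        then show ?thesis by (auto simp: PiE_iff)
      next
        case False
        then obtain i where "i < n" "z i \<notin> X i" using z by (auto simp: PiE_iff space_PiM)
        then have "(\<Prod>i<n. indicator (X i) (z i) :: ennreal) = 0"
          by (intro prod_zero bexI[of _ i]) auto
        then show ?thesis using False by simp
      qed
      then show "?d z * indicator (PiE {..<n} X) z = (\<Prod>i<n. ?\<delta> (z i) * indicator (X i) (z i))"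
        unfolding d by (simp only: prod.distrib)
    qed
    also have "\<dots> = (\<Prod>i<n. \<integral>\<^sup>+t. ?\<delta> t * indicator (X i) t \<partial>lborel)"
      by (rule L.product_nn_integral_prod) (use X in auto)
    also have "\<dots> = (\<Prod>i<n. emeasure gauss1 (X i))"
    proof (rule prod.cong[OF refl])
      fix i assume "i \<in> {..<n}"
      then have "X i \<in> sets lborel" using X by simp
      then show "(\<integral>\<^sup>+t. ?\<delta> t * indicator (X i) t \<partial>lborel) = emeasure gauss1 (X i)"
        unfolding gauss1_def by (intro emeasure_density[symmetric]) auto
    qed
    finally show "emeasure (density (leb_pi n) ?d) (PiE {..<n} X) = (\<Prod>i\<in>{..<n}. emeasure gauss1 (X i))" .
  qed simp
  then show ?thesis by simp
qed

lemma sets_gauss_pi: "sets (gauss_pi n) = sets (leb_pi n)"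
  by (rule sets_PiM_cong) auto

lemma measurable_gauss_pi: "u \<in> borel_measurable (gauss_pi n) \<longleftrightarrow> u \<in> borel_measurable (leb_pi n)"
  by (rule measurable_cong_sets[THEN eqset_imp_iff]) (simp_all add: sets_gauss_pi)

lemma integral_gauss_pi:
  fixes u :: "(nat \<Rightarrow> real) \<Rightarrow> real"
  assumes u: "u \<in> borel_measurable (leb_pi n)"
  shows "(\<integral>z. u z \<partial>gauss_pi n) = pi powr (- (real n / 2)) * (\<integral>z. exp (- (\<Sum>i<n. (z i)\<^sup>2)) * u z \<partial>leb_pi n)"
proof -
  have "(\<integral>z. u z \<partial>gauss_pi n) = (\<integral>z. (pi powr (- (real n / 2)) * exp (- (\<Sum>i<n. (z i)\<^sup>2))) *\<^sub>R u z \<partial>leb_pi n)"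
    unfolding gauss_pi_eq_density using u gauss_density_measurable by (intro integral_density) auto
  then show ?thesis by (simp add: mult.assoc)
qed

lemma AE_gauss_pi: "AE z in leb_pi n. R z \<Longrightarrow> AE z in gauss_pi n. R z"
  unfolding gauss_pi_eq_density using gauss_density_measurable by (subst AE_density) auto

section \<open>The quadratic form\<close>

lemma quadratic_form_lin_param:
  fixes A T :: "real mat"
  assumes A: "A \<in> carrier_mat n n" and T: "T \<in> carrier_mat n n" and TAT: "transpose_mat T * A * T = 1\<^sub>m n"
  shows "scalar_prod (lin_param n T z) (A *\<^sub>v lin_param n T z) = (\<Sum>i<n. (z i)\<^sup>2)"
proof -
  define v where "v = Matrix.vec n z"
  have v: "v \<in> carrier_vec n" by (simp add: v_def)
  have Tt: "transpose_mat T \<in> carrier_mat n n" using T by simp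
  have Tv: "T *\<^sub>v v \<in> carrier_vec n" and ATv: "A *\<^sub>v (T *\<^sub>v v) \<in> carrier_vec n" using A T v by auto
  have "scalar_prod (T *\<^sub>v v) (A *\<^sub>v (T *\<^sub>v v)) = scalar_prod (A *\<^sub>v (T *\<^sub>v v)) (T *\<^sub>v v)"
    by (rule comm_scalar_prod[OF Tv ATv])
  also have "\<dots> = scalar_prod (transpose_mat T *\<^sub>v (A *\<^sub>v (T *\<^sub>v v))) v"
    by (rule transpose_vec_mult_scalar[OF T v ATv, symmetric])
  also have "transpose_mat T *\<^sub>v (A *\<^sub>v (T *\<^sub>v v)) = (transpose_mat T * A * T) *\<^sub>v v"
    using A T Tt v by (simp add: assoc_mult_mat_vec[of _ n n _ n])
  also have "\<dots> = v" using v by (simp add: TAT)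
  finally show ?thesis
    by (simp add: lin_param_def v_def scalar_prod_def lessThan_atLeast0 power2_eq_square)
qed

lemma quadratic_form_measurable:
  fixes A :: "real mat"
  assumes A: "A \<in> carrier_mat n n"
  shows "(\<lambda>x. scalar_prod x (A *\<^sub>v x)) \<in> borel_measurable (borel_vec n)"
proof (rule measurable_embed_measure1)
  have "scalar_prod (Matrix.vec n z) (A *\<^sub>v Matrix.vec n z) = (\<Sum>i<n. z i * (\<Sum>j<n. A $$ (i, j) * z j))" for z
    using A by (simp add: scalar_prod_def lessThan_atLeast0)
  moreover have "(\<lambda>z. \<Sum>i<n. z i * (\<Sum>j<n. A $$ (i, j) * z j)) \<in> borel_measurable (leb_pi n)"
    using measurable_component_singleton[of _ "{..<n}" "\<lambda>_. lborel :: real measure"]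
    by (intro borel_measurable_sum borel_measurable_times borel_measurable_const) auto
  ultimately show "(\<lambda>z. scalar_prod (Matrix.vec n z) (A *\<^sub>v Matrix.vec n z)) \<in> borel_measurable (leb_pi n)" by simp
qed

text \<open>
  Take determinants in \<open>T\<^sup>T A T = 1\<close>: this gives \<open>det A \<cdot> (det T)\<^sup>2 = 1\<close>.
\<close>
lemma det_of_normalizing:
  fixes A T :: "real mat"
  assumes A: "A \<in> carrier_mat n n" and T: "T \<in> carrier_mat n n" and TAT: "transpose_mat T * A * T = 1\<^sub>m n"
  shows "Determinant.det T \<noteq> 0" "Determinant.det A > 0" "\<bar>Determinant.det T\<bar> = Determinant.det A powr (- 1 / 2)"
proof -
  have "Determinant.det (transpose_mat T * A * T) = Determinant.det T * Determinant.det A * Determinant.det T"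
    using A T by (simp add: det_mult[of _ n] Determinant.det_transpose)
  then have eq: "Determinant.det A * (Determinant.det T)\<^sup>2 = 1" by (simp add: TAT power2_eq_square mult_ac)
  then show 0: "Determinant.det T \<noteq> 0" by auto
  then have T2: "(Determinant.det T)\<^sup>2 > 0" by simp
  have "0 < Determinant.det A * (Determinant.det T)\<^sup>2" by (simp only: eq zero_less_one)
  then show pos: "Determinant.det A > 0" using T2 by (simp only: zero_less_mult_iff) linarith
  have "\<bar>Determinant.det T\<bar> = sqrt ((Determinant.det T)\<^sup>2)" by simp
  also have "(Determinant.det T)\<^sup>2 = inverse (Determinant.det A)" using eq pos by (simp add: field_simps)
  also have "sqrt (inverse (Determinant.det A)) = inverse (Determinant.det A powr (1 / 2))"
    using pos by (simp add: real_sqrt_inverse powr_half_sqrt)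
  also have "\<dots> = Determinant.det A powr (- 1 / 2)" by (simp add: powr_minus)
  finally show "\<bar>Determinant.det T\<bar> = Determinant.det A powr (- 1 / 2)" .
qed

section \<open>Differences and boxes\<close>

lemma coord_diffs_eq_mixed_diff:
  assumes "finite V" "V \<subseteq> {..<n}"
  shows "coord_diffs V (Matrix.vec n y) F (Matrix.vec n x) = mixed_diff V y (\<lambda>z. F (Matrix.vec n z)) x"
  using assms
proof (induction V arbitrary: x rule: finite_induct)
  case empty then show ?case by (simp add: coord_diffs_empty)
next
  case (insert j V)
  have "Matrix.vec n (\<lambda>i. if i = j then Matrix.vec_index (Matrix.vec n y) i else Matrix.vec_index (Matrix.vec n x) i) = Matrix.vec n (x(j := y j))"
    using insert.prems by (intro eq_vecI) auto
  then show ?case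
    using insert by (simp add: coord_diffs_insert coord_diff_def replace_coord_def mixed_diff_insert)
qed

lemma sup_box_iff_cube: "z \<in> space (gauss_pi n) \<Longrightarrow> Matrix.vec n z \<in> sup_box n \<rho> \<longleftrightarrow> z \<in> cube n \<rho>"
  by (auto simp: sup_box_def cube_def space_gauss_pi)

text \<open>
  The only asymptotic use of the lower bound on \<open>\<rho>\<^sub>1\<close>: \<open>(ln n)^(1 + 2\<epsilon>)\<close> eventually exceeds any multiple of
  \<open>ln n\<close>.
\<close>
lemma eventually_square_ge_log:
  fixes \<epsilon> :: real
  assumes "\<epsilon> > 0"
  shows "\<forall>\<^sub>F n in sequentially. 16 * ln (real n) \<le> (ln (real n) powr (1 / 2 + \<epsilon>))\<^sup>2"
proof -
  define c where "c = max 1 (16 powr (1 / (2 * \<epsilon>)))"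
  have "filterlim (\<lambda>n. ln (real n)) at_top sequentially"
    by (rule filterlim_compose[OF ln_at_top filterlim_real_sequentially])
  then have "\<forall>\<^sub>F n in sequentially. c \<le> ln (real n)" by (simp add: filterlim_at_top)
  then show ?thesis
  proof eventually_elim
    fix n assume n: "c \<le> ln (real n)"
    define L where "L = ln (real n)"
    have L: "1 \<le> L" "16 powr (1 / (2 * \<epsilon>)) \<le> L" using n by (auto simp: c_def L_def)
    have "16 = (16 powr (1 / (2 * \<epsilon>))) powr (2 * \<epsilon>)" using assms by (simp add: powr_powr)
    also have "\<dots> \<le> L powr (2 * \<epsilon>)" using L assms by (intro powr_mono2) auto
    finally have "16 * L \<le> L powr (2 * \<epsilon>) * L" using L by (intro mult_right_mono) auto
    also have "L powr (2 * \<epsilon>) * L = L powr (2 * \<epsilon> + 1)" using L by (simp add: powr_add)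
    also have "\<dots> = (L powr (1 / 2 + \<epsilon>))\<^sup>2"
      using powr_power[of L "1 / 2 + \<epsilon>" 2] L by (simp add: algebra_simps)
    finally show "16 * ln (real n) \<le> (ln (real n) powr (1 / 2 + \<epsilon>))\<^sup>2" by (simp add: L_def)
  qed
qed

lemma Delta_nonneg: "S \<noteq> {} \<Longrightarrow> 0 \<le> Delta V F S"
  unfolding Delta_def by (rule SUP_upper2[of "(SOME x. x \<in> S, SOME x. x \<in> S)"]) (auto simp: some_in_eq)

lemma abs_coord_diffs_le_Delta:
  assumes "x \<in> S" "y \<in> S"
  shows "ereal \<bar>coord_diffs V y F x\<bar> \<le> Delta V F S"
  unfolding Delta_def by (rule SUP_upper2[of "(x, y)"]) (use assms in auto)

text \<open>
  A finite bound on the sums excludes infinite values of \<open>Delta\<close> for nonempty \<open>V\<close>, since every such \<open>V\<close> contributes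
  to one of the sums; so the hypothesis may be read in the reals.
\<close>
lemma Delta_sum_bounds:
  assumes S: "S \<noteq> {}"
    and H: "\<forall>l\<in>{1..m}. (MAX j\<in>{..<n}. \<Sum>V | V \<subseteq> {..<n} \<and> card V = l \<and> j \<in> V. Delta V F S) \<le> ereal \<alpha>"
  shows "\<And>V. V \<subseteq> {..<n} \<Longrightarrow> card V \<in> {1..m} \<Longrightarrow> Delta V F S = ereal (real_of_ereal (Delta V F S))"
    and "\<And>l j. l \<in> {1..m} \<Longrightarrow> j < n \<Longrightarrow>
      (\<Sum>V | V \<subseteq> {..<n} \<and> card V = l \<and> j \<in> V. real_of_ereal (Delta V F S)) \<le> \<alpha>"
proof -
  have fin: "finite {V. V \<subseteq> {..<n} \<and> card V = l \<and> j \<in> V}" for l j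
    by (rule finite_subset[of _ "Pow {..<n}"]) auto
  have le: "(\<Sum>V | V \<subseteq> {..<n} \<and> card V = l \<and> j \<in> V. Delta V F S) \<le> ereal \<alpha>" if "l \<in> {1..m}" "j < n" for l j
  proof -
    have "(\<Sum>V | V \<subseteq> {..<n} \<and> card V = l \<and> j \<in> V. Delta V F S)
       \<le> (MAX j\<in>{..<n}. \<Sum>V | V \<subseteq> {..<n} \<and> card V = l \<and> j \<in> V. Delta V F S)"
      using that(2) by (intro Max_ge) auto
    also have "\<dots> \<le> ereal \<alpha>" using H that(1) by blast
    finally show ?thesis .
  qed
  show 1: "Delta V F S = ereal (real_of_ereal (Delta V F S))" if V: "V \<subseteq> {..<n}" "card V \<in> {1..m}" for V
  proof -
    have "V \<noteq> {}" using V(2) by auto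
    then obtain j where j: "j \<in> V" by auto
    have "Delta V F S \<le> (\<Sum>W | W \<subseteq> {..<n} \<and> card W = card V \<and> j \<in> W. Delta W F S)"
      using sum_mono2[of "{W. W \<subseteq> {..<n} \<and> card W = card V \<and> j \<in> W}" "{V}" "\<lambda>W. Delta W F S"]
        V j fin Delta_nonneg[OF S] by simp
    also have "\<dots> \<le> ereal \<alpha>" using V j by (intro le) auto
    finally have "Delta V F S \<noteq> \<infinity>" by auto
    moreover have "Delta V F S \<noteq> - \<infinity>" using Delta_nonneg[OF S, of V F] by auto
    ultimately show ?thesis by (cases "Delta V F S") auto
  qed
  show "(\<Sum>V | V \<subseteq> {..<n} \<and> card V = l \<and> j \<in> V. real_of_ereal (Delta V F S)) \<le> \<alpha>" if lj: "l \<in> {1..m}" "j < n" for l j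
  proof -
    have "ereal (\<Sum>V | V \<subseteq> {..<n} \<and> card V = l \<and> j \<in> V. real_of_ereal (Delta V F S))
      = (\<Sum>V | V \<subseteq> {..<n} \<and> card V = l \<and> j \<in> V. ereal (real_of_ereal (Delta V F S)))" by (rule sum_ereal[symmetric])
    also have "\<dots> = (\<Sum>V | V \<subseteq> {..<n} \<and> card V = l \<and> j \<in> V. Delta V F S)"
      using lj by (intro sum.cong refl 1[symmetric]) auto
    also have "\<dots> \<le> ereal \<alpha>" by (rule le[OF lj])
    finally show ?thesis by simp
  qed
qed

section \<open>The integral in the original coordinates\<close>

theorem theorem3p6:
  fixes \<epsilon> :: real
  assumes "\<epsilon> > 0"
  shows "\<forall>\<^sub>F n in sequentially.
    \<forall>(A :: real mat) (T :: real mat) (m :: nat) (\<Omega> :: real Matrix.vec set)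
      (f :: real Matrix.vec \<Rightarrow> real)
      (\<rho>\<^sub>1 :: real) (\<rho>\<^sub>2 :: real) (\<rho>\<^sub>3 :: real) (\<alpha> :: real)
      (b :: real) (b' :: real) (C :: real) (C' :: real).
      A \<in> carrier_mat n n \<and> transpose_mat A = A \<and> positive_definite n A \<and>
      T \<in> carrier_mat n n \<and> transpose_mat T * A * T = 1\<^sub>m n \<and>
      m \<in> {1..n} \<and>
      \<Omega> \<in> sets (lebesgue_vec n) \<and> f \<in> borel_measurable (lebesgue_vec n) \<and>
      0 \<le> \<rho>\<^sub>1 \<and> 0 \<le> \<rho>\<^sub>2 \<and> 0 \<le> \<rho>\<^sub>3 \<and> 0 \<le> \<alpha> \<and> 0 \<le> b \<and> 0 \<le> b' \<and> 0 \<le> C \<and> 0 \<le> C' \<and>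
      sup_box n \<rho>\<^sub>1 \<subseteq> {x \<in> carrier_vec n. T *\<^sub>v x \<in> \<Omega>} \<and>
      {x \<in> carrier_vec n. T *\<^sub>v x \<in> \<Omega>} \<subseteq> sup_box n \<rho>\<^sub>2 \<and>
      sup_box n \<rho>\<^sub>2 \<subseteq> sup_box n \<rho>\<^sub>3 \<and>
      \<rho>\<^sub>3 \<ge> \<rho>\<^sub>2 \<and> \<rho>\<^sub>2 \<ge> \<rho>\<^sub>1 \<and> \<rho>\<^sub>1 \<ge> ln (real n) powr (1 / 2 + \<epsilon>) \<and>
      (\<forall>l\<in>{1..m}.
        (MAX j\<in>{..<n}. \<Sum>V | V \<subseteq> {..<n} \<and> card V = l \<and> j \<in> V.
            Delta V (\<lambda>x. f (T *\<^sub>v x)) (sup_box n \<rho>\<^sub>2)) \<le> ereal \<alpha>) \<and>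
      \<alpha> < 1 / 400 \<and>
      max (b * real m + b\<^sup>2 * (real m)\<^sup>2) (b' * real m + b'\<^sup>2 * (real m)\<^sup>2) \<le> real n \<and>
      (\<forall>x\<in>carrier_vec n. \<bar>f x\<bar> \<le> C * exp (b * scalar_prod x (A *\<^sub>v x) / real n)) \<and>
      (\<forall>x\<in>(\<lambda>x. T *\<^sub>v x) ` sup_box n \<rho>\<^sub>3.
        \<bar>f x\<bar> \<le> C' * exp (b' * scalar_prod x (A *\<^sub>v x) / real n))
      \<longrightarrow>
      (\<exists>\<delta> :: real.
        (LINT x:\<Omega>|lebesgue_vec n. exp (- scalar_prod x (A *\<^sub>v x) + f x))
          = pi powr (real n / 2) * Determinant.det A powr (- 1 / 2)
            * exp ((\<Sum>r = 1..m. cumulant r (gaussian_vec n A) f / fact r) + \<delta>) \<and>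
        \<bar>\<delta>\<bar> \<le> 2 * real n * (100 * \<alpha>) ^ (m + 1) + exp (- \<rho>\<^sub>1\<^sup>2 / 2)
          + 6 ^ m * ((C ^ m + C) * exp (- (\<rho>\<^sub>3\<^sup>2 - b * real m) / 2)
                   + (C' ^ m + C') * exp (- (\<rho>\<^sub>1\<^sup>2 - b' * real m) / 2)))"
proof -
  have "\<forall>\<^sub>F n in sequentially. 144 \<le> (n::nat)" by (rule eventually_ge_at_top)
  with eventually_square_ge_log[OF assms] show ?thesis
  proof eventually_elim
    case (elim n)
    show ?case
    proof (intro allI impI, elim conjE)
      fix A T :: "real mat" and m :: nat and \<Omega> :: "real Matrix.vec set" and f :: "real Matrix.vec \<Rightarrow> real"
        and \<rho>\<^sub>1 \<rho>\<^sub>2 \<rho>\<^sub>3 \<alpha> b b' C C' :: real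
      assume A: "A \<in> carrier_mat n n" and T: "T \<in> carrier_mat n n" and TAT: "transpose_mat T * A * T = 1\<^sub>m n"
        and m: "m \<in> {1..n}" and \<Omega>: "\<Omega> \<in> sets (lebesgue_vec n)" and f: "f \<in> borel_measurable (lebesgue_vec n)"
        and \<rho>0: "0 \<le> \<rho>\<^sub>1" "0 \<le> \<rho>\<^sub>2" and \<alpha>0: "0 \<le> \<alpha>" and b0: "0 \<le> b" "0 \<le> b'" and C0: "0 \<le> C" "0 \<le> C'"
        and in1: "sup_box n \<rho>\<^sub>1 \<subseteq> {x \<in> carrier_vec n. T *\<^sub>v x \<in> \<Omega>}"
        and in2: "{x \<in> carrier_vec n. T *\<^sub>v x \<in> \<Omega>} \<subseteq> sup_box n \<rho>\<^sub>2"
        and \<rho>: "\<rho>\<^sub>3 \<ge> \<rho>\<^sub>2" "\<rho>\<^sub>2 \<ge> \<rho>\<^sub>1" "\<rho>\<^sub>1 \<ge> ln (real n) powr (1 / 2 + \<epsilon>)"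
        and HD: "\<forall>l\<in>{1..m}. (MAX j\<in>{..<n}. \<Sum>V | V \<subseteq> {..<n} \<and> card V = l \<and> j \<in> V.
            Delta V (\<lambda>x. f (T *\<^sub>v x)) (sup_box n \<rho>\<^sub>2)) \<le> ereal \<alpha>"
        and \<alpha>1: "\<alpha> < 1 / 400"
        and bm: "max (b * real m + b\<^sup>2 * (real m)\<^sup>2) (b' * real m + b'\<^sup>2 * (real m)\<^sup>2) \<le> real n"
        and fb: "\<forall>x\<in>carrier_vec n. \<bar>f x\<bar> \<le> C * exp (b * scalar_prod x (A *\<^sub>v x) / real n)"
        and fb': "\<forall>x\<in>(\<lambda>x. T *\<^sub>v x) ` sup_box n \<rho>\<^sub>3. \<bar>f x\<bar> \<le> C' * exp (b' * scalar_prod x (A *\<^sub>v x) / real n)"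
      note det = det_of_normalizing[OF A T TAT]
      note quad = quadratic_form_lin_param[OF A T TAT]
      define q where "q x = scalar_prod x (A *\<^sub>v x)" for x :: "real Matrix.vec"
      have qm[measurable]: "q \<in> borel_measurable (borel_vec n)"
        unfolding q_def by (rule quadratic_form_measurable[OF A])
      have q: "q (lin_param n T z) = (\<Sum>i<n. (z i)\<^sup>2)" for z unfolding q_def by (rule quad)
      note lm[measurable] = lin_param_measurable[OF T]

      \<comment> \<open>Borel versions make compositions with \<open>T\<close> measurable for the product measure; \<open>f\<close> itself is kept
        for the pointwise bounds.\<close>
      obtain f0 where f0[measurable]: "f0 \<in> borel_measurable (borel_vec n)" and ff0: "AE x in borel_vec n. f x = f0 x"
        using completion_ex_borel_measurable_real[OF f[unfolded lebesgue_vec_def]] by auto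
      have "(indicator \<Omega> :: _ \<Rightarrow> real) \<in> borel_measurable (completion (borel_vec n))"
        using \<Omega> by (simp add: lebesgue_vec_def)
      from completion_ex_borel_measurable_real[OF this] obtain h0 :: "real Matrix.vec \<Rightarrow> real"
        where h0[measurable]: "h0 \<in> borel_measurable (borel_vec n)" and hh0: "AE x in borel_vec n. indicator \<Omega> x = h0 x" by auto
      define \<Omega>0 where "\<Omega>0 = {x \<in> space (borel_vec n). h0 x = 1}"
      have \<Omega>0[measurable]: "\<Omega>0 \<in> sets (borel_vec n)" unfolding \<Omega>0_def by measurable
      have \<Omega>AE: "AE x in borel_vec n. x \<in> \<Omega> \<longleftrightarrow> x \<in> \<Omega>0"
        using hh0 AE_space by eventually_elim (auto simp: \<Omega>0_def indicator_def split: if_splits)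

      define g where "g z = f (T *\<^sub>v Matrix.vec n z)" for z
      define g0 where "g0 z = f0 (lin_param n T z)" for z
      define Om where "Om = {z \<in> space (leb_pi n). lin_param n T z \<in> \<Omega>0}"
      have g0m: "g0 \<in> borel_measurable (leb_pi n)" unfolding g0_def by measurable
      have Omm: "Om \<in> sets (leb_pi n)" unfolding Om_def by measurable
      have AEg: "AE z in gauss_pi n. g z = g0 z"
        using AE_gauss_pi[OF AE_lin_param[OF T det(1) ff0]] by (simp add: g_def g0_def lin_param_def)
      have AEO: "AE z in gauss_pi n. z \<in> Om \<longleftrightarrow> T *\<^sub>v Matrix.vec n z \<in> \<Omega>"
        using AE_gauss_pi[OF AE_lin_param[OF T det(1) \<Omega>AE]] AE_space
        by eventually_elim (auto simp: Om_def lin_param_def space_gauss_pi space_PiM)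

      define F where "F x = f (T *\<^sub>v x)" for x
      define S where "S = sup_box n \<rho>\<^sub>2"
      define d where "d V = real_of_ereal (Delta V F S)" for V
      have S: "S \<noteq> {}"
      proof -
        have "Matrix.vec n (\<lambda>_. 0) \<in> S" using \<rho>0 by (simp add: S_def sup_box_def)
        then show ?thesis by auto
      qed
      note DS = Delta_sum_bounds[OF S HD[folded F_def, folded S_def]]
      have cubeS: "Matrix.vec n z \<in> sup_box n r \<longleftrightarrow> z \<in> cube n r" if "z \<in> PiE {..<n} (\<lambda>_. UNIV)" for z r
        using sup_box_iff_cube[of z n r] that by (simp add: space_gauss_pi)
      have cubeP: "z \<in> PiE {..<n} (\<lambda>_. UNIV)" if "z \<in> cube n r" for z r using that by (simp add: cube_def)

      define J where "J = (\<integral>z. indicator Om z * exp (g0 z) \<partial>gauss_pi n)"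
      define \<kappa> where "\<kappa> = (\<Sum>r=1..m. fps_nth (fln (moment_series (gauss_pi n) g0 - 1)) r)"
      define rhs where "rhs = 2 * real n * (100 * \<alpha>) ^ (m + 1) + exp (- \<rho>\<^sub>1\<^sup>2 / 2)
          + 6 ^ m * ((C ^ m + C) * exp (- (\<rho>\<^sub>3\<^sup>2 - b * real m) / 2)
                   + (C' ^ m + C') * exp (- (\<rho>\<^sub>1\<^sup>2 - b' * real m) / 2))"
      have \<rho>sq: "16 * ln (real n) \<le> \<rho>\<^sub>1\<^sup>2"
        using elim(1) power_mono[OF \<rho>(3), of 2] by simp
      have gauss: "J > 0 \<and> \<bar>ln J - \<kappa>\<bar> \<le> rhs"
        unfolding J_def \<kappa>_def rhs_def
      proof (rule gaussian_cumulant_expansion[where g = g and d = d and ?\<rho>\<^sub>2.0 = \<rho>\<^sub>2 and ?\<rho>\<^sub>1.0 = \<rho>\<^sub>1 and ?\<rho>\<^sub>3.0 = \<rho>\<^sub>3 and \<alpha> = \<alpha>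
          and b = b and b' = b' and C = C and C' = C' and m = m])
        show "144 \<le> n" by (rule elim(2))
        show "1 \<le> m" using m by simp
        show "g0 \<in> borel_measurable (gauss_pi n)" using g0m by (simp only: measurable_gauss_pi)
        show "AE z in gauss_pi n. g z = g0 z" by (rule AEg)
        show "Om \<in> sets (gauss_pi n)" using Omm by (simp only: sets_gauss_pi)
        show "AE z in gauss_pi n. z \<in> cube n \<rho>\<^sub>1 \<longrightarrow> z \<in> Om"
          using AEO
        proof eventually_elim
          fix z assume z: "z \<in> Om \<longleftrightarrow> T *\<^sub>v Matrix.vec n z \<in> \<Omega>"
          show "z \<in> cube n \<rho>\<^sub>1 \<longrightarrow> z \<in> Om"
            using z cubeS[OF cubeP, of z \<rho>\<^sub>1 \<rho>\<^sub>1] in1 by blast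
        qed
        show "AE z in gauss_pi n. z \<in> Om \<longrightarrow> z \<in> cube n \<rho>\<^sub>2"
          using AEO AE_space
        proof eventually_elim
          fix z assume z: "z \<in> Om \<longleftrightarrow> T *\<^sub>v Matrix.vec n z \<in> \<Omega>" and zs: "z \<in> space (gauss_pi n)"
          have "Matrix.vec n z \<in> carrier_vec n" by simp
          then show "z \<in> Om \<longrightarrow> z \<in> cube n \<rho>\<^sub>2"
            using z cubeS[of z \<rho>\<^sub>2] zs in2 unfolding space_gauss_pi by blast
        qed
        show "0 \<le> \<rho>\<^sub>1" "\<rho>\<^sub>1 \<le> \<rho>\<^sub>2" "\<rho>\<^sub>2 \<le> \<rho>\<^sub>3" "16 * ln (real n) \<le> \<rho>\<^sub>1\<^sup>2" by (fact \<rho>0 \<rho> \<rho>sq)+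
        show "0 \<le> \<alpha>" "\<alpha> < 1 / 400" "0 \<le> b" "0 \<le> C" "0 \<le> b'" "0 \<le> C'" by (fact \<alpha>0 \<alpha>1 b0 C0)+
        show "b * real m + b\<^sup>2 * (real m)\<^sup>2 \<le> real n" "b' * real m + b'\<^sup>2 * (real m)\<^sup>2 \<le> real n" using bm by simp_all
        show "\<bar>mixed_diff V y g x\<bar> \<le> d V" if V: "V \<subseteq> {..<n}" "card V \<in> {1..m}" and xy: "x \<in> cube n \<rho>\<^sub>2" "y \<in> cube n \<rho>\<^sub>2" for V x y
        proof -
          have "mixed_diff V y g x = coord_diffs V (Matrix.vec n y) F (Matrix.vec n x)"
            using coord_diffs_eq_mixed_diff[OF finite_subset[OF V(1)] V(1), of y F x] by (simp add: F_def g_def[abs_def])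
          moreover have "ereal \<bar>coord_diffs V (Matrix.vec n y) F (Matrix.vec n x)\<bar> \<le> Delta V F S"
            using xy cubeS[OF cubeP] by (intro abs_coord_diffs_le_Delta) (auto simp: S_def)
          ultimately have "ereal \<bar>mixed_diff V y g x\<bar> \<le> ereal (d V)" using DS(1)[OF V] by (simp add: d_def)
          then show ?thesis by simp
        qed
        show "(\<Sum>V | V \<subseteq> {..<n} \<and> card V = l \<and> j \<in> V. d V) \<le> \<alpha>" if "l \<in> {1..m}" "j < n" for l j
          unfolding d_def by (rule DS(2)[OF that])
        show "\<bar>g z\<bar> \<le> C * exp (b * (\<Sum>i<n. (z i)\<^sup>2) / real n)" for z
        proof -
          have "T *\<^sub>v Matrix.vec n z \<in> carrier_vec n" using T by simp
          then show ?thesis using fb quad[of z] by (auto simp: g_def lin_param_def)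
        qed
        show "\<bar>g z\<bar> \<le> C' * exp (b' * (\<Sum>i<n. (z i)\<^sup>2) / real n)" if "z \<in> cube n \<rho>\<^sub>3" for z
        proof -
          have "Matrix.vec n z \<in> sup_box n \<rho>\<^sub>3" using that cubeS[OF cubeP[OF that], of \<rho>\<^sub>3] by blast
          then show ?thesis using fb' quad[of z] by (auto simp: g_def lin_param_def)
        qed
      qed
      then have Jpos: "J > 0" and bound: "\<bar>ln J - \<kappa>\<bar> \<le> rhs" by auto

      \<comment> \<open>It remains to see that \<open>J\<close> is the normalized integral and that \<open>f\<close> under the Gaussian law has the
        same moments as \<open>g0\<close> under independent coordinates.\<close>
      have f_c[measurable]: "f \<in> borel_measurable (completion (borel_vec n))" using f by (simp add: lebesgue_vec_def)
      have q_c[measurable]: "q \<in> borel_measurable (completion (borel_vec n))" by (rule measurable_completion[OF qm])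
      have O_c[measurable]: "\<Omega> \<in> sets (completion (borel_vec n))" using \<Omega> by (simp add: lebesgue_vec_def)
      have LHS: "(LINT x:\<Omega>|lebesgue_vec n. exp (- scalar_prod x (A *\<^sub>v x) + f x))
        = pi powr (real n / 2) * Determinant.det A powr (- 1 / 2) * J"
      proof -
        have "(LINT x:\<Omega>|lebesgue_vec n. exp (- scalar_prod x (A *\<^sub>v x) + f x)) = (\<integral>x. indicator \<Omega> x * exp (- q x + f x) \<partial>lebesgue_vec n)"
          by (simp add: set_lebesgue_integral_def q_def)
        also have "\<dots> = \<bar>Determinant.det T\<bar> * (\<integral>z. indicator \<Omega>0 (lin_param n T z) * exp (- q (lin_param n T z) + f0 (lin_param n T z)) \<partial>leb_pi n)"
        proof (rule integral_lebesgue_vec[OF T det(1)])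
          show "(\<lambda>x. indicator \<Omega> x * exp (- q x + f x)) \<in> borel_measurable (lebesgue_vec n)"
            unfolding lebesgue_vec_def by measurable
          show "(\<lambda>x. indicator \<Omega>0 x * exp (- q x + f0 x)) \<in> borel_measurable (borel_vec n)" by measurable
          show "AE x in borel_vec n. indicator \<Omega> x * exp (- q x + f x) = indicator \<Omega>0 x * exp (- q x + f0 x)"
            using ff0 \<Omega>AE by eventually_elim (auto simp: indicator_def)
        qed
        also have "(\<integral>z. indicator \<Omega>0 (lin_param n T z) * exp (- q (lin_param n T z) + f0 (lin_param n T z)) \<partial>leb_pi n)
          = (\<integral>z. exp (- (\<Sum>i<n. (z i)\<^sup>2)) * (indicator Om z * exp (g0 z)) \<partial>leb_pi n)"
          by (rule Bochner_Integration.integral_cong) (auto simp: q g0_def Om_def indicator_def mult_exp_exp)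
        also have "\<dots> = pi powr (real n / 2) * J"
        proof -
          have "J = pi powr (- (real n / 2)) * (\<integral>z. exp (- (\<Sum>i<n. (z i)\<^sup>2)) * (indicator Om z * exp (g0 z)) \<partial>leb_pi n)"
            unfolding J_def by (rule integral_gauss_pi) (use g0m Omm in measurable)
          then show ?thesis by (simp add: powr_minus)
        qed
        finally show ?thesis by (simp add: det(3))
      qed
      have RHS: "cumulant r (gaussian_vec n A) f / fact r = fps_nth (fln (moment_series (gauss_pi n) g0 - 1)) r" for r
      proof -
        define c where "c = pi powr (- (real n / 2)) * Determinant.det A powr (1 / 2)"
        have c0: "c \<ge> 0" by (simp add: c_def)
        have Tc: "\<bar>Determinant.det T\<bar> * c = pi powr (- (real n / 2))"
          using det(2) by (simp add: det(3) c_def powr_add[symmetric] mult.left_commute)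
        have "(LINT x|gaussian_vec n A. f x ^ k) = (\<integral>z. g0 z ^ k \<partial>gauss_pi n)" for k
        proof -
          have "(LINT x|gaussian_vec n A. f x ^ k) = (\<integral>x. (c * exp (- q x)) *\<^sub>R f x ^ k \<partial>lebesgue_vec n)"
            unfolding gaussian_vec_def c_def[symmetric] q_def[symmetric]
            by (rule integral_density) (use c0 in \<open>auto simp: lebesgue_vec_def\<close>)
          also have "\<dots> = \<bar>Determinant.det T\<bar> * (\<integral>z. (c * exp (- q (lin_param n T z))) * f0 (lin_param n T z) ^ k \<partial>leb_pi n)"
          proof (rule integral_lebesgue_vec[OF T det(1)])
            show "(\<lambda>x. (c * exp (- q x)) *\<^sub>R f x ^ k) \<in> borel_measurable (lebesgue_vec n)"
              unfolding lebesgue_vec_def by measurable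
            show "(\<lambda>x. (c * exp (- q x)) * f0 x ^ k) \<in> borel_measurable (borel_vec n)" by measurable
            show "AE x in borel_vec n. (c * exp (- q x)) *\<^sub>R f x ^ k = (c * exp (- q x)) * f0 x ^ k"
              using ff0 by eventually_elim simp
          qed
          also have "\<dots> = (\<bar>Determinant.det T\<bar> * c) * (\<integral>z. exp (- (\<Sum>i<n. (z i)\<^sup>2)) * g0 z ^ k \<partial>leb_pi n)"
            by (simp add: q g0_def mult.assoc)
          also have "\<dots> = (\<integral>z. g0 z ^ k \<partial>gauss_pi n)"
            unfolding Tc by (intro integral_gauss_pi[symmetric] borel_measurable_power g0m)
          finally show ?thesis .
        qed
        then have "moment_series (gaussian_vec n A) f = moment_series (gauss_pi n) g0"
          by (simp add: moment_series_def)
        then show ?thesis by (simp add: cumulant_def)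
      qed
      show "\<exists>\<delta> :: real.
        (LINT x:\<Omega>|lebesgue_vec n. exp (- scalar_prod x (A *\<^sub>v x) + f x))
          = pi powr (real n / 2) * Determinant.det A powr (- 1 / 2)
            * exp ((\<Sum>r = 1..m. cumulant r (gaussian_vec n A) f / fact r) + \<delta>) \<and>
        \<bar>\<delta>\<bar> \<le> 2 * real n * (100 * \<alpha>) ^ (m + 1) + exp (- \<rho>\<^sub>1\<^sup>2 / 2)
          + 6 ^ m * ((C ^ m + C) * exp (- (\<rho>\<^sub>3\<^sup>2 - b * real m) / 2)
                   + (C' ^ m + C') * exp (- (\<rho>\<^sub>1\<^sup>2 - b' * real m) / 2))"
      proof (intro exI[of _ "ln J - \<kappa>"] conjI)
        have "exp ((\<Sum>r = 1..m. cumulant r (gaussian_vec n A) f / fact r) + (ln J - \<kappa>)) = J"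
          using Jpos unfolding RHS \<kappa>_def[symmetric] by simp
        then show "(LINT x:\<Omega>|lebesgue_vec n. exp (- scalar_prod x (A *\<^sub>v x) + f x))
          = pi powr (real n / 2) * Determinant.det A powr (- 1 / 2)
            * exp ((\<Sum>r = 1..m. cumulant r (gaussian_vec n A) f / fact r) + (ln J - \<kappa>))"
          using LHS by simp
        show "\<bar>ln J - \<kappa>\<bar> \<le> 2 * real n * (100 * \<alpha>) ^ (m + 1) + exp (- \<rho>\<^sub>1\<^sup>2 / 2)
          + 6 ^ m * ((C ^ m + C) * exp (- (\<rho>\<^sub>3\<^sup>2 - b * real m) / 2)
                   + (C' ^ m + C') * exp (- (\<rho>\<^sub>1\<^sup>2 - b' * real m) / 2))"
          using bound unfolding rhs_def .
      qed
    qed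
  qed
qed

end
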